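(* Let $H$ be a commutative $\mathbb{Z}^n$-bigraded Hopf algebra and $A$ a $\mathbb{Z}^n$-bigraded right $H$-comodule algebra (in the sense of the context) such that $B=A^{\mathrm{co}H}\subseteq A$ is an $H$-Hopf--Galois extension with $A$ faithfully flat as a right $B$-module. Let $\theta$ be a real skew-symmetric $n\times n$ matrix and let $(H_\Theta,A_\Theta)$ be the deformed Hopf--Galois extension over $B_\Theta$. Then the Ehresmann--Schauenburg bialgebroid $\mathcal{C}(H_\Theta,A_\Theta)$, obtained by only deforming the multiplication-related structures of the Hopf algebroid $\mathcal{C}(H,A)$ over $B$ (whose antipode is the flip $S(a\otimes\tilde a)=\tilde a\otimes a$), is a Hopf algebroid over the base algebra $B_\Theta$, with antipode the flip $S(a\otimes\tilde a)=\tilde a\otimes a$.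
   Context: All algebras are unital associative over $\mathbb{C}$ and $\otimes=\otimes_{\mathbb{C}}$. A $\mathbb{Z}^n$-bigraded Hopf algebra is a Hopf algebra $H=\bigoplus_{r,s\in\mathbb{Z}^n}H_{(r,s)}$ such that: (i) $H_{(r,s)}\cdot H_{(p,q)}\subset H_{(r+p,s+q)}$; (ii) $\Delta(H_{(r,l)})\subset\bigoplus_{s\in\mathbb{Z}^n}H_{(r,s)}\otimes H_{(s,l)}$; (iii) $\varepsilon(h)=0$ for $h\in H_{(r,l)}$ with $r\ne l$; (iv) the antipode satisfies $S(H_{(r,l)})\subset H_{(-l,-r)}$ (and, if $H$ has a $*$-structure, $(H_{(r,l)})^*\subset H_{(-r,-l)}$). A $\mathbb{Z}^n$-bigraded $H$-comodule algebra is a right $H$-comodule algebra $A=\bigoplus_{r,s\in\mathbb{Z}^n}A_{(r,s)}$ with coaction $\delta^A(a)=a_{(0)}\otimes a_{(1)}$ such that $A_{(r,s)}A_{(p,q)}\subset A_{(r+p,s+q)}$ and $\delta^A(A_{(r,l)})\subset\bigoplus_{s\in\mathbb{Z}^n}A_{(r,s)}\otimes H_{(s,l)}$. Coinvariants: $A^{\mathrm{co}H}=\{b\in A:\delta^A(b)=b\otimes1_H\}$, and similarly for other coactions. Let $\lambda_\theta(r,l)=e^{\pi i\langle\theta r,l\rangle}$ for $r,l\in\mathbb{Z}^n$, with $\langle\cdot,\cdot\rangle$ the standard pairing, and $\Theta=\begin{pmatrix}\theta&0\\0&-\theta\end{pmatrix}$. On $H$ and on $A$ the deformed product of homogeneous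 elements $x,y$ of bidegrees $(r_1,r_2)$, $(l_1,l_2)$ is $x\cdot_\Theta y=\lambda_\theta(r_1,l_1)\,\lambda_{-\theta}(r_2,l_2)\,xy$, extended bilinearly; $H_\Theta=(H,\cdot_\Theta)$ is a Hopf algebra with the coproduct, counit and antipode of $H$; $A_\Theta=(A,\cdot_\Theta)$ is an $H_\Theta$-comodule algebra with the same coaction and coinvariants $B_\Theta=(B,\cdot_\Theta)$. $B=A^{\mathrm{co}H}\subseteq A$ is an $H$-Hopf--Galois extension if $\chi:A\otimes_BA\to A\otimes H$, $\tilde a\otimes_Ba\mapsto\tilde aa_{(0)}\otimes a_{(1)}$, is an isomorphism; its translation map is $\tau(h)=\chi^{-1}(1_A\otimes h)=h^{\langle1\rangle}\otimes_Bh^{\langle2\rangle}$. The deformed pair $(H_\Theta,A_\Theta)$ is again Hopf--Galois (over $B_\Theta$). Ehresmann--Schauenburg bialgebroid $\mathcal{C}(H,A)$ of a faithfully flat Hopf--Galois extension: the space $(A\otimes A)^{\mathrm{co}H}$ of coinvariants of the diagonal coaction $a\otimes\tilde a\mapsto a_{(0)}\otimes\tilde a_{(0)}\otimes a_{(1)}\tilde a_{(1)}$, with product $(x\otimes\tilde x)\bullet(y\otimes\tilde y)=xy\otimes\tilde y\tilde x$, unit $1_A\otimes1_A$, source $s(b)=b\otimes1_A$, target $t(b)=1_A\otimes b$ ($b\in B$), coproduct $\Delta(a\otimes\tilde a)=a_{(0)}\otimes a_{(1)}{}^{\langle1\rangle}\otimes_Ba_{(1)}{}^{\langle2\rangle}\otimes\tilde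 a$ and counit $\varepsilon(a\otimes\tilde a)=a\tilde a$. $\mathcal{C}(H_\Theta,A_\Theta)$ is the same construction for $(H_\Theta,A_\Theta)$, with product $(x\otimes y)\bullet_\Theta(\tilde x\otimes\tilde y)=x\cdot_\Theta\tilde x\otimes\tilde y\cdot_\Theta y$ and base algebra $B_\Theta$. As vector spaces $(A_\Theta\otimes A_\Theta)^{\mathrm{co}H_\Theta}=(A\otimes A)^{\mathrm{co}H}$; since $H$ is commutative the flip preserves this space. Left $B$-bialgebroid: an algebra $\mathcal{L}$ with algebra maps $s:B\to\mathcal{L}$, $t:B^{op}\to\mathcal{L}$ of commuting ranges, $B$-bimodule structure $b\triangleright a\triangleleft\tilde b=s(b)t(\tilde b)a$, and a $B$-coring structure $(\Delta,\varepsilon)$ such that: $\Delta$ corestricts to an algebra map into $\{\sum_ja_j\otimes_B\tilde a_j:\sum_ja_jt(b)\otimes_B\tilde a_j=\sum_ja_j\otimes_B\tilde a_js(b)\ \forall b\in B\}$; $\varepsilon(1)=1$; $\varepsilon(s(b)a)=b\varepsilon(a)$; $\varepsilon(as(\varepsilon(\tilde a)))=\varepsilon(a\tilde a)=\varepsilon(at(\varepsilon(\tilde a)))$. Hopf algebroid (with invertible antipode): a left $B$-bialgebroid $\mathcal{L}$ with an invertible algebra anti-homomorphism $S:\mathcal{L}\to\mathcal{L}$ such that $S\circ t=s$ and, for all $h\in\mathcal{L}$, $$(S^{-1}h_{(2)})_{(1')}\otimes_B(S^{-1}h_{(2)})_{(2')}h_{(1)}=S^{-1}h\otimes_B1,\qquad(Sh_{(1)})_{(1')}h_{(2)}\otimes_B(Sh_{(1)})_{(2')}=1\otimes_BSh,$$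 where $\Delta(h)=h_{(1)}\otimes_Bh_{(2)}$ and primed indices denote a further application of $\Delta$. *)

theory Defs
  imports "HOL-Analysis.Cartesian_Space" "HOL-Library.Poly_Mapping"
begin

section \<open>Complex vector spaces\<close>

class scaleC =
  fixes scaleC :: "complex \<Rightarrow> 'a \<Rightarrow> 'a" (infixr \<open>*\<^sub>C\<close> 75)

class complex_vector = scaleC + ab_group_add +
  assumes scaleC_add_right: "c *\<^sub>C (x + y) = c *\<^sub>C x + c *\<^sub>C y"
    and scaleC_add_left: "(c + d) *\<^sub>C x = c *\<^sub>C x + d *\<^sub>C x"
    and scaleC_scaleC: "c *\<^sub>C d *\<^sub>C x = (c * d) *\<^sub>C x"
    and scaleC_one: "1 *\<^sub>C x = x"

global_interpretation cvec: vector_space "scaleC :: complex \<Rightarrow> 'a \<Rightarrow> 'a :: complex_vector"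
  defines cspan = cvec.span and csubspace = cvec.subspace
  by unfold_locales (simp_all add: scaleC_add_right scaleC_add_left scaleC_scaleC scaleC_one)

abbreviation clinear :: "('a::complex_vector \<Rightarrow> 'b::complex_vector) \<Rightarrow> bool" where
  "clinear f \<equiv> Vector_Spaces.linear scaleC scaleC f"

lemma clinear_iff:
  "clinear f \<longleftrightarrow> (\<forall>x y. f (x + y) = f x + f y) \<and> (\<forall>c x. f (c *\<^sub>C x) = c *\<^sub>C f x)"
  by (simp add: Vector_Spaces.linear_iff cvec.vector_space_axioms)

lemma clinear_0: "clinear f \<Longrightarrow> f 0 = 0"
  unfolding clinear_iff by (metis add_0 add_cancel_right_right)

lemma clinear_diff: "clinear f \<Longrightarrow> f (x - y) = f x - f y"
  unfolding clinear_iff by (metis add_diff_cancel diff_add_cancel)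

lemma clinear_sum: "clinear f \<Longrightarrow> f (sum g I) = (\<Sum>i\<in>I. f (g i))"
  by (induction I rule: infinite_finite_induct) (auto simp: clinear_0 clinear_iff)

definition cbilinear ::
    "('a::complex_vector \<Rightarrow> 'b::complex_vector \<Rightarrow> 'c::complex_vector) \<Rightarrow> bool" where
  "cbilinear \<beta> \<longleftrightarrow> (\<forall>y. clinear (\<lambda>x. \<beta> x y)) \<and> (\<forall>x. clinear (\<beta> x))"

instantiation complex :: complex_vector
begin
definition scaleC_complex :: "complex \<Rightarrow> complex \<Rightarrow> complex" where
  "scaleC_complex c x = c * x"
instance by standard (simp_all add: scaleC_complex_def algebra_simps)
end

instantiation poly_mapping :: (type, complex_vector) complex_vector
begin
lift_definition scaleC_poly_mapping :: "complex \<Rightarrow> ('a \<Rightarrow>\<^sub>0 'b) \<Rightarrow> ('a \<Rightarrow>\<^sub>0 'b)"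
  is "\<lambda>c f k. c *\<^sub>C f k"
  by (rule finite_subset[rotated]) auto
instance
  by (standard; transfer)
     (simp_all add: fun_eq_iff scaleC_add_right scaleC_add_left scaleC_scaleC scaleC_one)
end


section \<open>The tensor product over the complex numbers\<close>

definition tensor_null :: "('a::complex_vector \<times> 'b::complex_vector \<Rightarrow>\<^sub>0 complex) set" where
  "tensor_null = cspan
     ({Poly_Mapping.single (x + x', y) 1 - Poly_Mapping.single (x, y) 1
        - Poly_Mapping.single (x', y) 1 | x x' y. True} \<union>
      {Poly_Mapping.single (x, y + y') 1 - Poly_Mapping.single (x, y) 1
        - Poly_Mapping.single (x, y') 1 | x y y'. True} \<union>
      {Poly_Mapping.single (c *\<^sub>C x, y) 1 - c *\<^sub>C Poly_Mapping.single (x, y) 1 | c x y. True} \<union>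
      {Poly_Mapping.single (x, c *\<^sub>C y) 1 - c *\<^sub>C Poly_Mapping.single (x, y) 1 | c x y. True})"

definition tensor_rel ::
    "('a::complex_vector \<times> 'b::complex_vector \<Rightarrow>\<^sub>0 complex) \<Rightarrow> ('a \<times> 'b \<Rightarrow>\<^sub>0 complex) \<Rightarrow> bool" where
  "tensor_rel u v \<longleftrightarrow> u - v \<in> tensor_null"

lemma tensor_null_subspace: "csubspace tensor_null"
  unfolding tensor_null_def by (rule cvec.subspace_span)

lemmas tensor_null_add = cvec.subspace_add[OF tensor_null_subspace]
  and tensor_null_diff = cvec.subspace_diff[OF tensor_null_subspace]
  and tensor_null_scale = cvec.subspace_scale[OF tensor_null_subspace]
  and tensor_null_0 = cvec.subspace_0[OF tensor_null_subspace]
  and tensor_null_neg = cvec.subspace_neg[OF tensor_null_subspace]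

quotient_type (overloaded) ('a, 'b) tensor (infixr \<open>\<otimes>\<close> 65) =
    "('a::complex_vector \<times> 'b::complex_vector) \<Rightarrow>\<^sub>0 complex" / tensor_rel
proof (intro equivpI reflpI sympI transpI)
  fix u v w :: "'a \<times> 'b \<Rightarrow>\<^sub>0 complex"
  show "tensor_rel u u" by (simp add: tensor_rel_def tensor_null_0)
  {
    assume "tensor_rel u v"
    then have "- (u - v) \<in> tensor_null" unfolding tensor_rel_def by (rule tensor_null_neg)
    then show "tensor_rel v u" by (simp add: tensor_rel_def)
  }
  assume "tensor_rel u v" "tensor_rel v w"
  then have "(u - v) + (v - w) \<in> tensor_null" unfolding tensor_rel_def by (rule tensor_null_add)
  then show "tensor_rel u w" by (simp add: tensor_rel_def)
qed

instantiation tensor :: (complex_vector, complex_vector) complex_vector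
begin
lift_definition zero_tensor :: "'a \<otimes> 'b" is 0 .
lift_definition plus_tensor :: "'a \<otimes> 'b \<Rightarrow> 'a \<otimes> 'b \<Rightarrow> 'a \<otimes> 'b" is "(+)"
  unfolding tensor_rel_def
proof -
  fix a b c d :: "'a \<times> 'b \<Rightarrow>\<^sub>0 complex"
  assume "a - b \<in> tensor_null" "c - d \<in> tensor_null"
  then have "(a - b) + (c - d) \<in> tensor_null" by (rule tensor_null_add)
  then show "a + c - (b + d) \<in> tensor_null" by (simp add: algebra_simps)
qed
lift_definition minus_tensor :: "'a \<otimes> 'b \<Rightarrow> 'a \<otimes> 'b \<Rightarrow> 'a \<otimes> 'b" is "(-)"
  unfolding tensor_rel_def
proof -
  fix a b c d :: "'a \<times> 'b \<Rightarrow>\<^sub>0 complex"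
  assume "a - b \<in> tensor_null" "c - d \<in> tensor_null"
  then have "(a - b) - (c - d) \<in> tensor_null" by (rule tensor_null_diff)
  then show "a - c - (b - d) \<in> tensor_null" by (simp add: algebra_simps)
qed
lift_definition uminus_tensor :: "'a \<otimes> 'b \<Rightarrow> 'a \<otimes> 'b" is uminus
  unfolding tensor_rel_def
proof -
  fix a b :: "'a \<times> 'b \<Rightarrow>\<^sub>0 complex"
  assume "a - b \<in> tensor_null"
  then have "- (a - b) \<in> tensor_null" by (rule tensor_null_neg)
  then show "- a - - b \<in> tensor_null" by simp
qed
lift_definition scaleC_tensor :: "complex \<Rightarrow> 'a \<otimes> 'b \<Rightarrow> 'a \<otimes> 'b" is scaleC
  unfolding tensor_rel_def
proof -
  fix c and a b :: "'a \<times> 'b \<Rightarrow>\<^sub>0 complex"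
  assume "a - b \<in> tensor_null"
  then have "c *\<^sub>C (a - b) \<in> tensor_null" by (rule tensor_null_scale)
  then show "c *\<^sub>C a - c *\<^sub>C b \<in> tensor_null" by (simp add: cvec.scale_right_diff_distrib)
qed
instance
proof
  fix a b c :: "'a \<otimes> 'b" and k l :: complex
  show "a + b + c = a + (b + c)"
    by transfer (simp add: tensor_rel_def tensor_null_0 add.assoc)
  show "a + b = b + a" by transfer (simp add: tensor_rel_def tensor_null_0 add.commute)
  show "0 + a = a" by transfer (simp add: tensor_rel_def tensor_null_0)
  show "- a + a = 0" by transfer (simp add: tensor_rel_def tensor_null_0)
  show "a - b = a + - b" by transfer (simp add: tensor_rel_def tensor_null_0)
  show "k *\<^sub>C (a + b) = k *\<^sub>C a + k *\<^sub>C b"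
    by transfer (simp add: tensor_rel_def tensor_null_0 scaleC_add_right)
  show "(k + l) *\<^sub>C a = k *\<^sub>C a + l *\<^sub>C a"
    by transfer (simp add: tensor_rel_def tensor_null_0 scaleC_add_left)
  show "k *\<^sub>C l *\<^sub>C a = (k * l) *\<^sub>C a"
    by transfer (simp add: tensor_rel_def tensor_null_0 scaleC_scaleC)
  show "1 *\<^sub>C a = a" by transfer (simp add: tensor_rel_def tensor_null_0 scaleC_one)
qed
end

lift_definition elem_tensor :: "'a::complex_vector \<Rightarrow> 'b::complex_vector \<Rightarrow> 'a \<otimes> 'b"
    (infixr \<open>\<otimes>\<close> 70)
  is "\<lambda>x y. Poly_Mapping.single (x, y) 1" .

lemma cbilinear_elem_tensor: "cbilinear elem_tensor"
proof -
  have 1: "(x + x') \<otimes> y = x \<otimes> y + x' \<otimes> y" for x x' :: 'a and y :: 'b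
    by (transfer, unfold tensor_rel_def tensor_null_def, rule cvec.span_base)
       (simp add: diff_diff_eq, blast)
  have 2: "x \<otimes> (y + y') = x \<otimes> y + x \<otimes> y'" for x :: 'a and y y' :: 'b
    by (transfer, unfold tensor_rel_def tensor_null_def, rule cvec.span_base)
       (simp add: diff_diff_eq, blast)
  have 3: "(c *\<^sub>C x) \<otimes> y = c *\<^sub>C (x \<otimes> y)" for c and x :: 'a and y :: 'b
    by (transfer, unfold tensor_rel_def tensor_null_def, rule cvec.span_base) blast
  have 4: "x \<otimes> (c *\<^sub>C y) = c *\<^sub>C (x \<otimes> y)" for c and x :: 'a and y :: 'b
    by (transfer, unfold tensor_rel_def tensor_null_def, rule cvec.span_base) blast
  show ?thesis by (simp add: cbilinear_def clinear_iff 1 2 3 4)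
qed

text \<open>The linear map on a tensor product induced by a bilinear map; the lemmas
  \<open>tlift_tensor\<close>, \<open>clinear_tlift\<close> and \<open>tensor_ext\<close> below are the universal property.\<close>

definition tlift :: "('a::complex_vector \<Rightarrow> 'b::complex_vector \<Rightarrow> 'c::complex_vector)
    \<Rightarrow> 'a \<otimes> 'b \<Rightarrow> 'c" where
  "tlift \<beta> = (THE f. clinear f \<and> (\<forall>x y. f (x \<otimes> y) = \<beta> x y))"

lemma span_elem_tensor: "t \<in> cspan {x \<otimes> y | x y. True}"
  for t :: "'a::complex_vector \<otimes> 'b::complex_vector"
proof -
  have abs_add: "abs_tensor (u + v) = abs_tensor u + abs_tensor v"
    for u v :: "'a \<times> 'b \<Rightarrow>\<^sub>0 complex" by (simp add: plus_tensor.abs_eq)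
  have abs_scale: "abs_tensor (c *\<^sub>C u) = c *\<^sub>C abs_tensor u"
    for c and u :: "'a \<times> 'b \<Rightarrow>\<^sub>0 complex" by (simp add: scaleC_tensor.abs_eq)
  have lin: "clinear (abs_tensor :: ('a \<times> 'b \<Rightarrow>\<^sub>0 complex) \<Rightarrow> _)"
    by (simp add: clinear_iff abs_add abs_scale)
  obtain u where u: "t = abs_tensor u" by (metis Quotient3_abs_rep Quotient3_tensor)
  have "u = (\<Sum>k\<in>Poly_Mapping.keys u.
      Poly_Mapping.lookup u k *\<^sub>C Poly_Mapping.single k (1::complex))"
    by (rule poly_mapping_eqI)
       (simp add: lookup_sum scaleC_poly_mapping.rep_eq scaleC_complex_def lookup_single
          when_def in_keys_iff if_distrib cong: if_cong)
  then have "t = (\<Sum>k\<in>Poly_Mapping.keys u.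
      Poly_Mapping.lookup u k *\<^sub>C abs_tensor (Poly_Mapping.single k 1))"
    by (metis (mono_tags, lifting) u clinear_sum[OF lin] abs_scale sum.cong)
  moreover have "abs_tensor (Poly_Mapping.single k 1) \<in> cspan {x \<otimes> y | x y. True}"
    for k :: "'a \<times> 'b"
    by (cases k) (auto intro!: cvec.span_base simp: elem_tensor.abs_eq)
  ultimately show "t \<in> cspan {x \<otimes> y | x y. True}"
    by (auto intro!: cvec.span_sum cvec.span_scale)
qed

lemma tensor_ext:
  fixes f g :: "'a::complex_vector \<otimes> 'b::complex_vector \<Rightarrow> 'c::complex_vector"
  assumes "clinear f" "clinear g" "\<And>x y. f (x \<otimes> y) = g (x \<otimes> y)"
  shows "f = g"
proof
  fix t :: "'a \<otimes> 'b"
  have "t \<in> cspan {x \<otimes> y | x y. True}" by (rule span_elem_tensor)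
  then show "f t = g t"
  proof (induction rule: cvec.span_induct_alt)
    case base
    show ?case using assms(1,2) by (simp add: clinear_0)
  next
    case (step c x y)
    then show ?case using assms by (auto simp: clinear_iff)
  qed
qed

lemma tlift_exists:
  fixes \<beta> :: "'a::complex_vector \<Rightarrow> 'b::complex_vector \<Rightarrow> 'c::complex_vector"
  assumes "cbilinear \<beta>"
  shows "\<exists>f. clinear f \<and> (\<forall>x y. f (x \<otimes> y) = \<beta> x y)"
proof -
  define g where "g u = (\<Sum>k\<in>Poly_Mapping.keys u.
      Poly_Mapping.lookup u k *\<^sub>C \<beta> (fst k) (snd k))" for u :: "'a \<times> 'b \<Rightarrow>\<^sub>0 complex"
  have g_eq: "g u = (\<Sum>k\<in>K. Poly_Mapping.lookup u k *\<^sub>C \<beta> (fst k) (snd k))"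
    if "finite K" "Poly_Mapping.keys u \<subseteq> K" for K u
    unfolding g_def using that by (intro sum.mono_neutral_left) (auto simp: in_keys_iff)
  have "g (u + v) = g u + g v" for u v
  proof -
    let ?K = "Poly_Mapping.keys u \<union> Poly_Mapping.keys v"
    have "finite ?K" "Poly_Mapping.keys (u + v) \<subseteq> ?K"
      by (simp_all add: Poly_Mapping.keys_add)
    then show ?thesis
      by (simp add: g_eq[of ?K] lookup_add scaleC_add_left sum.distrib)
  qed
  moreover have "g (c *\<^sub>C u) = c *\<^sub>C g u" for c u
  proof -
    have "Poly_Mapping.keys (c *\<^sub>C u) \<subseteq> Poly_Mapping.keys u"
      by (auto simp: in_keys_iff scaleC_poly_mapping.rep_eq)
    then show ?thesis
      by (simp add: g_eq[of "Poly_Mapping.keys u"] scaleC_poly_mapping.rep_eq scaleC_complex_def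
          scaleC_scaleC cvec.scale_sum_right)
  qed
  ultimately have lin: "clinear g" by (simp add: clinear_iff)
  have g1: "g (Poly_Mapping.single (x, y) 1) = \<beta> x y" for x y
    by (simp add: g_def scaleC_one)
  have g0: "g u = 0" if "u \<in> tensor_null" for u
    using that unfolding tensor_null_def
  proof (induction rule: cvec.span_induct_alt)
    case base
    show ?case using lin by (rule clinear_0)
  next
    case (step c x y)
    have "g x = 0"
      using step(1) assms lin
      by (auto simp: clinear_diff[OF lin] g1 cbilinear_def clinear_iff)
    then show ?case using step lin by (simp add: clinear_iff)
  qed
  have g_cong: "g u = g v" if "tensor_rel u v" for u v
    using g0[of "u - v"] that by (simp add: tensor_rel_def clinear_diff[OF lin])
  have gabs: "g (rep_tensor (abs_tensor u)) = g u" for u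
    by (rule g_cong) (simp add: tensor.abs_eq_iff[symmetric] Quotient3_abs_rep[OF Quotient3_tensor])
  have abs_rep: "abs_tensor (rep_tensor t) = t" for t :: "'a \<otimes> 'b"
    by (rule Quotient3_abs_rep[OF Quotient3_tensor])
  let ?f = "\<lambda>t. g (rep_tensor t)"
  have "?f (s + t) = ?f s + ?f t" for s t
  proof -
    obtain u v where "s = abs_tensor u" "t = abs_tensor v"
      using abs_rep by metis
    then show ?thesis using lin by (simp add: plus_tensor.abs_eq gabs clinear_iff)
  qed
  moreover have "?f (c *\<^sub>C t) = c *\<^sub>C ?f t" for c t
  proof -
    obtain u where "t = abs_tensor u"
      using abs_rep by metis
    then show ?thesis using lin by (simp add: scaleC_tensor.abs_eq gabs clinear_iff)
  qed
  moreover have "?f (x \<otimes> y) = \<beta> x y" for x y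
    by (simp add: elem_tensor.abs_eq gabs g1)
  ultimately show ?thesis by (intro exI[of _ ?f]) (simp add: clinear_iff)
qed

lemma tlift_props:
  fixes \<beta> :: "'a::complex_vector \<Rightarrow> 'b::complex_vector \<Rightarrow> 'c::complex_vector"
  assumes "cbilinear \<beta>"
  shows "clinear (tlift \<beta>) \<and> (\<forall>x y. tlift \<beta> (x \<otimes> y) = \<beta> x y)"
proof -
  have "\<exists>!f. clinear f \<and> (\<forall>x y. f (x \<otimes> y) = \<beta> x y)"
  proof (rule ex_ex1I[OF tlift_exists[OF assms]])
    fix f g
    assume "clinear f \<and> (\<forall>x y. f (x \<otimes> y) = \<beta> x y)" "clinear g \<and> (\<forall>x y. g (x \<otimes> y) = \<beta> x y)"
    then show "f = g" by (intro tensor_ext) simp_all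
  qed
  from theI'[OF this] show ?thesis unfolding tlift_def .
qed

lemma clinear_tlift: "cbilinear \<beta> \<Longrightarrow> clinear (tlift \<beta>)"
  and tlift_tensor: "cbilinear \<beta> \<Longrightarrow> tlift \<beta> (x \<otimes> y) = \<beta> x y"
  using tlift_props[of \<beta>] by simp_all

definition tmap :: "('a::complex_vector \<Rightarrow> 'c::complex_vector) \<Rightarrow>
    ('b::complex_vector \<Rightarrow> 'd::complex_vector) \<Rightarrow> 'a \<otimes> 'b \<Rightarrow> 'c \<otimes> 'd" where
  "tmap f g = tlift (\<lambda>x y. f x \<otimes> g y)"

definition tflip :: "'a::complex_vector \<otimes> 'b::complex_vector \<Rightarrow> 'b \<otimes> 'a" where
  "tflip = tlift (\<lambda>x y. y \<otimes> x)"

definition tassoc :: "('a::complex_vector \<otimes> 'b::complex_vector) \<otimes> 'c::complex_vector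
    \<Rightarrow> 'a \<otimes> ('b \<otimes> 'c)" where
  "tassoc = tlift (\<lambda>u z. tlift (\<lambda>x y. x \<otimes> (y \<otimes> z)) u)"

definition tlift2 :: "('a::complex_vector \<Rightarrow> 'b::complex_vector \<Rightarrow> 'c::complex_vector \<Rightarrow>
    'd::complex_vector \<Rightarrow> 'e::complex_vector) \<Rightarrow> 'a \<otimes> 'b \<Rightarrow> 'c \<otimes> 'd \<Rightarrow> 'e" where
  "tlift2 \<phi> u v = tlift (\<lambda>x y. tlift (\<lambda>x' y'. \<phi> x y x' y') v) u"

definition tmult :: "('a::complex_vector \<Rightarrow> 'a \<Rightarrow> 'a) \<Rightarrow> ('b::complex_vector \<Rightarrow> 'b \<Rightarrow> 'b)
    \<Rightarrow> 'a \<otimes> 'b \<Rightarrow> 'a \<otimes> 'b \<Rightarrow> 'a \<otimes> 'b" where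
  "tmult m m' = tlift2 (\<lambda>x y x' y'. m x x' \<otimes> m' y y')"

text \<open>For subspaces \<open>M\<close>, \<open>N\<close> the product of \<open>M\<close> and \<open>N\<close> over the complex numbers is the
  subspace \<open>tens M N\<close> of the tensor product of the ambient spaces.  The tensor product over an
  algebra \<open>B\<close>, acting on \<open>M\<close> from the right by \<open>ra\<close> and on \<open>N\<close> from the left by \<open>la\<close>, is the
  quotient of \<open>tens M N\<close> by \<open>balance B ra la M N\<close>; its elements are cosets.\<close>

definition tens :: "'m::complex_vector set \<Rightarrow> 'n::complex_vector set \<Rightarrow> ('m \<otimes> 'n) set" where
  "tens M N = cspan {x \<otimes> y | x y. x \<in> M \<and> y \<in> N}"

definition balance :: "'b set \<Rightarrow> ('m::complex_vector \<Rightarrow> 'b \<Rightarrow> 'm) \<Rightarrow>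
    ('b \<Rightarrow> 'n::complex_vector \<Rightarrow> 'n) \<Rightarrow> 'm set \<Rightarrow> 'n set \<Rightarrow> ('m \<otimes> 'n) set" where
  "balance B ra la M N =
     cspan {ra x b \<otimes> y - x \<otimes> la b y | x b y. x \<in> M \<and> b \<in> B \<and> y \<in> N}"

definition coset :: "'a::ab_group_add set \<Rightarrow> 'a \<Rightarrow> 'a set" where
  "coset U w = (\<lambda>u. w + u) ` U"

definition btensor :: "'b set \<Rightarrow> ('m::complex_vector \<Rightarrow> 'b \<Rightarrow> 'm) \<Rightarrow>
    ('b \<Rightarrow> 'n::complex_vector \<Rightarrow> 'n) \<Rightarrow> 'm set \<Rightarrow> 'n set \<Rightarrow> ('m \<otimes> 'n) set set" where
  "btensor B ra la M N = coset (balance B ra la M N) ` tens M N"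


section \<open>Algebras, Hopf algebras, comodule algebras\<close>

record 'a alg =
  mult :: "'a \<Rightarrow> 'a \<Rightarrow> 'a"
  unity :: 'a

record (overloaded) ('h::complex_vector) hopf = "'h alg" +
  comul :: "'h \<Rightarrow> 'h \<otimes> 'h"
  counit :: "'h \<Rightarrow> complex"
  antipode :: "'h \<Rightarrow> 'h"

record (overloaded) ('a::complex_vector, 'h::complex_vector) comod = "'a alg" +
  coact :: "'a \<Rightarrow> 'a \<otimes> 'h"

text \<open>An algebra whose underlying space is the subspace \<open>X\<close>.  Linear and bilinear maps on a
  subspace extend to the ambient space, so asking for linearity of structure maps on the whole
  type is no restriction; their values off the carrier play no role.\<close>

definition algebra_on :: "'a::complex_vector set \<Rightarrow> ('a, 'z) alg_scheme \<Rightarrow> bool" where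
  "algebra_on X A \<longleftrightarrow> csubspace X \<and> cbilinear (mult A) \<and> unity A \<in> X \<and>
     (\<forall>x\<in>X. \<forall>y\<in>X. mult A x y \<in> X) \<and>
     (\<forall>x\<in>X. \<forall>y\<in>X. \<forall>z\<in>X. mult A (mult A x y) z = mult A x (mult A y z)) \<and>
     (\<forall>x\<in>X. mult A (unity A) x = x \<and> mult A x (unity A) = x)"

locale hopf_algebra =
  fixes H :: "('h::complex_vector) hopf"
  assumes algebra: "algebra_on UNIV H"
    and comul_linear: "clinear (comul H)"
    and counit_linear: "clinear (counit H)"
    and antipode_linear: "clinear (antipode H)"
    and coassoc: "tassoc (tmap (comul H) id (comul H x)) = tmap id (comul H) (comul H x)"
    and counit_left: "tlift (\<lambda>y z. counit H y *\<^sub>C z) (comul H x) = x"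
    and counit_right: "tlift (\<lambda>y z. counit H z *\<^sub>C y) (comul H x) = x"
    and comul_mult: "comul H (mult H x y) = tmult (mult H) (mult H) (comul H x) (comul H y)"
    and comul_unity: "comul H (unity H) = unity H \<otimes> unity H"
    and counit_mult: "counit H (mult H x y) = counit H x * counit H y"
    and counit_unity: "counit H (unity H) = 1"
    and antipode_left:
      "tlift (\<lambda>y z. mult H (antipode H y) z) (comul H x) = counit H x *\<^sub>C unity H"
    and antipode_right:
      "tlift (\<lambda>y z. mult H y (antipode H z)) (comul H x) = counit H x *\<^sub>C unity H"

locale comodule_algebra = hopf_algebra H for H :: "('h::complex_vector) hopf" +
  fixes A :: "('a::complex_vector, 'h) comod"
  assumes comod_algebra: "algebra_on UNIV A"
    and coact_linear: "clinear (coact A)"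
    and coact_coassoc: "tassoc (tmap (coact A) id (coact A a)) = tmap id (comul H) (coact A a)"
    and coact_counit: "tlift (\<lambda>x h. counit H h *\<^sub>C x) (coact A a) = a"
    and coact_mult: "coact A (mult A a a') = tmult (mult A) (mult H) (coact A a) (coact A a')"
    and coact_unity: "coact A (unity A) = unity A \<otimes> unity H"

definition coinvariants :: "('h::complex_vector) hopf \<Rightarrow> ('a::complex_vector, 'h) comod \<Rightarrow> 'a set"
  where "coinvariants H A = {b. coact A b = b \<otimes> unity H}"


section \<open>Hopf-Galois extensions\<close>

abbreviation A_tensor_B_A ::
    "('h::complex_vector) hopf \<Rightarrow> ('a::complex_vector, 'h) comod \<Rightarrow> ('a \<otimes> 'a) set set" where
  "A_tensor_B_A H A \<equiv> btensor (coinvariants H A) (mult A) (mult A) UNIV UNIV"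

text \<open>The canonical map, first on the tensor product over the complex numbers, then on classes
  (it is constant on each class).\<close>

definition can_lift :: "('a::complex_vector, 'h::complex_vector) comod \<Rightarrow> 'a \<otimes> 'a \<Rightarrow> 'a \<otimes> 'h" where
  "can_lift A = tlift (\<lambda>x a. tmap (mult A x) id (coact A a))"

definition can :: "('a::complex_vector, 'h::complex_vector) comod \<Rightarrow> ('a \<otimes> 'a) set \<Rightarrow> 'a \<otimes> 'h" where
  "can A X = the_elem (can_lift A ` X)"

definition hopf_galois ::
    "('h::complex_vector) hopf \<Rightarrow> ('a::complex_vector, 'h) comod \<Rightarrow> bool" where
  "hopf_galois H A \<longleftrightarrow> comodule_algebra H A \<and> bij_betw (can A) (A_tensor_B_A H A) UNIV"

definition translation ::
    "('h::complex_vector) hopf \<Rightarrow> ('a::complex_vector, 'h) comod \<Rightarrow> 'h \<Rightarrow> ('a \<otimes> 'a) set" where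
  "translation H A h = inv_into (A_tensor_B_A H A) (can A) (unity A \<otimes> h)"


section \<open>Faithful flatness\<close>

definition left_module :: "('a::complex_vector, 'z) alg_scheme \<Rightarrow> 'a set \<Rightarrow>
    'm::complex_vector set \<Rightarrow> ('a \<Rightarrow> 'm \<Rightarrow> 'm) \<Rightarrow> bool" where
  "left_module A B M act \<longleftrightarrow> csubspace M \<and>
     (\<forall>b\<in>B. \<forall>x\<in>M. act b x \<in> M) \<and>
     (\<forall>b\<in>B. \<forall>x\<in>M. \<forall>y\<in>M. act b (x + y) = act b x + act b y) \<and>
     (\<forall>b\<in>B. \<forall>b'\<in>B. \<forall>x\<in>M. act (b + b') x = act b x + act b' x) \<and>
     (\<forall>c. \<forall>b\<in>B. \<forall>x\<in>M. act (c *\<^sub>C b) x = c *\<^sub>C act b x \<and> act b (c *\<^sub>C x) = c *\<^sub>C act b x) \<and>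
     (\<forall>b\<in>B. \<forall>b'\<in>B. \<forall>x\<in>M. act (mult A b b') x = act b (act b' x)) \<and>
     (\<forall>x\<in>M. act (unity A) x = x)"

definition left_module_hom :: "'a set \<Rightarrow> 'm::complex_vector set \<Rightarrow> ('a \<Rightarrow> 'm \<Rightarrow> 'm) \<Rightarrow>
    'm set \<Rightarrow> ('a \<Rightarrow> 'm \<Rightarrow> 'm) \<Rightarrow> ('m \<Rightarrow> 'm) \<Rightarrow> bool" where
  "left_module_hom B M act N act' f \<longleftrightarrow> clinear f \<and> f ` M \<subseteq> N \<and>
     (\<forall>b\<in>B. \<forall>x\<in>M. f (act b x) = act' b (f x))"

text \<open>The algebra \<open>A\<close> is faithfully flat as a right module over its subalgebra \<open>B\<close>: a sequence
  of left \<open>B\<close>-modules is exact at the middle term iff it is so after tensoring with \<open>A\<close>.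
  The quantification over modules has to stay inside one type: the modules are taken on
  subspaces of the free vector space on the set of lists over \<open>A\<close>, i.e. they are, up to
  isomorphism, all modules whose dimension is at most the cardinality of the set of these lists.
  This suffices: by a Loewenheim-Skolem argument, a sequence violating the condition contains a
  sequence of submodules that violates it and whose terms have at most the cardinality of \<open>A\<close>
  (for nonzero \<open>A\<close>; for \<open>A = 0\<close> all modules vanish).\<close>

definition faithfully_flat :: "('a::complex_vector, 'z) alg_scheme \<Rightarrow> 'a set \<Rightarrow> bool" where
  "faithfully_flat A B \<longleftrightarrow>
     (\<forall>(M1 :: ('a list \<Rightarrow>\<^sub>0 complex) set) M2 M3 act1 act2 act3 f g.
        left_module A B M1 act1 \<and> left_module A B M2 act2 \<and> left_module A B M3 act3 \<and>
        left_module_hom B M1 act1 M2 act2 f \<and> left_module_hom B M2 act2 M3 act3 g \<longrightarrow>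
        (f ` M1 = {y \<in> M2. g y = 0} \<longleftrightarrow>
         (let U2 = balance B (mult A) act2 UNIV M2; U3 = balance B (mult A) act3 UNIV M3
          in {coset U2 (tmap id f w) | w. w \<in> tens UNIV M1} =
             {coset U2 w | w. w \<in> tens UNIV M2 \<and> coset U3 (tmap id g w) = coset U3 0})))"


section \<open>Bigradings and the deformation\<close>

type_synonym 'n bideg = "(int ^ 'n) \<times> (int ^ 'n)"

definition decomposition :: "('d \<Rightarrow> 'v::complex_vector set) \<Rightarrow> 'v \<Rightarrow> ('d \<Rightarrow>\<^sub>0 'v) \<Rightarrow> bool" where
  "decomposition G x f \<longleftrightarrow> (\<forall>d. Poly_Mapping.lookup f d \<in> G d) \<and>
     x = (\<Sum>d\<in>Poly_Mapping.keys f. Poly_Mapping.lookup f d)"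

definition direct_sum :: "('d \<Rightarrow> 'v::complex_vector set) \<Rightarrow> bool" where
  "direct_sum G \<longleftrightarrow> (\<forall>d. csubspace (G d)) \<and> (\<forall>x. \<exists>!f. decomposition G x f)"

definition components :: "('d \<Rightarrow> 'v::complex_vector set) \<Rightarrow> 'v \<Rightarrow> ('d \<Rightarrow>\<^sub>0 'v)" where
  "components G x = (THE f. decomposition G x f)"

locale bigraded_hopf_algebra = hopf_algebra H for H :: "('h::complex_vector) hopf" +
  fixes G :: "'n::finite bideg \<Rightarrow> 'h set"
  assumes graded: "direct_sum G"
    and graded_mult: "x \<in> G (r, s) \<Longrightarrow> y \<in> G (p, q) \<Longrightarrow> mult H x y \<in> G (r + p, s + q)"
    and graded_comul:
      "x \<in> G (r, l) \<Longrightarrow> comul H x \<in> cspan (\<Union>s. {y \<otimes> z | y z. y \<in> G (r, s) \<and> z \<in> G (s, l)})"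
    and graded_counit: "x \<in> G (r, l) \<Longrightarrow> r \<noteq> l \<Longrightarrow> counit H x = 0"
    and graded_antipode: "x \<in> G (r, l) \<Longrightarrow> antipode H x \<in> G (- l, - r)"

locale bigraded_comodule_algebra = comodule_algebra H A
  for H :: "('h::complex_vector) hopf" and A :: "('a::complex_vector, 'h) comod" +
  fixes GH :: "'n::finite bideg \<Rightarrow> 'h set" and GA :: "'n bideg \<Rightarrow> 'a set"
  assumes comod_graded: "direct_sum GA"
    and comod_graded_mult:
      "x \<in> GA (r, s) \<Longrightarrow> y \<in> GA (p, q) \<Longrightarrow> mult A x y \<in> GA (r + p, s + q)"
    and graded_coact:
      "x \<in> GA (r, l) \<Longrightarrow> coact A x \<in> cspan (\<Union>s. {y \<otimes> z | y z. y \<in> GA (r, s) \<and> z \<in> GH (s, l)})"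

definition phase :: "real ^ 'n ^ 'n \<Rightarrow> int ^ 'n::finite \<Rightarrow> int ^ 'n \<Rightarrow> complex" where
  "phase \<theta> r l =
     exp (\<i> * of_real (pi * ((\<theta> *v (\<chi> i. real_of_int (r $ i))) \<bullet> (\<chi> i. real_of_int (l $ i)))))"

definition deformed_mult :: "real ^ 'n ^ 'n \<Rightarrow> ('n::finite bideg \<Rightarrow> 'a::complex_vector set) \<Rightarrow>
    ('a \<Rightarrow> 'a \<Rightarrow> 'a) \<Rightarrow> 'a \<Rightarrow> 'a \<Rightarrow> 'a" where
  "deformed_mult \<theta> G m x y =
     (\<Sum>(r1, r2)\<in>Poly_Mapping.keys (components G x).
      \<Sum>(l1, l2)\<in>Poly_Mapping.keys (components G y).
        (phase \<theta> r1 l1 * phase (- \<theta>) r2 l2) *\<^sub>C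
        m (Poly_Mapping.lookup (components G x) (r1, r2))
          (Poly_Mapping.lookup (components G y) (l1, l2)))"

definition deform :: "real ^ 'n ^ 'n \<Rightarrow> ('n::finite bideg \<Rightarrow> 'a::complex_vector set) \<Rightarrow>
    ('a, 'z) alg_scheme \<Rightarrow> ('a, 'z) alg_scheme" where
  "deform \<theta> G A = A\<lparr>mult := deformed_mult \<theta> G (mult A)\<rparr>"


section \<open>Bialgebroids and Hopf algebroids\<close>

text \<open>The base algebra \<open>B\<close> and the total algebra \<open>L\<close> have carriers; the coproduct takes values
  in the set of classes that make up the tensor product of \<open>L\<close> with itself over \<open>B\<close>.\<close>

record (overloaded) ('b, 'l::complex_vector) bialgebroid =
  base_carrier :: "'b set"
  base :: "'b alg"
  total_carrier :: "'l set"
  total :: "'l alg"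
  src :: "'b \<Rightarrow> 'l"
  tgt :: "'b \<Rightarrow> 'l"
  cop :: "'l \<Rightarrow> ('l \<otimes> 'l) set"
  cou :: "'l \<Rightarrow> 'b"

abbreviation lact :: "('b, 'l::complex_vector) bialgebroid \<Rightarrow> 'b \<Rightarrow> 'l \<Rightarrow> 'l" where
  "lact L b x \<equiv> mult (total L) (src L b) x"

abbreviation ract :: "('b, 'l::complex_vector) bialgebroid \<Rightarrow> 'l \<Rightarrow> 'b \<Rightarrow> 'l" where
  "ract L x b \<equiv> mult (total L) (tgt L b) x"

definition class2 :: "('b, 'l::complex_vector) bialgebroid \<Rightarrow> 'l \<otimes> 'l \<Rightarrow> ('l \<otimes> 'l) set" where
  "class2 L = coset (balance (base_carrier L) (ract L) (lact L) (total_carrier L) (total_carrier L))"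

definition class3 :: "('b, 'l::complex_vector) bialgebroid \<Rightarrow>
    'l \<otimes> 'l \<otimes> 'l \<Rightarrow> ('l \<otimes> 'l \<otimes> 'l) set" where
  "class3 L = coset (cspan
     ({ract L x b \<otimes> y \<otimes> z - x \<otimes> lact L b y \<otimes> z | x y z b. x \<in> total_carrier L \<and>
        y \<in> total_carrier L \<and> z \<in> total_carrier L \<and> b \<in> base_carrier L} \<union>
      {x \<otimes> ract L y b \<otimes> z - x \<otimes> y \<otimes> lact L b z | x y z b. x \<in> total_carrier L \<and>
        y \<in> total_carrier L \<and> z \<in> total_carrier L \<and> b \<in> base_carrier L}))"

text \<open>A linear map to a quotient of vector spaces lifts through the projection, so the existence
  of \<open>D\<close> below says exactly that the coproduct is a linear map from the carrier of \<open>L\<close> to the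
  tensor product over \<open>B\<close>.  Lifts represent the coproduct in Sweedler-type formulas.\<close>

definition cop_lift :: "('b, 'l::complex_vector) bialgebroid \<Rightarrow> ('l \<Rightarrow> 'l \<otimes> 'l) \<Rightarrow> bool" where
  "cop_lift L D \<longleftrightarrow> clinear D \<and>
     (\<forall>x\<in>total_carrier L. D x \<in> tens (total_carrier L) (total_carrier L) \<and> cop L x = class2 L (D x))"

locale left_bialgebroid =
  fixes L :: "('b::complex_vector, 'l::complex_vector) bialgebroid"
  assumes base_algebra: "algebra_on (base_carrier L) (base L)"
    and total_algebra: "algebra_on (total_carrier L) (total L)"
    and src_linear: "clinear (src L)"
    and src_closed: "b \<in> base_carrier L \<Longrightarrow> src L b \<in> total_carrier L"
    and src_mult: "b \<in> base_carrier L \<Longrightarrow> b' \<in> base_carrier L \<Longrightarrow>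
      src L (mult (base L) b b') = mult (total L) (src L b) (src L b')"
    and src_unity: "src L (unity (base L)) = unity (total L)"
    and tgt_linear: "clinear (tgt L)"
    and tgt_closed: "b \<in> base_carrier L \<Longrightarrow> tgt L b \<in> total_carrier L"
    and tgt_mult: "b \<in> base_carrier L \<Longrightarrow> b' \<in> base_carrier L \<Longrightarrow>
      tgt L (mult (base L) b b') = mult (total L) (tgt L b') (tgt L b)"
    and tgt_unity: "tgt L (unity (base L)) = unity (total L)"
    and src_tgt_commute: "b \<in> base_carrier L \<Longrightarrow> b' \<in> base_carrier L \<Longrightarrow>
      mult (total L) (src L b) (tgt L b') = mult (total L) (tgt L b') (src L b)"
    \<comment> \<open>\<open>B\<close>-coring\<close>
    and cop_linear: "\<exists>D. cop_lift L D"
    and cop_bimodule: "cop_lift L D \<Longrightarrow> x \<in> total_carrier L \<Longrightarrow>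
      b \<in> base_carrier L \<Longrightarrow> b' \<in> base_carrier L \<Longrightarrow>
      cop L (ract L (lact L b x) b') = class2 L (tmap (lact L b) (\<lambda>y. ract L y b') (D x))"
    and cop_coassoc: "cop_lift L D \<Longrightarrow> x \<in> total_carrier L \<Longrightarrow>
      class3 L (tassoc (tmap D id (D x))) = class3 L (tmap id D (D x))"
    and cou_linear: "clinear (cou L)"
    and cou_closed: "x \<in> total_carrier L \<Longrightarrow> cou L x \<in> base_carrier L"
    and cou_bimodule: "x \<in> total_carrier L \<Longrightarrow> b \<in> base_carrier L \<Longrightarrow> b' \<in> base_carrier L \<Longrightarrow>
      cou L (ract L (lact L b x) b') = mult (base L) (mult (base L) b (cou L x)) b'"
    and cou_left: "cop_lift L D \<Longrightarrow> x \<in> total_carrier L \<Longrightarrow>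
      tlift (\<lambda>y z. lact L (cou L y) z) (D x) = x"
    and cou_right: "cop_lift L D \<Longrightarrow> x \<in> total_carrier L \<Longrightarrow>
      tlift (\<lambda>y z. ract L y (cou L z)) (D x) = x"
    \<comment> \<open>the coproduct is an algebra map into the Takeuchi product\<close>
    and cop_takeuchi: "cop_lift L D \<Longrightarrow> x \<in> total_carrier L \<Longrightarrow> b \<in> base_carrier L \<Longrightarrow>
      class2 L (tmap (\<lambda>y. mult (total L) y (tgt L b)) id (D x)) =
      class2 L (tmap id (\<lambda>z. mult (total L) z (src L b)) (D x))"
    and cop_mult: "cop_lift L D \<Longrightarrow> x \<in> total_carrier L \<Longrightarrow> y \<in> total_carrier L \<Longrightarrow>
      cop L (mult (total L) x y) =
      class2 L (tmult (mult (total L)) (mult (total L)) (D x) (D y))"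
    and cop_unity: "cop L (unity (total L)) = class2 L (unity (total L) \<otimes> unity (total L))"
    \<comment> \<open>the counit\<close>
    and cou_unity: "cou L (unity (total L)) = unity (base L)"
    and cou_lact: "x \<in> total_carrier L \<Longrightarrow> b \<in> base_carrier L \<Longrightarrow>
      cou L (mult (total L) (src L b) x) = mult (base L) b (cou L x)"
    and cou_mult_src: "x \<in> total_carrier L \<Longrightarrow> y \<in> total_carrier L \<Longrightarrow>
      cou L (mult (total L) x (src L (cou L y))) = cou L (mult (total L) x y)"
    and cou_mult_tgt: "x \<in> total_carrier L \<Longrightarrow> y \<in> total_carrier L \<Longrightarrow>
      cou L (mult (total L) x (tgt L (cou L y))) = cou L (mult (total L) x y)"

text \<open>In the last two axioms \<open>S'\<close> is any linear map that inverts \<open>S\<close> on the carrier of \<open>L\<close>; such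
  maps exist since \<open>S\<close> is linear and bijective there.\<close>

locale hopf_algebroid = left_bialgebroid L
  for L :: "('b::complex_vector, 'l::complex_vector) bialgebroid" +
  fixes S :: "'l \<Rightarrow> 'l"
  assumes S_linear: "clinear S"
    and S_bij: "bij_betw S (total_carrier L) (total_carrier L)"
    and S_mult: "x \<in> total_carrier L \<Longrightarrow> y \<in> total_carrier L \<Longrightarrow>
      S (mult (total L) x y) = mult (total L) (S y) (S x)"
    and S_unity: "S (unity (total L)) = unity (total L)"
    and S_tgt: "b \<in> base_carrier L \<Longrightarrow> S (tgt L b) = src L b"
    and S_inv_axiom: "cop_lift L D \<Longrightarrow> clinear S' \<Longrightarrow> (\<And>x. x \<in> total_carrier L \<Longrightarrow> S' (S x) = x) \<Longrightarrow>
      h \<in> total_carrier L \<Longrightarrow>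
      class2 L (tlift (\<lambda>h1 h2. tmap id (\<lambda>z. mult (total L) z h1) (D (S' h2))) (D h)) =
      class2 L (S' h \<otimes> unity (total L))"
    and S_axiom: "cop_lift L D \<Longrightarrow> h \<in> total_carrier L \<Longrightarrow>
      class2 L (tlift (\<lambda>h1 h2. tmap (\<lambda>y. mult (total L) y h2) id (D (S h1))) (D h)) =
      class2 L (unity (total L) \<otimes> S h)"


section \<open>The Ehresmann-Schauenburg bialgebroid\<close>

definition diagonal_coact :: "('h::complex_vector) hopf \<Rightarrow> ('a::complex_vector, 'h) comod \<Rightarrow>
    'a \<otimes> 'a \<Rightarrow> ('a \<otimes> 'a) \<otimes> 'h" where
  "diagonal_coact H A =
     tlift (\<lambda>a a'. tlift2 (\<lambda>x h x' h'. (x \<otimes> x') \<otimes> mult H h h') (coact A a) (coact A a'))"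

definition es_carrier ::
    "('h::complex_vector) hopf \<Rightarrow> ('a::complex_vector, 'h) comod \<Rightarrow> ('a \<otimes> 'a) set" where
  "es_carrier H A = {w. diagonal_coact H A w = w \<otimes> unity H}"

definition es_algebra :: "('a::complex_vector, 'h::complex_vector) comod \<Rightarrow> ('a \<otimes> 'a) alg" where
  "es_algebra A = \<lparr>mult = tmult (mult A) (\<lambda>y y'. mult A y' y), unity = unity A \<otimes> unity A\<rparr>"

definition es_src :: "('a::complex_vector, 'h::complex_vector) comod \<Rightarrow> 'a \<Rightarrow> 'a \<otimes> 'a" where
  "es_src A b = b \<otimes> unity A"

definition es_tgt :: "('a::complex_vector, 'h::complex_vector) comod \<Rightarrow> 'a \<Rightarrow> 'a \<otimes> 'a" where
  "es_tgt A b = unity A \<otimes> b"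

definition es_balance :: "('h::complex_vector) hopf \<Rightarrow> ('a::complex_vector, 'h) comod \<Rightarrow>
    ('a \<otimes> 'a) set \<Rightarrow> (('a \<otimes> 'a) \<otimes> ('a \<otimes> 'a)) set" where
  "es_balance H A M = balance (coinvariants H A)
     (\<lambda>x b. mult (es_algebra A) (es_tgt A b) x) (\<lambda>b x. mult (es_algebra A) (es_src A b) x) M M"

text \<open>A linear choice of representatives of the translation map.\<close>

definition translation_rep ::
    "('h::complex_vector) hopf \<Rightarrow> ('a::complex_vector, 'h) comod \<Rightarrow> 'h \<Rightarrow> 'a \<otimes> 'a" where
  "translation_rep H A = (SOME T. clinear T \<and> (\<forall>h. T h \<in> translation H A h))"

text \<open>The formula for the coproduct gives an element of \<open>A \<otimes> (A \<otimes>\<^sub>B A) \<otimes> A\<close>, that is, of the tensor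
  product over \<open>B\<close> of \<open>A \<otimes> A\<close> (right action on the second factor) with \<open>A \<otimes> A\<close> (left action on the
  first factor), the quotient by \<open>es_balance H A UNIV\<close>.  The class does not depend on the
  representatives.\<close>

definition es_formula :: "('h::complex_vector) hopf \<Rightarrow> ('a::complex_vector, 'h) comod \<Rightarrow>
    'a \<otimes> 'a \<Rightarrow> (('a \<otimes> 'a) \<otimes> ('a \<otimes> 'a)) set" where
  "es_formula H A w = coset (es_balance H A UNIV)
     (tlift (\<lambda>a a'. tlift (\<lambda>x h. tlift (\<lambda>p q. (x \<otimes> p) \<otimes> (q \<otimes> a')) (translation_rep H A h))
        (coact A a)) w)"

text \<open>Writing \<open>C\<close> for the carrier, the coproduct is the element of \<open>C \<otimes>\<^sub>B C\<close> with that image under the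
  canonical map \<open>C \<otimes>\<^sub>B C \<rightarrow> (A \<otimes> A) \<otimes>\<^sub>B (A \<otimes> A)\<close>, which sends a class to the class containing it.\<close>

definition es_cop :: "('h::complex_vector) hopf \<Rightarrow> ('a::complex_vector, 'h) comod \<Rightarrow>
    'a \<otimes> 'a \<Rightarrow> (('a \<otimes> 'a) \<otimes> ('a \<otimes> 'a)) set" where
  "es_cop H A w = (THE X.
     X \<in> coset (es_balance H A (es_carrier H A)) ` tens (es_carrier H A) (es_carrier H A) \<and>
     X \<subseteq> es_formula H A w)"

definition ES :: "('h::complex_vector) hopf \<Rightarrow> ('a::complex_vector, 'h) comod \<Rightarrow>
    ('a, 'a \<otimes> 'a) bialgebroid" where
  "ES H A = \<lparr>base_carrier = coinvariants H A, base = alg.truncate A,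
     total_carrier = es_carrier H A, total = es_algebra A,
     src = es_src A, tgt = es_tgt A, cop = es_cop H A, cou = tlift (mult A)\<rparr>"

end

theory Submission
  imports Defs
begin

text \<open>Let \<open>C\<close> be the space of coinvariants of \<open>A \<otimes> A\<close>.  The map \<open>C \<otimes>\<^sub>B C \<rightarrow> A \<otimes> A \<otimes> A\<close>,
  \<open>(x \<otimes> p) \<otimes> (q \<otimes> y) \<mapsto> x \<otimes> p q \<otimes> y\<close>, is injective and sends the coproduct of \<open>a \<otimes> a'\<close> to
  \<open>a \<otimes> 1 \<otimes> a'\<close>; together with its analogue on \<open>C \<otimes>\<^sub>B C \<otimes>\<^sub>B C\<close> it turns the axioms of a Hopf
  algebroid into identities in tensor powers of \<open>A\<close>.  Its injectivity, and the existence of the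
  coproduct, rest on projections onto coinvariants built from linear maps \<open>\<phi> : H \<rightarrow> A\<close> with
  \<open>\<phi> 1 = 1\<close> that are colinear at finitely many prescribed elements.  Flatness writes the translation
  map, restricted to a finite-dimensional space, as a sum of terms \<open>a \<otimes> \<phi>\<close> with \<open>\<phi>\<close> colinear, so
  \<open>1\<close> is a sum of terms \<open>a (\<phi> 1)\<close>; faithfulness then puts \<open>1\<close> into the left ideal of all \<open>\<phi> 1\<close>.
  The existence of such \<open>\<phi>\<close> involves only the coactions and is therefore inherited by the
  deformation, whose diagonal coaction and canonical map are conjugate to the original ones by
  operators that multiply homogeneous tensors by phases.\<close>

section \<open>Linear maps and Sweedler sums\<close>

text \<open>The deformed Hopf algebra need not be commutative, so a construction for commutative
  \<open>H\<close> could not simply be applied twice. Commutativity of the given \<open>H\<close>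
  enters through two consequences that survive the deformation: the flip preserves the coinvariants
  of \<open>A \<otimes> A\<close>, and \<open>S(h2) h1 = counit h\<close>, the antipode identity
  with its factors reversed. The reversed identity is what a projection onto coinvariants by left
  multiplication requires. Left and right projections both occur because a balancing relation
  \<open>x b \<otimes> y - x \<otimes> b y\<close> survives when the map applied to \<open>x\<close>
  is right \<open>B\<close>-linear and the map applied to \<open>y\<close> is left
  \<open>B\<close>-linear. In the deformed half, phases disappear for one of two reasons: the inner
  degree shared by the two legs of a coaction contributes mutually inverse factors, or skewness
  gives \<open>phase \<theta> r r = 1\<close>, hence also a trivial phase for \<open>r\<close> and
  \<open>- r\<close>.\<close>

global_interpretation cpair: vector_space_pair
  "scaleC :: complex \<Rightarrow> 'a \<Rightarrow> 'a::complex_vector" "scaleC :: complex \<Rightarrow> 'b \<Rightarrow> 'b::complex_vector"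
  by unfold_locales

named_theorems lin

lemma cbilinearI [lin]:
  "(\<And>y. clinear (\<lambda>x. \<beta> x y)) \<Longrightarrow> (\<And>x. clinear (\<lambda>y. \<beta> x y)) \<Longrightarrow> cbilinear \<beta>"
  by (simp add: cbilinear_def)

lemma clinear_add: "clinear f \<Longrightarrow> f (x + y) = f x + f y"
  by (simp add: clinear_iff)

lemma clinear_scale: "clinear f \<Longrightarrow> f (c *\<^sub>C x) = c *\<^sub>C f x"
  by (simp add: clinear_iff)

lemma clinear_compose: "clinear f \<Longrightarrow> clinear g \<Longrightarrow> clinear (\<lambda>x. f (g x))"
  by (simp add: clinear_iff)

lemma clinear_ident [lin]: "clinear (\<lambda>x. x)"
  by (simp add: clinear_iff)

lemma clinear_zero_map [lin]: "clinear (\<lambda>x. 0)"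
  by (simp add: clinear_iff)

lemma clinear_plus [lin]: "clinear f \<Longrightarrow> clinear g \<Longrightarrow> clinear (\<lambda>x. f x + g x)"
  by (simp add: clinear_iff scaleC_add_right)

lemma clinear_minus [lin]: "clinear f \<Longrightarrow> clinear g \<Longrightarrow> clinear (\<lambda>x. f x - g x)"
  by (simp add: clinear_iff cvec.scale_right_diff_distrib)

lemma clinear_scaleC [lin]: "clinear f \<Longrightarrow> clinear (\<lambda>x. c *\<^sub>C f x)"
  by (simp add: clinear_iff scaleC_add_right scaleC_scaleC mult.commute)

lemma clinear_scaleC_left [lin]: "clinear f \<Longrightarrow> clinear (\<lambda>x. f x *\<^sub>C v)"
  by (simp add: clinear_iff scaleC_add_left scaleC_scaleC scaleC_complex_def)

lemma clinear_times_right [lin]: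
  "clinear f \<Longrightarrow> clinear (\<lambda>x. (c::complex) * f x)"
  by (simp add: clinear_iff scaleC_complex_def algebra_simps)

lemma clinear_times_left [lin]:
  "clinear f \<Longrightarrow> clinear (\<lambda>x. f x * (c::complex))"
  by (simp add: clinear_iff scaleC_complex_def algebra_simps)

lemma clinear_sum_map [lin]:
  "(\<And>i. i \<in> I \<Longrightarrow> clinear (f i)) \<Longrightarrow> clinear (\<lambda>x. \<Sum>i\<in>I. f i x)"
  by (induction I rule: infinite_finite_induct) (simp_all add: clinear_zero_map clinear_plus)

lemma clinear_tensor_left [lin]: "clinear f \<Longrightarrow> clinear (\<lambda>x. f x \<otimes> y)"
  using cbilinear_elem_tensor clinear_compose by (auto simp: cbilinear_def)

lemma clinear_tensor_right [lin]: "clinear f \<Longrightarrow> clinear (\<lambda>x. y \<otimes> f x)"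
  using cbilinear_elem_tensor clinear_compose by (auto simp: cbilinear_def)

lemma tensor_zero [simp]: "x \<otimes> 0 = 0" "0 \<otimes> y = 0"
  by (rule clinear_0, rule lin, rule lin)+

lemma tensor_scale: "x \<otimes> (c *\<^sub>C y) = c *\<^sub>C (x \<otimes> y)" "(c *\<^sub>C x) \<otimes> y = c *\<^sub>C (x \<otimes> y)"
  by (rule clinear_scale, rule lin, rule lin)+

lemma tensor_diff: "x \<otimes> (y - z) = x \<otimes> y - x \<otimes> z"
  by (rule clinear_diff, rule lin, rule lin)

lemma clinear_tlift_arg [lin]: "cbilinear \<beta> \<Longrightarrow> clinear f \<Longrightarrow> clinear (\<lambda>x. tlift \<beta> (f x))"
  using clinear_compose[OF clinear_tlift] .

lemma tensor_induct [consumes 0, case_names zero step]: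
  assumes "P 0" "\<And>c x y u. P u \<Longrightarrow> P (c *\<^sub>C (x \<otimes> y) + u)"
  shows "P u"
  using span_elem_tensor[of u]
  by (induction rule: cvec.span_induct_alt) (use assms in auto)

text \<open>Needed for nested Sweedler sums, where the integrand of the inner sum depends linearly
  on a variable of the outer one.\<close>

lemma clinear_tlift_param [lin]:
  assumes "\<And>x. cbilinear (\<beta> x)" "\<And>y z. clinear (\<lambda>x. \<beta> x y z)"
  shows "clinear (\<lambda>x. tlift (\<beta> x) u)"
proof (induction u rule: tensor_induct)
  case zero
  then show ?case by (simp add: clinear_0[OF clinear_tlift] assms clinear_zero_map)
next
  case (step c y z u)
  then show ?case
    by (simp add: clinear_add[OF clinear_tlift] clinear_scale[OF clinear_tlift] tlift_tensor assms
        clinear_plus clinear_scaleC)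
qed

lemma tensor_eqI:
  assumes "clinear f" "clinear g" "\<And>x y. f (x \<otimes> y) = g (x \<otimes> y)"
  shows "f u = g u"
  using tensor_ext[OF assms] by simp

text \<open>Both sides are linear in \<open>u\<close> and agree on pure tensors. All the rules
  collected in \<open>push\<close> are instances.\<close>

lemma tlift_push:
  assumes "clinear f" "cbilinear \<beta>"
  shows "f (tlift \<beta> u) = tlift (\<lambda>x y. f (\<beta> x y)) u"
proof -
  have b: "cbilinear (\<lambda>x y. f (\<beta> x y))"
    using assms by (simp add: cbilinear_def clinear_compose[OF assms(1)])
  have "(\<lambda>u. f (tlift \<beta> u)) = tlift (\<lambda>x y. f (\<beta> x y))"
    by (rule tensor_ext) (simp_all add: lin assms b tlift_tensor clinear_tlift
        clinear_compose[OF assms(1)])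
  then show ?thesis by (rule fun_cong)
qed

lemma tlift_id [simp]: "tlift (\<lambda>x y. x \<otimes> y) u = u"
proof -
  have "tlift (\<lambda>x y. x \<otimes> y) = (\<lambda>u :: 'a \<otimes> 'b. u)"
    by (rule tensor_ext) (simp_all add: lin tlift_tensor clinear_tlift)
  then show ?thesis by (rule fun_cong)
qed

lemma tlift_eqI: "clinear f \<Longrightarrow> (\<And>x y. f (x \<otimes> y) = \<beta> x y) \<Longrightarrow> tlift \<beta> u = f u"
  using tlift_push[of f "(\<otimes>)" u, OF _ cbilinear_elem_tensor] by simp

text \<open>Fubini for two Sweedler sums over independent tensors.\<close>

lemma tlift_swap:
  assumes "\<And>y x' y'. clinear (\<lambda>x. \<beta> x y x' y')" "\<And>x x' y'. clinear (\<lambda>y. \<beta> x y x' y')"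
    "\<And>x y y'. clinear (\<lambda>x'. \<beta> x y x' y')" "\<And>x y x'. clinear (\<lambda>y'. \<beta> x y x' y')"
  shows "tlift (\<lambda>x y. tlift (\<lambda>x' y'. \<beta> x y x' y') v) u = tlift (\<lambda>x' y'. tlift (\<lambda>x y. \<beta> x y x' y') u) v"
by (rule tensor_eqI[where u = u])
    (simp_all add: lin assms tlift_tensor clinear_tlift)

lemma clinear_eq_on_span:
  "clinear f \<Longrightarrow> clinear g \<Longrightarrow> x \<in> cspan S \<Longrightarrow> (\<And>y. y \<in> S \<Longrightarrow> f y = g y) \<Longrightarrow> f x = g x"
  by (rule cpair.linear_eq_on)

lemma clinear_image_span_subset:
  assumes "clinear f" "csubspace V" "\<And>y. y \<in> S \<Longrightarrow> f y \<in> V" "x \<in> cspan S"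
  shows "f x \<in> V"
  using assms(4)
proof (induction rule: cvec.span_induct_alt)
  case base
  then show ?case using assms by (simp add: clinear_0 cvec.subspace_0)
next
  case (step c y x)
  then show ?case using assms
    by (simp add: clinear_add clinear_scale cvec.subspace_add cvec.subspace_scale)
qed

lemma tmap_tensor: "clinear f \<Longrightarrow> clinear g \<Longrightarrow> tmap f g (x \<otimes> y) = f x \<otimes> g y"
  by (simp add: tmap_def tlift_tensor lin)

lemma clinear_tmap [lin]:
  "clinear f \<Longrightarrow> clinear g \<Longrightarrow> clinear h \<Longrightarrow> clinear (\<lambda>x. tmap f g (h x))"
  by (simp add: tmap_def lin)

lemma tflip_tensor [simp]: "tflip (x \<otimes> y) = y \<otimes> x"
  by (simp add: tflip_def tlift_tensor lin)

lemma clinear_tflip [lin]: "clinear f \<Longrightarrow> clinear (\<lambda>x. tflip (f x))"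
  by (simp add: tflip_def lin)

lemma tflip_tflip [simp]: "tflip (tflip u) = u"
  by (induction u rule: tensor_induct)
    (simp_all add: clinear_0[OF clinear_tflip, OF clinear_ident]
      clinear_add[OF clinear_tflip, OF clinear_ident] clinear_scale[OF clinear_tflip, OF clinear_ident])

lemma tassoc_tensor [simp]: "tassoc ((x \<otimes> y) \<otimes> z) = x \<otimes> (y \<otimes> z)"
  by (simp add: tassoc_def tlift_tensor lin)

lemma clinear_tassoc [lin]: "clinear f \<Longrightarrow> clinear (\<lambda>x. tassoc (f x))"
  by (simp add: tassoc_def lin)

lemma tmult_tensor: "cbilinear m \<Longrightarrow> cbilinear m' \<Longrightarrow>
    tmult m m' (x \<otimes> y) (x' \<otimes> y') = m x x' \<otimes> m' y y'"
  unfolding tmult_def tlift2_def by (simp add: tlift_tensor lin cbilinear_def)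

lemma clinear_id [lin]: "clinear id"
  by (simp add: clinear_iff)

lemma tlift_expand: "clinear f \<Longrightarrow> f u = tlift (\<lambda>x y. f (x \<otimes> y)) u"
  by (simp add: tlift_eqI)

text \<open>The rules \<open>push\<close> move linear maps under \<open>tlift\<close>, so that every expression becomes a nested
  Sweedler sum.\<close>

named_theorems push

lemma tlift_tlift [push]: "cbilinear \<gamma> \<Longrightarrow> cbilinear \<beta> \<Longrightarrow>
    tlift \<gamma> (tlift \<beta> u) = tlift (\<lambda>x y. tlift \<gamma> (\<beta> x y)) u"
  by (rule tlift_push) (simp_all add: lin clinear_tlift)

lemma tensor_tlift_left [push]: "cbilinear \<beta> \<Longrightarrow> tlift \<beta> u \<otimes> v = tlift (\<lambda>x y. \<beta> x y \<otimes> v) u"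
  by (rule tlift_push[of "\<lambda>w. w \<otimes> v"]) (simp_all add: lin)

lemma tensor_tlift_right [push]: "cbilinear \<beta> \<Longrightarrow> v \<otimes> tlift \<beta> u = tlift (\<lambda>x y. v \<otimes> \<beta> x y) u"
  by (rule tlift_push[of "\<lambda>w. v \<otimes> w"]) (simp_all add: lin)

lemma tmap_tlift [push]: "clinear f \<Longrightarrow> clinear g \<Longrightarrow> cbilinear \<beta> \<Longrightarrow>
    tmap f g (tlift \<beta> u) = tlift (\<lambda>x y. tmap f g (\<beta> x y)) u"
  by (rule tlift_push) (simp_all add: lin)

lemma tassoc_tlift [push]: "cbilinear \<beta> \<Longrightarrow>
    tassoc (tlift \<beta> u) = tlift (\<lambda>x y. tassoc (\<beta> x y)) u"
  by (rule tlift_push) (simp_all add: lin)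

lemma tmap_0: "clinear f \<Longrightarrow> clinear g \<Longrightarrow> tmap f g 0 = 0"
  by (rule clinear_0[of "tmap f g"]) (simp add: lin)

lemma tmap_diff: "clinear f \<Longrightarrow> clinear g \<Longrightarrow> tmap f g (u - v) = tmap f g u - tmap f g v"
  by (rule clinear_diff[of "tmap f g"]) (simp add: lin)

lemma tmap_tmap: "clinear f \<Longrightarrow> clinear g \<Longrightarrow> clinear f' \<Longrightarrow> clinear g' \<Longrightarrow>
    tmap f g (tmap f' g' u) = tmap (\<lambda>x. f (f' x)) (\<lambda>x. g (g' x)) u"
proof -
  assume *: "clinear f" "clinear g" "clinear f'" "clinear g'"
  then have "(\<lambda>u. tmap f g (tmap f' g' u)) = (\<lambda>u. tmap (\<lambda>x. f (f' x)) (\<lambda>x. g (g' x)) u)"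
    by (intro tensor_ext) (simp_all add: lin tmap_tensor clinear_compose)
  then show ?thesis by (rule fun_cong)
qed

definition ctrilinear where
  "ctrilinear \<beta> \<longleftrightarrow> (\<forall>y z. clinear (\<lambda>x. \<beta> x y z)) \<and> (\<forall>x z. clinear (\<lambda>y. \<beta> x y z)) \<and>
     (\<forall>x y. clinear (\<lambda>z. \<beta> x y z))"

lemma ctrilinearI [lin]:
  "(\<And>y z. clinear (\<lambda>x. \<beta> x y z)) \<Longrightarrow> (\<And>x z. clinear (\<lambda>y. \<beta> x y z)) \<Longrightarrow>
    (\<And>x y. clinear (\<lambda>z. \<beta> x y z)) \<Longrightarrow> ctrilinear \<beta>"
  by (simp add: ctrilinear_def)

text \<open>Turns an equation of coassociativity type into a substitution rule under a trilinear
  integrand: the linear map \<open>?F\<close> induced by \<open>\<beta>\<close> on triple tensors is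
  applied to both sides. \<open>D\<close> and \<open>E\<close> may differ, so coproducts and
  coactions are both covered.\<close>

lemma tlift_tassoc_eq:
  fixes D :: "'a::complex_vector \<Rightarrow> 'b::complex_vector \<otimes> 'c::complex_vector"
    and E :: "'d::complex_vector \<Rightarrow> 'c \<otimes> 'd'::complex_vector"
  assumes D: "clinear D" and E: "clinear E" and \<beta>: "ctrilinear \<beta>"
    and eq: "tassoc (tmap D id u) = tmap id E v"
  shows "tlift (\<lambda>x z. tlift (\<lambda>y1 y2. \<beta> y1 y2 z) (D x)) u =
    tlift (\<lambda>x y. tlift (\<lambda>y1 y2. \<beta> x y1 y2) (E y)) v"
proof -
  have \<beta>': "\<And>y z. clinear (\<lambda>x. \<beta> x y z)" "\<And>x z. clinear (\<lambda>y. \<beta> x y z)" "\<And>x y. clinear (\<lambda>z. \<beta> x y z)"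
    using \<beta> by (auto simp: ctrilinear_def)
  note D' = clinear_compose[OF D] and E' = clinear_compose[OF E]
  let ?F = "tlift (\<lambda>x u. tlift (\<lambda>y z. \<beta> x y z) u)"
  have "(\<lambda>u. ?F (tassoc (tmap D id u))) = tlift (\<lambda>x z. tlift (\<lambda>y1 y2. \<beta> y1 y2 z) (D x))"
  proof (rule tensor_ext)
    fix x z
    have "(\<lambda>w. ?F (tassoc (w \<otimes> z))) = tlift (\<lambda>y1 y2. \<beta> y1 y2 z)"
      by (rule tensor_ext) (simp_all add: lin \<beta>' D' E' tlift_tensor)
    then show "?F (tassoc (tmap D id (x \<otimes> z))) = tlift (\<lambda>x z. tlift (\<lambda>y1 y2. \<beta> y1 y2 z) (D x)) (x \<otimes> z)"
      by (simp add: lin \<beta>' D' E' D tlift_tensor tmap_tensor fun_eq_iff)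
  qed (simp_all add: lin \<beta>' D D' E')
  moreover have "(\<lambda>v. ?F (tmap id E v)) = tlift (\<lambda>x y. tlift (\<lambda>y1 y2. \<beta> x y1 y2) (E y))"
    by (rule tensor_ext) (simp_all add: lin \<beta>' D' E' E tlift_tensor tmap_tensor)
  ultimately show ?thesis using eq by (metis (mono_tags, lifting))
qed

section \<open>Subspaces of tensor products, kernels and cosets\<close>

lemma tens_subspace: "csubspace (tens M N)"
  unfolding tens_def by (rule cvec.subspace_span)

lemma tens_tensor: "x \<in> M \<Longrightarrow> y \<in> N \<Longrightarrow> x \<otimes> y \<in> tens M N"
  unfolding tens_def by (intro cvec.span_base) blast

lemma balance_subspace: "csubspace (balance B ra la M N)"
  unfolding balance_def by (rule cvec.subspace_span)

lemma balance_base: "x \<in> M \<Longrightarrow> b \<in> B \<Longrightarrow> y \<in> N \<Longrightarrow> ra x b \<otimes> y - x \<otimes> la b y \<in> balance B ra la M N"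
  unfolding balance_def by (intro cvec.span_base) blast

lemma tens_UNIV [simp]: "tens UNIV UNIV = UNIV"
  using span_elem_tensor by (auto simp: tens_def)

lemma clinear_right_inverse:
  assumes "clinear f" "csubspace V"
  obtains g where "clinear g" "range g \<subseteq> V" "\<And>v. v \<in> V \<Longrightarrow> f (g (f v)) = f v"
  using cpair.linear_exists_right_inverse_on[OF assms] by blast

text \<open>Exactness of the tensor product over a field. The map \<open>m - g (f m)\<close> sends
  \<open>M\<close> into the kernel of \<open>f\<close>, and its tensor product with
  \<open>id\<close> fixes \<open>z\<close> because \<open>tmap id f\<close> kills
  \<open>z\<close>.\<close>

lemma tens_kernel:
  assumes f: "clinear f" and M: "csubspace M" and z: "z \<in> tens C M" "tmap id f z = 0"
  shows "z \<in> tens C {m \<in> M. f m = 0}"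
proof -
  obtain g where g: "clinear g" "range g \<subseteq> M" "\<And>v. v \<in> M \<Longrightarrow> f (g (f v)) = f v"
    using clinear_right_inverse[OF f M] by blast
  have l: "clinear (\<lambda>m. m - g (f m))"
    by (simp add: lin clinear_compose[OF g(1)] f)
  have "tmap id (\<lambda>m. m - g (f m)) z \<in> tens C {m \<in> M. f m = 0}"
    using z(1) unfolding tens_def[of C M]
  proof (rule clinear_image_span_subset[rotated 3])
    fix y assume "y \<in> {x \<otimes> y |x y. x \<in> C \<and> y \<in> M}"
    then obtain c m where y: "y = c \<otimes> m" "c \<in> C" "m \<in> M" by blast
    have "m - g (f m) \<in> {m \<in> M. f m = 0}"
      using y(3) g M f by (auto simp: clinear_diff intro!: cvec.subspace_diff)
    then show "tmap id (\<lambda>m. m - g (f m)) y \<in> tens C {m \<in> M. f m = 0}"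
      using y l by (simp add: tmap_tensor lin tens_tensor)
  qed (simp_all add: lin l tens_subspace)
  moreover have "tmap id (\<lambda>m. m - g (f m)) = (\<lambda>z. z - tmap id g (tmap id f z))"
    by (rule tensor_ext) (simp_all add: lin l f g tmap_tensor tensor_diff)
  ultimately have "z - tmap id g 0 \<in> tens C {m \<in> M. f m = 0}" using z(2) by metis
  then show ?thesis using g(1) by (simp add: tmap_0 clinear_id)
qed

lemma tens_kernel_left:
  assumes f: "clinear f" and z: "tmap f id z = 0"
  shows "z \<in> tens {x. f x = 0} UNIV"
proof -
  have "tmap id f (tflip z) = tflip (tmap f id z)"
  by (rule tensor_eqI[where u = z])
    (simp_all add: lin f tmap_tensor)
  then have "tflip z \<in> tens UNIV {x. f x = 0}"
    using tens_kernel[of f UNIV "tflip z" UNIV] f z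
    by (simp add: clinear_0[OF clinear_tflip, OF clinear_ident])
  then have "tflip (tflip z) \<in> tens {x. f x = 0} UNIV"
    unfolding tens_def[of UNIV]
    by (rule clinear_image_span_subset[rotated 3]) (auto simp: lin tens_subspace tens_tensor)
  then show ?thesis by simp
qed

lemma coset_eq_iff:
  assumes "csubspace U"
  shows "coset U x = coset U y \<longleftrightarrow> x - y \<in> U"
proof
  assume "coset U x = coset U y"
  then have "x + 0 \<in> coset U y" using cvec.subspace_0[OF assms] by (metis coset_def imageI)
  then show "x - y \<in> U" by (auto simp: coset_def)
next
  assume *: "x - y \<in> U"
  have "y - x \<in> U" using cvec.subspace_neg[OF assms *] by simp
  have "x + u \<in> coset U y" if "u \<in> U" for u
    unfolding coset_def by (rule image_eqI[of _ _ "(x - y) + u"]) (use cvec.subspace_add[OF assms * that] in auto)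
  moreover have "y + u \<in> coset U x" if "u \<in> U" for u
    unfolding coset_def by (rule image_eqI[of _ _ "(y - x) + u"])
      (use cvec.subspace_add[OF assms \<open>y - x \<in> U\<close> that] in auto)
  ultimately show "coset U x = coset U y" by (auto simp: coset_def)
qed

section \<open>Hopf algebras and comodule algebras in Sweedler notation\<close>

context hopf_algebra
begin

lemma mult_bilinear: "cbilinear (mult H)"
  and mult_assoc: "mult H (mult H x y) z = mult H x (mult H y z)"
  and mult_unity [simp]: "mult H (unity H) x = x" "mult H x (unity H) = x"
  using algebra by (auto simp: algebra_on_def)

lemma mult_lin [lin]:
  "clinear f \<Longrightarrow> clinear (\<lambda>x. mult H (f x) y)" "clinear f \<Longrightarrow> clinear (\<lambda>x. mult H y (f x))"
  using mult_bilinear by (auto simp: cbilinear_def intro: clinear_compose[of "\<lambda>x. mult H x y"]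
    clinear_compose[of "mult H y"])

lemma comul_lin [lin]: "clinear f \<Longrightarrow> clinear (\<lambda>x. comul H (f x))"
  and counit_lin [lin]: "clinear f \<Longrightarrow> clinear (\<lambda>x. counit H (f x))"
  and antipode_lin [lin]: "clinear f \<Longrightarrow> clinear (\<lambda>x. antipode H (f x))"
  using comul_linear counit_linear antipode_linear by (auto intro: clinear_compose)

lemma coassoc_sw:
  assumes "ctrilinear \<beta>"
  shows "tlift (\<lambda>x z. tlift (\<lambda>y1 y2. \<beta> y1 y2 z) (comul H x)) (comul H h) =
    tlift (\<lambda>x y. tlift (\<lambda>y1 y2. \<beta> x y1 y2) (comul H y)) (comul H h)"
  by (rule tlift_tassoc_eq[OF comul_linear comul_linear assms coassoc])

lemma counit_left_sw:
  assumes f: "clinear f" shows "tlift (\<lambda>y z. counit H y *\<^sub>C f z) (comul H h) = f h"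
  using arg_cong[OF counit_left, of f h] tlift_push[OF f, of "\<lambda>y z. counit H y *\<^sub>C z" "comul H h"]
  by (simp add: lin clinear_scale[OF f])

lemma counit_right_sw:
  assumes f: "clinear f" shows "tlift (\<lambda>y z. counit H z *\<^sub>C f y) (comul H h) = f h"
  using arg_cong[OF counit_right, of f h] tlift_push[OF f, of "\<lambda>y z. counit H z *\<^sub>C y" "comul H h"]
  by (simp add: lin clinear_scale[OF f])

lemma antipode_left_sw:
  assumes f: "clinear f"
  shows "tlift (\<lambda>y z. f (mult H (antipode H y) z)) (comul H h) = counit H h *\<^sub>C f (unity H)"
  using arg_cong[OF antipode_left, of f h]
    tlift_push[OF f, of "\<lambda>y z. mult H (antipode H y) z" "comul H h"]
  by (simp add: lin clinear_scale[OF f])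

lemma antipode_right_sw:
  assumes f: "clinear f"
  shows "tlift (\<lambda>y z. f (mult H y (antipode H z))) (comul H h) = counit H h *\<^sub>C f (unity H)"
  using arg_cong[OF antipode_right, of f h]
    tlift_push[OF f, of "\<lambda>y z. mult H y (antipode H z)" "comul H h"]
  by (simp add: lin clinear_scale[OF f])

abbreviation mult2 (infixl \<open>\<star>\<close> 69) where "mult2 \<equiv> tmult (mult H) (mult H)"

lemma mult2_lin [lin]: "clinear f \<Longrightarrow> clinear (\<lambda>x. f x \<star> u)" "clinear f \<Longrightarrow> clinear (\<lambda>x. u \<star> f x)"
  by (simp_all add: tmult_def tlift2_def lin)

lemma mult2_push [push]:
  "cbilinear \<beta> \<Longrightarrow> tlift \<beta> u \<star> v = tlift (\<lambda>x y. \<beta> x y \<star> v) u"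
  "cbilinear \<beta> \<Longrightarrow> v \<star> tlift \<beta> u = tlift (\<lambda>x y. v \<star> \<beta> x y) u"
  by (rule tlift_push, simp_all add: lin)+

lemma mult2_tensor [simp]: "x \<otimes> y \<star> x' \<otimes> y' = mult H x x' \<otimes> mult H y y'"
  by (simp add: tmult_tensor mult_bilinear)

lemma mult2_unity [simp]: "unity H \<otimes> unity H \<star> u = u" "u \<star> unity H \<otimes> unity H = u"
proof -
  have "(\<lambda>u. unity H \<otimes> unity H \<star> u) = (\<lambda>u. u)" "(\<lambda>u. u \<star> unity H \<otimes> unity H) = (\<lambda>u. u)"
    by (rule tensor_ext; simp add: lin)+
  then show "unity H \<otimes> unity H \<star> u = u" "u \<star> unity H \<otimes> unity H = u" by metis+
qed

lemma mult2_assoc: "u \<star> v \<star> w = u \<star> (v \<star> w)"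
proof -
  have "x \<otimes> y \<star> x' \<otimes> y' \<star> w = x \<otimes> y \<star> (x' \<otimes> y' \<star> w)" for x y x' y'
  by (rule tensor_eqI[where u = w])
    (simp_all add: lin mult_assoc)
  then have "(\<lambda>v. x \<otimes> y \<star> v \<star> w) = (\<lambda>v. x \<otimes> y \<star> (v \<star> w))" for x y
    by (intro tensor_ext) (simp_all add: lin)
  then have "(\<lambda>u. u \<star> v \<star> w) = (\<lambda>u. u \<star> (v \<star> w))"
    by (intro tensor_ext) (simp_all add: lin fun_eq_iff)
  then show ?thesis by (rule fun_cong)
qed

text \<open>Both sides are convolution inverse to the coproduct in the linear maps from \<open>H\<close> to
  \<open>H \<otimes> H\<close>.\<close>

lemma antipode_anticomult:
  "comul H (antipode H h) = tlift (\<lambda>x y. antipode H y \<otimes> antipode H x) (comul H h)"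
proof -
  let ?S = "antipode H" and ?D = "comul H" and ?m = "mult H" and ?e = "counit H"
  define R where "R h = tlift (\<lambda>x y. ?S y \<otimes> ?S x) (?D h)" for h
  have R_lin [lin]: "clinear f \<Longrightarrow> clinear (\<lambda>x. R (f x))" for f :: "'c::complex_vector \<Rightarrow> 'h"
    by (simp add: R_def lin)
  have left: "tlift (\<lambda>x y. ?D (?S x) \<star> ?D y) (?D h) = ?e h *\<^sub>C (unity H \<otimes> unity H)" for h
    using antipode_left_sw[OF comul_linear, of h] by (simp add: comul_mult comul_unity)
  have right: "tlift (\<lambda>x y. ?D x \<star> R y) (?D h) = ?e h *\<^sub>C (unity H \<otimes> unity H)" for h
  proof -
    have "tlift (\<lambda>x y. ?D x \<star> R y) (?D h) =
      tlift (\<lambda>x y. tlift (\<lambda>a b. tlift (\<lambda>c d. ?m a (?S d) \<otimes> ?m b (?S c)) (?D y)) (?D x)) (?D h)"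
      by (subst tlift_expand[of "\<lambda>w. w \<star> R _" "?D _"]) (simp_all add: R_def lin push)
    also have "\<dots> = tlift (\<lambda>a r. tlift (\<lambda>b s. tlift (\<lambda>c d. ?m a (?S d) \<otimes> ?m b (?S c)) (?D s)) (?D r)) (?D h)"
      by (rule coassoc_sw) (simp add: lin)
    \<comment> \<open>Rebracketing makes \<open>b\<close> and \<open>c\<close> adjacent, so that
      \<open>b S(c)\<close> collapses to a counit and only \<open>a S(d)\<close> remains.\<close>
    also have "\<dots> = tlift (\<lambda>a r. tlift (\<lambda>t d. tlift (\<lambda>b c. ?m a (?S d) \<otimes> ?m b (?S c)) (?D t)) (?D r)) (?D h)"
      by (subst coassoc_sw[symmetric]) (simp_all add: lin)
    also have "\<dots> = tlift (\<lambda>a r. ?m a (?S r) \<otimes> unity H) (?D h)"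
      by (simp add: antipode_right_sw counit_left_sw lin)
    also have "\<dots> = ?e h *\<^sub>C (unity H \<otimes> unity H)"
      by (simp add: antipode_right_sw[of "\<lambda>x. x \<otimes> unity H"] lin)
    finally show ?thesis .
  qed
  \<comment> \<open>A left and a right convolution inverse coincide: a counit is inserted, expanded
    by \<open>right\<close>, and after rebracketing the first two factors are cancelled by
    \<open>left\<close>.\<close>
  have "?D (?S h) = tlift (\<lambda>x y. ?D (?S x) \<star> (?e y *\<^sub>C (unity H \<otimes> unity H))) (?D h)"
    by (simp add: clinear_scale[OF mult2_lin(2)[OF clinear_ident]] counit_right_sw lin)
  also have "\<dots> = tlift (\<lambda>x y. tlift (\<lambda>c d. ?D (?S x) \<star> (?D c \<star> R d)) (?D y)) (?D h)"
    by (simp only: right[symmetric]) (simp add: lin push)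
  also have "\<dots> = tlift (\<lambda>t d. tlift (\<lambda>x c. ?D (?S x) \<star> (?D c \<star> R d)) (?D t)) (?D h)"
    by (rule coassoc_sw[symmetric]) (simp add: lin)
  also have "\<dots> = tlift (\<lambda>t d. tlift (\<lambda>x c. ?D (?S x) \<star> ?D c) (?D t) \<star> R d) (?D h)"
    by (simp add: lin push mult2_assoc)
  also have "\<dots> = R h"
    by (simp add: left clinear_scale[OF mult2_lin(1)[OF clinear_ident]] counit_left_sw lin)
  finally show ?thesis unfolding R_def .
qed
end

context comodule_algebra
begin

lemma amult_bilinear: "cbilinear (mult A)"
  and amult_assoc: "mult A (mult A x y) z = mult A x (mult A y z)"
  and amult_unity [simp]: "mult A (unity A) x = x" "mult A x (unity A) = x"
  using comod_algebra by (auto simp: algebra_on_def)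

lemma amult_lin [lin]:
  "clinear f \<Longrightarrow> clinear (\<lambda>x. mult A (f x) y)" "clinear f \<Longrightarrow> clinear (\<lambda>x. mult A y (f x))"
  using amult_bilinear by (auto simp: cbilinear_def intro: clinear_compose[of "\<lambda>x. mult A x y"]
    clinear_compose[of "mult A y"])

lemma coact_lin [lin]: "clinear f \<Longrightarrow> clinear (\<lambda>x. coact A (f x))"
  using coact_linear by (rule clinear_compose)

lemma coact_push [push]: "cbilinear \<beta> \<Longrightarrow> coact A (tlift \<beta> u) = tlift (\<lambda>x y. coact A (\<beta> x y)) u"
  by (rule tlift_push) (simp_all add: lin)

lemma comul_mult_sw: "comul H (mult H x y) =
    tlift (\<lambda>a b. tlift (\<lambda>c d. mult H a c \<otimes> mult H b d) (comul H y)) (comul H x)"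
  by (simp add: comul_mult tmult_def tlift2_def)

lemma coact_mult_sw: "coact A (mult A x y) =
    tlift (\<lambda>a b. tlift (\<lambda>c d. mult A a c \<otimes> mult H b d) (coact A y)) (coact A x)"
  by (simp add: coact_mult tmult_def tlift2_def)

text \<open>The second factor is an arbitrary comodule, so that iteration gives \<open>diag\<close>
  and \<open>diag2\<close> and one set of lemmas serves all tensor powers of
  \<open>A\<close>.\<close>

definition tens_coact :: "('v::complex_vector \<Rightarrow> 'v \<otimes> 'h) \<Rightarrow> 'a \<otimes> 'v \<Rightarrow> ('a \<otimes> 'v) \<otimes> 'h" where
  "tens_coact co = tlift (\<lambda>a v. tlift (\<lambda>x h. tlift (\<lambda>m k. (x \<otimes> m) \<otimes> mult H h k) (co v)) (coact A a))"

lemma tens_coact_lin [lin]: "clinear co \<Longrightarrow> clinear f \<Longrightarrow> clinear (\<lambda>x. tens_coact co (f x))"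
  unfolding tens_coact_def using clinear_compose[of co] by (simp add: lin)

lemma tens_coact_tensor: "clinear co \<Longrightarrow> tens_coact co (a \<otimes> v) =
    tlift (\<lambda>x h. tlift (\<lambda>m k. (x \<otimes> m) \<otimes> mult H h k) (co v)) (coact A a)"
  unfolding tens_coact_def using clinear_compose[of co] by (simp add: lin tlift_tensor)

abbreviation laA :: "'a \<Rightarrow> 'a \<otimes> 'v::complex_vector \<Rightarrow> 'a \<otimes> 'v" where
  "laA \<equiv> \<lambda>a. tmap (mult A a) id"

abbreviation diag :: "'a \<otimes> 'a \<Rightarrow> ('a \<otimes> 'a) \<otimes> 'h" where
  "diag \<equiv> tens_coact (coact A)"

abbreviation diag2 :: "'a \<otimes> 'a \<otimes> 'a \<Rightarrow> ('a \<otimes> 'a \<otimes> 'a) \<otimes> 'h" where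
  "diag2 \<equiv> tens_coact diag"

lemma diagonal_coact_eq: "diagonal_coact H A = diag"
  by (simp add: diagonal_coact_def tens_coact_def tlift2_def)

end

section \<open>Relative Hopf modules\<close>

definition coinv :: "('h::complex_vector) hopf \<Rightarrow> ('v::complex_vector \<Rightarrow> 'v \<otimes> 'h) \<Rightarrow> 'v set" where
  "coinv H co = {v. co v = v \<otimes> unity H}"

lemma coinv_subspace: "clinear co \<Longrightarrow> csubspace (coinv H co)"
  by (auto simp: coinv_def cvec.subspace_def clinear_0 clinear_add clinear_scale
    tensor_zero
    clinear_add[OF clinear_tensor_left[OF clinear_ident]]
    tensor_scale)

lemma coinvariants_eq: "coinvariants H A = coinv H (coact A)"
  by (simp add: coinvariants_def coinv_def)

text \<open>Relative Hopf modules; the instances are the tensor powers of \<open>A\<close> with the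
  diagonal coaction. At this level the cancellation results for \<open>kap\<close> and for
  \<open>kap3\<close> have a common proof.\<close>

locale right_hopf_module = comodule_algebra H A
  for H :: "('h::complex_vector) hopf" and A :: "('a::complex_vector, 'h) comod" +
  fixes ra :: "'v::complex_vector \<Rightarrow> 'a \<Rightarrow> 'v" and co :: "'v \<Rightarrow> 'v \<otimes> 'h"
  assumes ra_bilinear: "cbilinear ra"
    and ra_unity: "ra v (unity A) = v"
    and co_linear: "clinear co"
    and co_coassoc: "tassoc (tmap co id (co v)) = tmap id (comul H) (co v)"
    and co_counit: "tlift (\<lambda>x h. counit H h *\<^sub>C x) (co v) = v"
    and co_ra: "co (ra v a) = tlift (\<lambda>m h. tlift (\<lambda>x k. ra m x \<otimes> mult H h k) (coact A a)) (co v)"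
begin

lemma ra_lin [lin]:
  "clinear f \<Longrightarrow> clinear (\<lambda>x. ra (f x) y)" "clinear g \<Longrightarrow> clinear (\<lambda>x. ra z (g x))"
  using ra_bilinear by (auto simp: cbilinear_def intro: clinear_compose[of "\<lambda>x. ra x y"]
    clinear_compose[of "ra z"])

lemma co_lin [lin]: "clinear f \<Longrightarrow> clinear (\<lambda>x. co (f x))"
  using co_linear by (rule clinear_compose)

lemma co_push [push]: "cbilinear \<beta> \<Longrightarrow> co (tlift \<beta> u) = tlift (\<lambda>x y. co (\<beta> x y)) u"
  by (rule tlift_push) (simp_all add: lin)

lemma ra_push [push]:
  "cbilinear \<beta> \<Longrightarrow> ra (tlift \<beta> u) a = tlift (\<lambda>x y. ra (\<beta> x y) a) u"
  "cbilinear \<gamma> \<Longrightarrow> ra v (tlift \<gamma> w) = tlift (\<lambda>x y. ra v (\<gamma> x y)) w"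
  by (rule tlift_push, simp_all add: lin)+

lemma co_coassoc_sw:
  assumes "ctrilinear \<beta>"
  shows "tlift (\<lambda>x h. tlift (\<lambda>y k. \<beta> y k h) (co x)) (co v) =
    tlift (\<lambda>x h. tlift (\<lambda>h1 h2. \<beta> x h1 h2) (comul H h)) (co v)"
  by (rule tlift_tassoc_eq[OF co_linear comul_linear assms co_coassoc])

lemma co_counit_sw:
  assumes f: "clinear f" shows "tlift (\<lambda>y z. counit H z *\<^sub>C f y) (co v) = f v"
  using arg_cong[OF co_counit, of f v] tlift_push[OF f, of "\<lambda>y z. counit H z *\<^sub>C y" "co v"]
  by (simp add: lin clinear_scale[OF f])

end

lemma (in comodule_algebra) right_hopf_module_self: "right_hopf_module H A (mult A) (coact A)"
  by (intro right_hopf_module.intro right_hopf_module_axioms.intro comodule_algebra_axioms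
    amult_bilinear amult_unity coact_linear coact_coassoc coact_counit coact_mult_sw)

lemmas (in comodule_algebra) coact_coassoc_sw =
    right_hopf_module.co_coassoc_sw[OF right_hopf_module_self]
  and coact_counit_sw = right_hopf_module.co_counit_sw[OF right_hopf_module_self]

locale hopf_bimodule = right_hopf_module H A ra co
  for H :: "('h::complex_vector) hopf" and A :: "('a::complex_vector, 'h) comod"
    and ra :: "'v::complex_vector \<Rightarrow> 'a \<Rightarrow> 'v" and co :: "'v \<Rightarrow> 'v \<otimes> 'h" +
  fixes la :: "'a \<Rightarrow> 'v \<Rightarrow> 'v"
  assumes la_bilinear: "cbilinear la"
    and la_unity: "la (unity A) v = v"
    and la_assoc: "la (mult A a b) v = la a (la b v)"
    and la_ra: "la a (ra v b) = ra (la a v) b"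
    and co_la: "co (la a v) = tlift (\<lambda>x h. tlift (\<lambda>m k. la x m \<otimes> mult H h k) (co v)) (coact A a)"
begin

lemma la_lin [lin]:
  "clinear f \<Longrightarrow> clinear (\<lambda>x. la (f x) z)" "clinear g \<Longrightarrow> clinear (\<lambda>x. la y (g x))"
  using la_bilinear by (auto simp: cbilinear_def intro: clinear_compose[of "\<lambda>x. la x z"]
    clinear_compose[of "la y"])

lemma la_push [push]:
  "cbilinear \<beta> \<Longrightarrow> la (tlift \<beta> u) v = tlift (\<lambda>x y. la (\<beta> x y) v) u"
  "cbilinear \<gamma> \<Longrightarrow> la a (tlift \<gamma> w) = tlift (\<lambda>x y. la a (\<gamma> x y)) w"
  by (rule tlift_push, simp_all add: lin)+

end

context right_hopf_module
begin

text \<open>Swapping independent sums separates the two coactions, coassociativity is applied to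
  each of them, and multiplicativity of the coproduct joins them again.\<close>

lemma tens_coact_coassoc:
  "tassoc (tmap (tens_coact co) id (tens_coact co w)) = tmap id (comul H) (tens_coact co w)"
proof -
  have "tassoc (tmap (tens_coact co) id (tens_coact co (a \<otimes> v))) = tmap id (comul H) (tens_coact co (a \<otimes> v))" for a v
  proof -
    have "tassoc (tmap (tens_coact co) id (tens_coact co (a \<otimes> v))) =
      tlift (\<lambda>x h. tlift (\<lambda>m k. tlift (\<lambda>x' h'. tlift (\<lambda>m' k'.
        (x' \<otimes> m') \<otimes> (mult H h' k' \<otimes> mult H h k)) (co m)) (coact A x)) (co v)) (coact A a)"
      by (simp add: tens_coact_tensor co_linear lin push tmap_tensor)
    also have "\<dots> = tlift (\<lambda>x h. tlift (\<lambda>x' h'. tlift (\<lambda>m k. tlift (\<lambda>m' k'.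
        (x' \<otimes> m') \<otimes> (mult H h' k' \<otimes> mult H h k)) (co m)) (co v)) (coact A x)) (coact A a)"
      by (subst tlift_swap[where u = "coact A _"]) (simp_all add: lin)
    also have "\<dots> = tlift (\<lambda>x h. tlift (\<lambda>h1 h2. tlift (\<lambda>m k. tlift (\<lambda>k1 k2.
        (x \<otimes> m) \<otimes> (mult H h1 k1 \<otimes> mult H h2 k2)) (comul H k)) (co v)) (comul H h)) (coact A a)"
      by (subst coact_coassoc_sw, simp add: lin, subst co_coassoc_sw, simp_all add: lin)
    also have "\<dots> = tlift (\<lambda>x h. tlift (\<lambda>m k. tlift (\<lambda>h1 h2. tlift (\<lambda>k1 k2.
        (x \<otimes> m) \<otimes> (mult H h1 k1 \<otimes> mult H h2 k2)) (comul H k)) (comul H h)) (co v)) (coact A a)"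
      by (subst tlift_swap[where u = "comul H _"]) (simp_all add: lin)
    also have "\<dots> = tmap id (comul H) (tens_coact co (a \<otimes> v))"
      by (simp add: tens_coact_tensor co_linear comul_linear lin push tmap_tensor comul_mult_sw)
    finally show ?thesis .
  qed
  then have "(\<lambda>w. tassoc (tmap (tens_coact co) id (tens_coact co w))) =
      (\<lambda>w. tmap id (comul H) (tens_coact co w))"
    by (intro tensor_ext) (simp_all add: lin co_linear comul_linear)
  then show ?thesis by (rule fun_cong)
qed

end

lemma clinear_tmap_param [lin]:
  "clinear f \<Longrightarrow> (\<And>x. clinear (g x)) \<Longrightarrow> (\<And>v. clinear (\<lambda>x. g x v)) \<Longrightarrow> clinear (\<lambda>x. tmap f (g x) u)"
  "(\<And>x. clinear (g' x)) \<Longrightarrow> clinear f' \<Longrightarrow> (\<And>v. clinear (\<lambda>x. g' x v)) \<Longrightarrow> clinear (\<lambda>x. tmap (g' x) f' u)"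
  by (simp_all add: tmap_def lin clinear_compose)

context right_hopf_module
begin

text \<open>Degrees in \<open>H\<close> are multiplied in the order of the tensor factors. Hence the
  left action on the first factor and the right action on the last one are compatible with the
  coaction even for noncommutative \<open>H\<close>.\<close>

lemma hopf_bimodule_tens:
  "hopf_bimodule H A (\<lambda>w a. tmap id (\<lambda>v. ra v a) w) (tens_coact co) laA"
proof -
  have 1: "cbilinear (\<lambda>w a. tmap id (\<lambda>v. ra v a) w)" by (simp add: lin tmap_def)
  have 2: "cbilinear laA" by (simp add: lin tmap_def)
  have 3: "clinear (tens_coact co)" by (simp add: lin co_linear)
  have 4: "tmap id (\<lambda>v. ra v (unity A)) w = w" for w :: "'a \<otimes> 'v"
    by (simp add: ra_unity tmap_def)
  have 5: "tmap (mult A (unity A)) id w = w" for w :: "'a \<otimes> 'v"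
    by (simp add: tmap_def)
  have "mult A (mult A a b) = (\<lambda>x. mult A a (mult A b x))" for a b
    by (simp add: amult_assoc fun_eq_iff)
  then have 6: "tmap (mult A (mult A a b)) id w = tmap (mult A a) id (tmap (mult A b) id w)"
    for w :: "'a \<otimes> 'v" and a b by (subst tmap_tmap) (simp_all add: lin id_def)
  have 7: "tmap (mult A a) id (tmap id (\<lambda>v. ra v b) w) = tmap id (\<lambda>v. ra v b) (tmap (mult A a) id w)"
    for w :: "'a \<otimes> 'v" and a b
    by (subst (1 2) tmap_tmap) (simp_all add: lin)
  have "(\<lambda>w. tlift (\<lambda>x h. counit H h *\<^sub>C x) (tens_coact co w)) = (\<lambda>w. w)"
  proof (rule tensor_ext)
    fix x v
    have "tlift (\<lambda>x h. counit H h *\<^sub>C x) (tens_coact co (x \<otimes> v)) =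
      tlift (\<lambda>x h. tlift (\<lambda>m k. counit H k *\<^sub>C (counit H h *\<^sub>C (x \<otimes> m))) (co v)) (coact A x)"
      by (simp add: tens_coact_tensor co_linear lin push tlift_tensor counit_mult scaleC_scaleC mult.commute)
    also have "\<dots> = tlift (\<lambda>x h. counit H h *\<^sub>C (x \<otimes> v)) (coact A x)"
      by (simp add: co_counit_sw lin del: cvec.scale_scale)
    also have "\<dots> = x \<otimes> v" by (simp add: coact_counit_sw lin)
    finally show "tlift (\<lambda>x h. counit H h *\<^sub>C x) (tens_coact co (x \<otimes> v)) = x \<otimes> v" .
  qed (simp_all add: lin co_linear)
  then have 8: "tlift (\<lambda>x h. counit H h *\<^sub>C x) (tens_coact co w) = w" for w by (rule fun_cong)
  have "(\<lambda>w. tens_coact co (tmap id (\<lambda>v. ra v a) w)) = (\<lambda>w. tlift (\<lambda>m h. tlift (\<lambda>x k.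
      tmap id (\<lambda>v. ra v x) m \<otimes> mult H h k) (coact A a)) (tens_coact co w))" (is "?L = ?R") for a
  proof (rule tensor_ext)
    show "?L (x \<otimes> v) = ?R (x \<otimes> v)" for x v
      by (simp add: lin co_linear tmap_tensor tens_coact_tensor push co_ra mult_assoc tlift_tensor)
    show "clinear ?R" by (simp add: lin co_linear tmap_def)
  qed (simp_all add: lin co_linear)
  then have 9: "tens_coact co (tmap id (\<lambda>v. ra v a) w) = tlift (\<lambda>m h. tlift (\<lambda>x k.
      tmap id (\<lambda>v. ra v x) m \<otimes> mult H h k) (coact A a)) (tens_coact co w)" for w a
    by (rule fun_cong)
  have "(\<lambda>w. tens_coact co (tmap (mult A a) id w)) = (\<lambda>w. tlift (\<lambda>x h. tlift (\<lambda>m k.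
      tmap (mult A x) id m \<otimes> mult H h k) (tens_coact co w)) (coact A a))" (is "?L = ?R") for a
  proof (rule tensor_ext)
    show "?L (x \<otimes> v) = ?R (x \<otimes> v)" for x v
      by (simp add: lin co_linear tmap_def tens_coact_tensor push coact_mult_sw mult_assoc tlift_tensor)
    show "clinear ?R" by (simp add: lin co_linear tmap_def)
  qed (simp_all add: lin co_linear)
  then have 10: "tens_coact co (tmap (mult A a) id w) = tlift (\<lambda>x h. tlift (\<lambda>m k.
      tmap (mult A x) id m \<otimes> mult H h k) (tens_coact co w)) (coact A a)" for w a
    by (rule fun_cong)
  show ?thesis
    by (intro hopf_bimodule.intro right_hopf_module.intro right_hopf_module_axioms.intro
        hopf_bimodule_axioms.intro comodule_algebra_axioms 1 2 3 4 5 6 7 8 9 10 tens_coact_coassoc)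
qed

end

section \<open>The canonical map and the translation map\<close>

context comodule_algebra
begin

lemma can_lift_tensor: "can_lift A (x \<otimes> a) = tlift (\<lambda>y h. mult A x y \<otimes> h) (coact A a)"
  unfolding can_lift_def by (subst tlift_tensor) (simp_all add: lin tmap_def)

lemma can_lift_lin [lin]: "clinear f \<Longrightarrow> clinear (\<lambda>x. can_lift A (f x))"
  unfolding can_lift_def by (simp add: lin)

lemma can_lift_push [push]: "cbilinear \<beta> \<Longrightarrow> can_lift A (tlift \<beta> u) = tlift (\<lambda>x y. can_lift A (\<beta> x y)) u"
  by (rule tlift_push) (simp_all add: lin)

lemma coact_mult_coinvariant:
  assumes b: "b \<in> coinvariants H A"
  shows "coact A (mult A b a) = tlift (\<lambda>y h. mult A b y \<otimes> h) (coact A a)"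
    "coact A (mult A a b) = tlift (\<lambda>y h. mult A y b \<otimes> h) (coact A a)"
  using b by (simp_all add: coact_mult_sw coinvariants_def tlift_tensor lin)

abbreviation bal :: "('a \<otimes> 'a) set" where
  "bal \<equiv> balance (coinvariants H A) (mult A) (mult A) UNIV UNIV"

lemma can_lift_bal: "u \<in> bal \<Longrightarrow> can_lift A u = 0"
proof -
  assume "u \<in> bal"
  then have "can_lift A u \<in> {0}"
    unfolding balance_def
  proof (rule clinear_image_span_subset[rotated 3])
    fix y assume "y \<in> {mult A x b \<otimes> y - x \<otimes> mult A b y |x b y. x \<in> UNIV \<and> b \<in> coinvariants H A \<and> y \<in> UNIV}"
    then obtain x b z where y: "y = mult A x b \<otimes> z - x \<otimes> mult A b z" and b: "b \<in> coinvariants H A" by blast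
    have "can_lift A (mult A x b \<otimes> z) = can_lift A (x \<otimes> mult A b z)"
      by (simp add: can_lift_tensor coact_mult_coinvariant b push lin tlift_tensor amult_assoc)
    then show "can_lift A y \<in> {0}"
      by (simp add: y clinear_diff[OF can_lift_lin[OF clinear_ident]])
  qed (simp_all add: lin cvec.subspace_0 cvec.subspace_single_0)
  then show ?thesis by simp
qed

lemma can_coset: "can A (coset bal w) = can_lift A w"
proof -
  have "can_lift A (w + u) = can_lift A w" if "u \<in> bal" for u
    using can_lift_bal[OF that] by (simp add: clinear_add[OF can_lift_lin[OF clinear_ident]])
  then have "can_lift A ` coset bal w = {can_lift A w}"
    using cvec.subspace_0[OF balance_subspace] by (fastforce simp: coset_def image_iff)
  then show ?thesis by (simp add: can_def)
qed

text \<open>Replaces bijectivity on classes by two statements about the linear map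
  \<open>can_lift\<close>; the deformed extension is checked in this form.\<close>

lemma hopf_galois_iff:
  "hopf_galois H A \<longleftrightarrow> surj (can_lift A) \<and> (\<forall>w. can_lift A w = 0 \<longrightarrow> w \<in> bal)"
proof -
  have im: "A_tensor_B_A H A = range (coset bal)"
    by (simp add: btensor_def)
  have "inj_on (can A) (range (coset bal)) \<longleftrightarrow> (\<forall>w. can_lift A w = 0 \<longrightarrow> w \<in> bal)"
  proof
    assume inj: "inj_on (can A) (range (coset bal))"
    show "\<forall>w. can_lift A w = 0 \<longrightarrow> w \<in> bal"
    proof (intro allI impI)
      fix w assume "can_lift A w = 0"
      then have "can A (coset bal w) = can A (coset bal 0)"
        by (simp add: can_coset clinear_0[OF can_lift_lin[OF clinear_ident]])
      then have "coset bal w = coset bal 0" using inj by (auto dest: inj_onD)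
      then show "w \<in> bal" by (simp add: coset_eq_iff balance_subspace)
    qed
  next
    assume "\<forall>w. can_lift A w = 0 \<longrightarrow> w \<in> bal"
    then show "inj_on (can A) (range (coset bal))"
      by (auto simp: inj_on_def can_coset coset_eq_iff balance_subspace
          clinear_diff[OF can_lift_lin[OF clinear_ident]])
  qed
  moreover have "can A ` range (coset bal) = range (can_lift A)"
    by (simp add: image_image can_coset)
  ultimately show ?thesis
    by (auto simp: hopf_galois_def im bij_betw_def comodule_algebra_axioms)
qed

lemma antipode_unity: "antipode H (unity H) = unity H"
  using antipode_left[of "unity H"] by (simp add: comul_unity counit_unity tlift_tensor lin)

end

locale galois_extension = comodule_algebra H A
  for H :: "('h::complex_vector) hopf" and A :: "('a::complex_vector, 'h) comod" +
  assumes galois: "hopf_galois H A"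
begin

abbreviation T where "T \<equiv> translation_rep H A"

lemma can_lift_eq_0_iff: "can_lift A w = 0 \<longleftrightarrow> w \<in> bal"
  using galois can_lift_bal by (auto simp: hopf_galois_iff)

text \<open>A linear section \<open>g\<close> of \<open>can_lift\<close> gives the representatives
  \<open>g (unity A \<otimes> h)\<close>, so the choice that defines \<open>T\<close> is possible.
  Other representatives differ by elements of \<open>bal\<close>, on which \<open>can_lift\<close>
  vanishes.\<close>

lemma translation_rep: "clinear T" and can_lift_T: "can_lift A (T h) = unity A \<otimes> h"
proof -
  have surj: "surj (can_lift A)" and "\<forall>w. can_lift A w = 0 \<longrightarrow> w \<in> bal"
    using galois by (simp_all add: hopf_galois_iff)
  obtain g where g: "clinear g" "\<And>v. can_lift A (g (can_lift A v)) = can_lift A v"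
    using clinear_right_inverse[OF can_lift_lin[OF clinear_ident] cvec.subspace_UNIV] by (metis UNIV_I)
  have g': "can_lift A (g v) = v" for v
    using g(2) surj by (metis surjD)
  have mem: "translation H A h = coset bal (g (unity A \<otimes> h))" for h
  proof -
    have "bij_betw (can A) (A_tensor_B_A H A) UNIV"
      using galois by (simp add: hopf_galois_def)
    moreover have "coset bal (g (unity A \<otimes> h)) \<in> A_tensor_B_A H A"
      by (simp add: btensor_def)
    ultimately show ?thesis
      unfolding translation_def
      by (intro inv_into_f_eq) (simp_all add: bij_betw_def can_coset g')
  qed
  have "\<exists>T. clinear T \<and> (\<forall>h. T h \<in> translation H A h)"
    using cvec.subspace_0[OF balance_subspace]
    by (intro exI[of _ "\<lambda>h. g (unity A \<otimes> h)"])
      (auto simp: mem coset_def lin clinear_compose[OF g(1)] image_iff intro!: bexI[of _ 0])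
  then have *: "clinear T \<and> (\<forall>h. T h \<in> translation H A h)"
    unfolding translation_rep_def by (rule someI_ex)
  then show "clinear T" by simp
  obtain u where "u \<in> bal" "T h = g (unity A \<otimes> h) + u"
    using * by (auto simp: mem coset_def)
  then show "can_lift A (T h) = unity A \<otimes> h"
    by (simp add: clinear_add[OF can_lift_lin[OF clinear_ident]] can_lift_bal g')
qed

lemma T_lin [lin]: "clinear f \<Longrightarrow> clinear (\<lambda>x. T (f x))"
  using translation_rep by (rule clinear_compose)

text \<open>The equation \<open>can_lift A (T h) = unity A \<otimes> h\<close> as a substitution
  rule under a bilinear integrand. Taking the counit in the second argument yields
  \<open>T_mult_sw\<close>.\<close>

lemma T_can_sw:
  assumes \<beta>: "cbilinear \<beta>"
  shows "tlift (\<lambda>p q. tlift (\<lambda>y k. \<beta> (mult A p y) k) (coact A q)) (T h) = \<beta> (unity A) h"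
proof -
  have l1: "clinear (\<lambda>x. \<beta> (f x) y)" if "clinear f" for f :: "'c::complex_vector \<Rightarrow> 'a" and y
    using \<beta> that by (auto simp: cbilinear_def intro: clinear_compose[of "\<lambda>x. \<beta> x y"])
  have l2: "clinear (\<lambda>x. \<beta> z (g x))" if "clinear g" for g :: "'d::complex_vector \<Rightarrow> 'h" and z
    using \<beta> that by (auto simp: cbilinear_def intro: clinear_compose[of "\<beta> z"])
  have "tlift (\<lambda>p q. tlift (\<lambda>y k. \<beta> (mult A p y) k) (coact A q)) = (\<lambda>w. tlift \<beta> (can_lift A w))"
    by (rule tensor_ext) (simp_all add: lin l1 l2 \<beta> can_lift_tensor push tlift_tensor)
  then show ?thesis by (simp add: can_lift_T \<beta> tlift_tensor)
qed

lemma T_mult_sw: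
  assumes f: "clinear f"
  shows "tlift (\<lambda>p q. f (mult A p q)) (T h) = counit H h *\<^sub>C f (unity A)"
proof -
  have "tlift (\<lambda>p q. tlift (\<lambda>y k. counit H k *\<^sub>C f (mult A p y)) (coact A q)) (T h)
      = counit H h *\<^sub>C f (unity A)"
    by (rule T_can_sw) (simp add: lin clinear_compose[OF f])
  then show ?thesis
    by (simp add: coact_counit_sw lin clinear_compose[OF f])
qed

end

section \<open>Finite support of tensors and of balancing relations\<close>

lemma tens_finite: "u \<in> tens M N \<Longrightarrow> \<exists>X Y. finite X \<and> X \<subseteq> M \<and> finite Y \<and> Y \<subseteq> N \<and> u \<in> tens X Y"
  unfolding tens_def[of M]
proof (induction rule: cvec.span_induct_alt)
  case base
  show ?case by (rule exI[of _ "{}"], rule exI[of _ "{}"]) (simp add: cvec.subspace_0 tens_subspace)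
next
  case (step c w u)
  then obtain x y X Y where *: "w = x \<otimes> y" "x \<in> M" "y \<in> N" "finite X" "X \<subseteq> M" "finite Y" "Y \<subseteq> N" "u \<in> tens X Y"
    by blast
  have "tens X Y \<subseteq> tens (insert x X) (insert y Y)"
    unfolding tens_def by (rule cvec.span_mono) blast
  then have "c *\<^sub>C w + u \<in> tens (insert x X) (insert y Y)"
    using * by (intro cvec.subspace_add cvec.subspace_scale tens_subspace) (auto intro: tens_tensor)
  then show ?case using * by (intro exI[of _ "insert x X"] exI[of _ "insert y Y"]) simp
qed

text \<open>Finiteness matters because a total integral is colinear only at finitely many prescribed
  elements.\<close>

lemma balance_finite: "u \<in> balance B ra la M N \<Longrightarrow>
    \<exists>X Y. finite X \<and> X \<subseteq> M \<and> finite Y \<and> Y \<subseteq> N \<and> u \<in> balance B ra la X Y"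
  unfolding balance_def[of B ra la M]
proof (induction rule: cvec.span_induct_alt)
  case base
  show ?case by (rule exI[of _ "{}"], rule exI[of _ "{}"]) (simp add: cvec.subspace_0 balance_subspace)
next
  case (step c w u)
  then obtain x b y X Y where *: "w = ra x b \<otimes> y - x \<otimes> la b y" "x \<in> M" "b \<in> B" "y \<in> N"
    "finite X" "X \<subseteq> M" "finite Y" "Y \<subseteq> N" "u \<in> balance B ra la X Y"
    by blast
  have "balance B ra la X Y \<subseteq> balance B ra la (insert x X) (insert y Y)"
    unfolding balance_def by (rule cvec.span_mono) blast
  then have "c *\<^sub>C w + u \<in> balance B ra la (insert x X) (insert y Y)"
    using * by (intro cvec.subspace_add cvec.subspace_scale balance_subspace) (auto intro: balance_base)
  then show ?case using * by (intro exI[of _ "insert x X"] exI[of _ "insert y Y"]) simp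
qed

lemma tens_mono: "M \<subseteq> M' \<Longrightarrow> N \<subseteq> N' \<Longrightarrow> tens M N \<subseteq> tens M' N'"
  unfolding tens_def by (rule cvec.span_mono) blast

lemma tmap_tens:
  assumes "clinear f" "clinear g" "\<And>x. x \<in> X \<Longrightarrow> f x \<in> M" "\<And>y. y \<in> Y \<Longrightarrow> g y \<in> N" "u \<in> tens X Y"
  shows "tmap f g u \<in> tens M N"
  using assms(5) unfolding tens_def[of X]
  by (rule clinear_image_span_subset[rotated 3])
    (use assms in \<open>auto simp: lin tens_subspace tmap_tensor intro!: tens_tensor\<close>)

lemma tmap_tens_ident:
  assumes "clinear f" "clinear g" "\<And>x. x \<in> X \<Longrightarrow> f x = x" "\<And>y. y \<in> Y \<Longrightarrow> g y = y" "u \<in> tens X Y"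
  shows "tmap f g u = u"
  using assms(5) unfolding tens_def
  by (rule clinear_eq_on_span[rotated 2])
    (use assms in \<open>auto simp: lin tmap_tensor\<close>)

section \<open>Total integrals and projections onto coinvariants\<close>

context comodule_algebra
begin

definition colinear_at :: "('h \<Rightarrow> 'a) \<Rightarrow> 'h \<Rightarrow> bool" where
  "colinear_at \<phi> h \<longleftrightarrow> coact A (\<phi> h) = tlift (\<lambda>x y. \<phi> x \<otimes> y) (comul H h)"

text \<open>For a total integral \<open>\<phi>\<close>, \<open>projl\<close> and
  \<open>projr\<close> are the standard projections of a Hopf module onto its coinvariants. They
  differ in the \<open>B\<close>-action they respect, see \<open>projl_ra\<close> and
  \<open>projr_la\<close>.\<close>

definition projl :: "('h \<Rightarrow> 'a) \<Rightarrow> ('a \<Rightarrow> 'v \<Rightarrow> 'v) \<Rightarrow> ('v::complex_vector \<Rightarrow> 'v \<otimes> 'h) \<Rightarrow> 'v \<Rightarrow> 'v" where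
  "projl \<phi> la co v = tlift (\<lambda>m h. la (\<phi> (antipode H h)) m) (co v)"

definition projr :: "('h \<Rightarrow> 'a) \<Rightarrow> ('v \<Rightarrow> 'a \<Rightarrow> 'v) \<Rightarrow> ('v::complex_vector \<Rightarrow> 'v \<otimes> 'h) \<Rightarrow> 'v \<Rightarrow> 'v" where
  "projr \<phi> ra co v = tlift (\<lambda>m h. ra m (\<phi> (antipode H h))) (co v)"

end

context right_hopf_module
begin

text \<open>Since the antipode reverses the coproduct, the coaction of the projected element is
  \<open>v0 \<phi>(S v3) \<otimes> v1 S(v2)\<close> in Sweedler notation, and the antipode axiom
  removes \<open>v1 S(v2)\<close>. Colinearity of \<open>\<phi>\<close> is used at the antipodes of
  the second legs of \<open>co v\<close>.\<close>

lemma projr_coinv: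
  assumes \<phi>: "clinear \<phi>" and v: "co v \<in> tens UNIV {h. colinear_at \<phi> (antipode H h)}"
  shows "projr \<phi> ra co v \<in> coinv H co"
proof -
  note [lin] = clinear_compose[OF \<phi>]
  have "co (projr \<phi> ra co v) = tlift (\<lambda>m h. co (ra m (\<phi> (antipode H h)))) (co v)"
    by (simp add: projr_def lin push)
  also have "\<dots> = tlift (\<lambda>m h. tlift (\<lambda>n k. tlift (\<lambda>x y. ra n (\<phi> x) \<otimes> mult H k y)
      (comul H (antipode H h))) (co m)) (co v)"
    using v unfolding tens_def
    by (rule clinear_eq_on_span[rotated 2])
      (auto simp: lin tlift_tensor co_ra colinear_at_def push)
  also have "\<dots> = tlift (\<lambda>m h. tlift (\<lambda>n k. tlift (\<lambda>x y.
      ra n (\<phi> (antipode H y)) \<otimes> mult H k (antipode H x)) (comul H h)) (co m)) (co v)"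
    by (simp add: antipode_anticomult push lin tlift_tensor)
  also have "\<dots> = tlift (\<lambda>m h. tlift (\<lambda>k l. tlift (\<lambda>x y.
      ra m (\<phi> (antipode H y)) \<otimes> mult H k (antipode H x)) (comul H l)) (comul H h)) (co v)"
    by (rule co_coassoc_sw) (simp add: lin)
  also have "\<dots> = tlift (\<lambda>m h. tlift (\<lambda>l y. tlift (\<lambda>k x.
      ra m (\<phi> (antipode H y)) \<otimes> mult H k (antipode H x)) (comul H l)) (comul H h)) (co v)"
    by (subst coassoc_sw[symmetric]) (simp_all add: lin)
  also have "\<dots> = projr \<phi> ra co v \<otimes> unity H"
    by (simp add: antipode_right_sw counit_left_sw lin projr_def push)
  finally show ?thesis by (simp add: coinv_def)
qed

lemma projr_ident: "clinear \<phi> \<Longrightarrow> \<phi> (unity H) = unity A \<Longrightarrow> v \<in> coinv H co \<Longrightarrow> projr \<phi> ra co v = v"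
  by (simp add: projr_def coinv_def tlift_tensor lin clinear_compose antipode_unity ra_unity)

lemma projr_lin [lin]: "clinear \<phi> \<Longrightarrow> clinear f \<Longrightarrow> clinear (\<lambda>x. projr \<phi> ra co (f x))"
  by (simp add: projr_def lin clinear_compose)

end

context hopf_bimodule
begin

lemma projr_la: "clinear \<phi> \<Longrightarrow> b \<in> coinvariants H A \<Longrightarrow> projr \<phi> ra co (la b v) = la b (projr \<phi> ra co v)"
  by (simp add: projr_def co_la coinvariants_def tlift_tensor lin push clinear_compose la_ra)

lemma projl_lin [lin]: "clinear \<phi> \<Longrightarrow> clinear f \<Longrightarrow> clinear (\<lambda>x. projl \<phi> la co (f x))"
  by (simp add: projl_def lin clinear_compose)

lemma projl_ident: "clinear \<phi> \<Longrightarrow> \<phi> (unity H) = unity A \<Longrightarrow> v \<in> coinv H co \<Longrightarrow> projl \<phi> la co v = v"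
  by (simp add: projl_def coinv_def tlift_tensor lin clinear_compose antipode_unity la_unity)

lemma projl_ra: "clinear \<phi> \<Longrightarrow> b \<in> coinvariants H A \<Longrightarrow> projl \<phi> la co (ra v b) = ra (projl \<phi> la co v) b"
  by (simp add: projl_def co_ra coinvariants_def tlift_tensor lin push clinear_compose la_ra)

text \<open>Acting from the left produces \<open>S(v2) v1\<close> in place of
  \<open>v1 S(v2)\<close>; this is the reason for the reversed antipode identity
  \<open>inv\<close>.\<close>

lemma projl_coinv:
  assumes inv: "\<And>h. tlift (\<lambda>x y. mult H (antipode H y) x) (comul H h) = counit H h *\<^sub>C unity H"
    and \<phi>: "clinear \<phi>" and v: "co v \<in> tens UNIV {h. colinear_at \<phi> (antipode H h)}"
  shows "projl \<phi> la co v \<in> coinv H co"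
proof -
  note [lin] = clinear_compose[OF \<phi>]
  have inv_sw: "tlift (\<lambda>x y. f (mult H (antipode H y) x)) (comul H h) = counit H h *\<^sub>C f (unity H)"
    if f: "clinear f" for f :: "'h \<Rightarrow> 'v \<otimes> 'h" and h
    using arg_cong[OF inv, of f h] tlift_push[OF f, of "\<lambda>y z. mult H (antipode H z) y" "comul H h"]
    by (simp add: lin clinear_scale[OF f])
  have "co (projl \<phi> la co v) = tlift (\<lambda>m h. co (la (\<phi> (antipode H h)) m)) (co v)"
    by (simp add: projl_def lin push)
  also have "\<dots> = tlift (\<lambda>m h. tlift (\<lambda>x y. tlift (\<lambda>n k. la (\<phi> x) n \<otimes> mult H y k) (co m))
      (comul H (antipode H h))) (co v)"
    using v unfolding tens_def
    by (rule clinear_eq_on_span[rotated 2])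
      (auto simp: lin tlift_tensor co_la colinear_at_def push)
  also have "\<dots> = tlift (\<lambda>m h. tlift (\<lambda>x y. tlift (\<lambda>n k.
      la (\<phi> (antipode H y)) n \<otimes> mult H (antipode H x) k) (co m)) (comul H h)) (co v)"
    by (simp add: antipode_anticomult push lin tlift_tensor)
  also have "\<dots> = tlift (\<lambda>m h. tlift (\<lambda>n k. tlift (\<lambda>x y.
      la (\<phi> (antipode H y)) n \<otimes> mult H (antipode H x) k) (comul H h)) (co m)) (co v)"
    by (subst tlift_swap) (simp_all add: lin)
  also have "\<dots> = tlift (\<lambda>m h. tlift (\<lambda>k l. tlift (\<lambda>x y.
      la (\<phi> (antipode H y)) m \<otimes> mult H (antipode H x) k) (comul H l)) (comul H h)) (co v)"
    by (rule co_coassoc_sw) (simp add: lin)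
  also have "\<dots> = tlift (\<lambda>m h. tlift (\<lambda>l y. tlift (\<lambda>k x.
      la (\<phi> (antipode H y)) m \<otimes> mult H (antipode H x) k) (comul H l)) (comul H h)) (co v)"
    by (subst coassoc_sw[symmetric]) (simp_all add: lin)
  also have "\<dots> = projl \<phi> la co v \<otimes> unity H"
    by (simp add: inv_sw counit_left_sw lin projl_def push)
  finally show ?thesis by (simp add: coinv_def)
qed

end

text \<open>A total integral is only required at finitely many elements at a time: this suffices below,
  and the space of linear maps from a finite-dimensional space to \<open>A\<close> commutes with tensor
  products over \<open>B\<close>.\<close>

locale integrable_extension = galois_extension H A
  for H :: "('h::complex_vector) hopf" and A :: "('a::complex_vector, 'h) comod" +
  assumes antipode_inv: "tlift (\<lambda>x y. mult H (antipode H y) x) (comul H h) = counit H h *\<^sub>C unity H"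
    and integral: "finite F \<Longrightarrow> \<exists>\<phi>. clinear \<phi> \<and> \<phi> (unity H) = unity A \<and> (\<forall>h\<in>F. colinear_at \<phi> h)"
begin

text \<open>Each \<open>co v\<close> involves finitely many second legs, and \<open>integral\<close>
  is applied to their antipodes, where the projections evaluate \<open>\<phi>\<close>.\<close>

lemma integral_tens:
  fixes co :: "'v::complex_vector \<Rightarrow> 'v \<otimes> 'h"
  assumes "finite X"
  shows "\<exists>\<phi>. clinear \<phi> \<and> \<phi> (unity H) = unity A \<and>
    (\<forall>v\<in>X. co v \<in> tens UNIV {h. colinear_at \<phi> (antipode H h)})"
proof -
  have "\<exists>Y. finite Y \<and> co v \<in> tens UNIV Y" for v
    using tens_finite[of "co v" UNIV UNIV] tens_mono[OF subset_UNIV subset_refl] by fastforce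
  then obtain Y where Y: "\<And>v. finite (Y v)" "\<And>v. co v \<in> tens UNIV (Y v)" by metis
  obtain \<phi> where \<phi>: "clinear \<phi>" "\<phi> (unity H) = unity A"
    "\<forall>h\<in>antipode H ` (\<Union>v\<in>X. Y v). colinear_at \<phi> h"
    using integral[of "antipode H ` (\<Union>v\<in>X. Y v)"] Y(1) assms by auto
  have "co v \<in> tens UNIV {h. colinear_at \<phi> (antipode H h)}" if "v \<in> X" for v
    using Y(2) tens_mono[of UNIV UNIV "Y v" "{h. colinear_at \<phi> (antipode H h)}"] \<phi>(3) that by auto
  then show ?thesis using \<phi> by blast
qed

end

section \<open>Cancellation of the inner tensor factors\<close>

context comodule_algebra
begin

definition raA :: "'a \<otimes> 'a \<Rightarrow> 'a \<Rightarrow> 'a \<otimes> 'a" where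
  "raA w b = tmap id (\<lambda>x. mult A x b) w"

lemma raA_tensor: "raA (x \<otimes> y) b = x \<otimes> mult A y b"
  by (simp add: raA_def tmap_tensor lin)

lemma raA_lin [lin]: "clinear f \<Longrightarrow> clinear (\<lambda>x. raA (f x) b)"
  by (simp add: raA_def lin)

abbreviation ES2 :: "('a \<otimes> 'a) set" where
  "ES2 \<equiv> coinv H diag"

definition mid :: "('a \<Rightarrow> 'v \<Rightarrow> 'v) \<Rightarrow> ('a \<otimes> 'a) \<otimes> 'v::complex_vector \<Rightarrow> 'a \<otimes> 'v" where
  "mid la = tlift (\<lambda>u v. tlift (\<lambda>x y. x \<otimes> la y v) u)"

text \<open>The candidate inverse of \<open>mid\<close>: the translation map is inserted between the
  two factors. It depends on the representatives chosen by \<open>translation_rep\<close>, so it can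
  invert \<open>mid\<close> only modulo balancing relations.\<close>

definition unmid :: "('a \<Rightarrow> 'v \<Rightarrow> 'v) \<Rightarrow> 'a \<otimes> 'v::complex_vector \<Rightarrow> ('a \<otimes> 'a) \<otimes> 'v" where
  "unmid la = tlift (\<lambda>a v. tlift (\<lambda>x h. tlift (\<lambda>p q. (x \<otimes> p) \<otimes> la q v)
     (translation_rep H A h)) (coact A a))"

lemma hopf_bimodule_AA: "hopf_bimodule H A raA diag laA"
  using right_hopf_module.hopf_bimodule_tens[OF right_hopf_module_self] unfolding raA_def .

end

locale integrable_bimodule = integrable_extension H A + N: hopf_bimodule H A ra co la
  for H :: "('h::complex_vector) hopf" and A :: "('a::complex_vector, 'h) comod"
    and ra :: "'v::complex_vector \<Rightarrow> 'a \<Rightarrow> 'v" and co :: "'v \<Rightarrow> 'v \<otimes> 'h" and la :: "'a \<Rightarrow> 'v \<Rightarrow> 'v"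
begin

lemma mid_lin [lin]: "clinear f \<Longrightarrow> clinear (\<lambda>x. mid la (f x))"
  by (simp add: mid_def lin)

lemma unmid_lin [lin]: "clinear f \<Longrightarrow> clinear (\<lambda>x. unmid la (f x))"
  by (simp add: unmid_def lin)

lemma mid_push [push]: "cbilinear \<beta> \<Longrightarrow> mid la (tlift \<beta> u) = tlift (\<lambda>x y. mid la (\<beta> x y)) u"
  by (rule tlift_push) (simp_all add: lin)

lemma mid_tensor: "mid la (u \<otimes> v) = tlift (\<lambda>x y. x \<otimes> la y v) u"
  by (simp add: mid_def tlift_tensor lin)

lemma unmid_tensor: "unmid la (a \<otimes> v) = tlift (\<lambda>x h. tlift (\<lambda>p q. (x \<otimes> p) \<otimes> la q v) (T h)) (coact A a)"
  by (simp add: unmid_def tlift_tensor lin)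

lemma mid_balance:
  assumes "u \<in> balance (coinvariants H A) raA la M N"
  shows "mid la u = 0"
proof -
  have "mid la (raA w b \<otimes> v - w \<otimes> la b v) = 0" for w b v
  proof -
    have "(\<lambda>w. mid la (raA w b \<otimes> v)) = (\<lambda>w. mid la (w \<otimes> la b v))"
      by (rule tensor_ext) (simp_all add: lin mid_tensor tlift_tensor raA_tensor N.la_assoc)
    then show ?thesis by (simp add: clinear_diff[OF mid_lin[OF clinear_ident]] fun_eq_iff)
  qed
  then have "mid la u \<in> {0}"
    using assms unfolding balance_def
    by (intro clinear_image_span_subset[of "mid la" "{0}" _ u])
      (auto simp: lin cvec.subspace_single_0)
  then show ?thesis by simp
qed

text \<open>For \<open>c\<close> a sum of terms \<open>x \<otimes> x'\<close>, the two tensors come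
  from \<open>P c\<close>, with terms \<open>x0 \<otimes> T(x1) x'\<close>, and \<open>P' c\<close>,
  with terms \<open>x \<otimes> x' \<otimes> 1\<close>. Under \<open>tmap id (can_lift A)\<close>
  these become \<open>x0 \<otimes> x'0 \<otimes> x1 x'1\<close> and
  \<open>x \<otimes> x' \<otimes> 1\<close>, which agree by coinvariance. Injectivity of the
  canonical map then yields the congruence.\<close>

lemma unmid_mid_tensor:
  assumes c: "c \<in> ES2"
  shows "unmid la (mid la (c \<otimes> v)) - c \<otimes> v \<in> balance (coinvariants H A) raA la UNIV UNIV"
proof -
  define L :: "'a \<otimes> 'a \<otimes> 'a \<Rightarrow> ('a \<otimes> 'a) \<otimes> 'v"
    where "L = tlift (\<lambda>x w. tlift (\<lambda>p q. (x \<otimes> p) \<otimes> la q v) w)"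
  define P :: "'a \<otimes> 'a \<Rightarrow> 'a \<otimes> 'a \<otimes> 'a" where "P = tlift (\<lambda>x x'. tlift (\<lambda>y h. y \<otimes> tlift (\<lambda>p q. p \<otimes> mult A q x') (T h)) (coact A x))"
  define P' :: "'a \<otimes> 'a \<Rightarrow> 'a \<otimes> 'a \<otimes> 'a" where "P' = tlift (\<lambda>x x'. x \<otimes> (x' \<otimes> unity A))"
  have lins [lin]: "clinear f \<Longrightarrow> clinear (\<lambda>x. L (f x))" "clinear g \<Longrightarrow> clinear (\<lambda>x. P (g x))"
    "clinear g \<Longrightarrow> clinear (\<lambda>x. P' (g x))"
    for f :: "'d::complex_vector \<Rightarrow> 'a \<otimes> 'a \<otimes> 'a" and g :: "'d::complex_vector \<Rightarrow> 'a \<otimes> 'a"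
    by (simp_all add: L_def P_def P'_def lin)
  have L: "L (x \<otimes> w) = tlift (\<lambda>p q. (x \<otimes> p) \<otimes> la q v) w" for x w
    by (simp add: L_def tlift_tensor lin)
  have P: "P (x \<otimes> x') = tlift (\<lambda>y h. y \<otimes> tlift (\<lambda>p q. p \<otimes> mult A q x') (T h)) (coact A x)" for x x'
    by (simp add: P_def tlift_tensor lin)
  have P': "P' (x \<otimes> x') = x \<otimes> (x' \<otimes> unity A)" for x x'
    by (simp add: P'_def tlift_tensor lin)
  have L_push: "cbilinear \<beta> \<Longrightarrow> L (tlift \<beta> u) = tlift (\<lambda>x y. L (\<beta> x y)) u"
    for \<beta> :: "'d::complex_vector \<Rightarrow> 'e::complex_vector \<Rightarrow> 'a \<otimes> 'a \<otimes> 'a" and u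
    by (rule tlift_push) (simp_all add: lin)
  have 1: "unmid la (mid la (c \<otimes> v)) = L (P c)"    by (rule tensor_eqI[where u = c]) (simp_all add: lin mid_tensor tlift_tensor unmid_tensor P L_push L push N.la_assoc)
  have 2: "c \<otimes> v = L (P' c)"    by (rule tensor_eqI[where u = c]) (simp_all add: lin P' L tlift_tensor N.la_unity)
  have can_P: "can_lift A (tlift (\<lambda>p q. p \<otimes> mult A q x') (T h)) = tlift (\<lambda>y k. y \<otimes> mult H h k) (coact A x')" for x' h
  proof -
    have "can_lift A (tlift (\<lambda>p q. p \<otimes> mult A q x') (T h)) =
      tlift (\<lambda>p q. tlift (\<lambda>q0 q1. tlift (\<lambda>y k. mult A (mult A p q0) y \<otimes> mult H q1 k) (coact A x')) (coact A q)) (T h)"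
      by (simp add: push lin can_lift_tensor coact_mult_sw tlift_tensor amult_assoc)
    also have "\<dots> = tlift (\<lambda>y k. mult A (unity A) y \<otimes> mult H h k) (coact A x')"
      by (rule T_can_sw) (simp add: lin)
    finally show ?thesis by simp
  qed
  have "tmap id (can_lift A) (P (x \<otimes> x')) =
      tlift (\<lambda>y h. y \<otimes> tlift (\<lambda>z k. z \<otimes> mult H h k) (coact A x')) (coact A x)" for x x'
    by (simp add: P tmap_tlift tmap_tensor can_P lin)
  then have "(\<lambda>c. tmap id (can_lift A) (P c)) = (\<lambda>c. tassoc (diag c))"
    by (intro tensor_ext)
      (simp_all add: lin coact_linear push tens_coact_tensor)
  then have "tmap id (can_lift A) (P c) = tassoc (c \<otimes> unity H)"
    using c by (simp add: coinv_def fun_eq_iff)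
  also have "tassoc (c \<otimes> unity H) = tmap id (can_lift A) (P' c)"    by (rule tensor_eqI[where u = c]) (simp_all add: lin P' tmap_tensor can_lift_tensor coact_unity tlift_tensor)
  finally have "tmap id (can_lift A) (P c - P' c) = 0"
    by (simp add: tmap_diff lin)
  then have "P c - P' c \<in> tens UNIV {m \<in> UNIV. can_lift A m = 0}"
    by (intro tens_kernel) (simp_all add: lin cvec.subspace_UNIV)
  then have "P c - P' c \<in> tens UNIV bal"
    by (simp add: can_lift_eq_0_iff)
  \<comment> \<open>\<open>L\<close> lets the last leg act on \<open>v\<close>, which turns
    relations in \<open>bal\<close> into relations for \<open>raA\<close> and
    \<open>la\<close>.\<close>
  then have "L (P c - P' c) \<in> balance (coinvariants H A) raA la UNIV UNIV"
    unfolding tens_def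
  proof (rule clinear_image_span_subset[rotated 3])
    fix y :: "'a \<otimes> 'a \<otimes> 'a" assume "y \<in> {x \<otimes> y |x y. x \<in> UNIV \<and> y \<in> bal}"
    then obtain x w where y: "y = x \<otimes> w" "w \<in> bal" by blast
    have "tlift (\<lambda>p q. (x \<otimes> p) \<otimes> la q v) w \<in> balance (coinvariants H A) raA la UNIV UNIV"
      using y(2) unfolding balance_def[of _ "mult A"]
    proof (rule clinear_image_span_subset[rotated 3])
      fix y' assume "y' \<in> {mult A p b \<otimes> q - p \<otimes> mult A b q |p b q. p \<in> UNIV \<and> b \<in> coinvariants H A \<and> q \<in> UNIV}"
      then obtain p b q where y': "y' = mult A p b \<otimes> q - p \<otimes> mult A b q" "b \<in> coinvariants H A" by blast
      have "tlift (\<lambda>p q. (x \<otimes> p) \<otimes> la q v) y' = raA (x \<otimes> p) b \<otimes> la q v - (x \<otimes> p) \<otimes> la b (la q v)"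
        unfolding y' by (subst clinear_diff) (simp_all add: lin tlift_tensor raA_tensor N.la_assoc)
      then show "tlift (\<lambda>p q. (x \<otimes> p) \<otimes> la q v) y' \<in> balance (coinvariants H A) raA la UNIV UNIV"
        using y'(2) by (simp add: balance_base)
    qed (simp_all add: lin balance_subspace)
    then show "L y \<in> balance (coinvariants H A) raA la UNIV UNIV" by (simp add: y L)
  qed (simp_all add: lin balance_subspace)
  then show ?thesis unfolding 1 clinear_diff[OF lins(1)[OF clinear_ident]] 2[symmetric] .
qed

lemma unmid_mid:
  assumes "u \<in> tens ES2 UNIV"
  shows "unmid la (mid la u) - u \<in> balance (coinvariants H A) raA la UNIV UNIV"
  using assms unfolding tens_def
  by (rule clinear_image_span_subset[rotated 3, of _ _ "\<lambda>u. unmid la (mid la u) - u"])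
    (auto simp: lin balance_subspace unmid_mid_tensor)

text \<open>Cancelling with \<open>unmid\<close> only shows that \<open>u\<close> is a combination
  of balancing relations between arbitrary elements. Projecting both legs onto coinvariants fixes
  \<open>u\<close> and moves these relations into the coinvariants.\<close>

lemma mid_injective:
  assumes u: "u \<in> tens ES2 (coinv H co)" and 0: "mid la u = 0"
  shows "u \<in> balance (coinvariants H A) raA la ES2 (coinv H co)"
proof -
  interpret AA: hopf_bimodule H A raA diag laA
    by (rule hopf_bimodule_AA)
  have "u \<in> tens ES2 UNIV" using u tens_mono by blast
  from unmid_mid[OF this] have "- u \<in> balance (coinvariants H A) raA la UNIV UNIV"
    by (simp add: 0 clinear_0[OF unmid_lin[OF clinear_ident]])
  then have "u \<in> balance (coinvariants H A) raA la UNIV UNIV"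
    using cvec.subspace_neg[OF balance_subspace] by fastforce
  then obtain X Y where XY: "finite X" "finite Y" "u \<in> balance (coinvariants H A) raA la X Y"
    using balance_finite[of u] by metis
  obtain \<phi> where \<phi>: "clinear \<phi>" "\<phi> (unity H) = unity A"
    "\<And>v. v \<in> X \<Longrightarrow> diag v \<in> tens UNIV {h. colinear_at \<phi> (antipode H h)}"
    using integral_tens[OF XY(1), of diag] by blast
  obtain \<psi> where \<psi>: "clinear \<psi>" "\<psi> (unity H) = unity A"
    "\<And>v. v \<in> Y \<Longrightarrow> co v \<in> tens UNIV {h. colinear_at \<psi> (antipode H h)}"
    using integral_tens[OF XY(2), of co] by blast
  \<comment> \<open>\<open>p\<close> is right \<open>B\<close>-linear and \<open>q\<close> is left
    \<open>B\<close>-linear, as the relations \<open>x b \<otimes> y - x \<otimes> b y\<close>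
    require.\<close>
  define p where "p = projl \<phi> laA diag"
  define q where "q = projr \<psi> ra co"
  have p: "clinear p" and q: "clinear q"
    unfolding p_def q_def by (rule AA.projl_lin N.projr_lin \<phi> \<psi> clinear_ident)+
  have "tmap p q u = u"
    using u by (rule tmap_tens_ident[OF p q, rotated 2])
      (simp_all add: p_def q_def AA.projl_ident N.projr_ident \<phi> \<psi>)
  moreover have "tmap p q u \<in> balance (coinvariants H A) raA la ES2 (coinv H co)"
    using XY(3) unfolding balance_def[of _ _ _ X]
  proof (rule clinear_image_span_subset[rotated 3])
    fix y assume "y \<in> {raA x b \<otimes> y - x \<otimes> la b y |x b y. x \<in> X \<and> b \<in> coinvariants H A \<and> y \<in> Y}"
    then obtain x b z where y: "y = raA x b \<otimes> z - x \<otimes> la b z" "x \<in> X" "b \<in> coinvariants H A" "z \<in> Y"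
      by blast
    have "tmap p q y = raA (p x) b \<otimes> q z - p x \<otimes> la b (q z)"
      unfolding y(1) using y(3)
      by (simp add: tmap_diff p q tmap_tensor) (simp add: p_def q_def AA.projl_ra N.projr_la \<phi> \<psi>)
    moreover have "p x \<in> ES2" "q z \<in> coinv H co"
      using y unfolding p_def q_def
      by (simp_all add: AA.projl_coinv[OF antipode_inv] N.projr_coinv \<phi> \<psi>)
    ultimately show "tmap p q y \<in> balance (coinvariants H A) raA la ES2 (coinv H co)"
      using y(3) balance_base[where ra = raA and la = la] by metis
  qed (simp_all add: clinear_tmap p q clinear_ident balance_subspace)
  ultimately show ?thesis by simp
qed

text \<open>The legs of \<open>unmid la v\<close> need not be coinvariant. Projecting the second leg
  by \<open>q\<close> becomes, after \<open>mid\<close>, the projection \<open>Q\<close> of the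
  whole of \<open>A \<otimes> V\<close>, which fixes \<open>v\<close>; projecting the first leg by
  \<open>p\<close> then becomes \<open>P\<close>, which fixes \<open>v\<close> too.\<close>

lemma mid_surjective:
  assumes v: "v \<in> coinv H (tens_coact co)"
  shows "\<exists>u \<in> tens ES2 (coinv H co). mid la u = v"
proof -
  interpret AA: hopf_bimodule H A raA diag laA
    by (rule hopf_bimodule_AA)
  interpret AN: hopf_bimodule H A "\<lambda>w a. tmap id (\<lambda>v. ra v a) w" "tens_coact co" laA
    by (rule N.hopf_bimodule_tens)
  obtain X Y where XY: "finite X" "finite Y" "unmid la v \<in> tens X Y"
    using tens_finite[of "unmid la v" UNIV UNIV] by auto
  obtain \<phi> where \<phi>: "clinear \<phi>" "\<phi> (unity H) = unity A"
    "\<And>v. v \<in> X \<Longrightarrow> diag v \<in> tens UNIV {h. colinear_at \<phi> (antipode H h)}"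
    using integral_tens[OF XY(1), of diag] by blast
  obtain \<psi> where \<psi>: "clinear \<psi>" "\<psi> (unity H) = unity A"
    "\<And>v. v \<in> Y \<Longrightarrow> co v \<in> tens UNIV {h. colinear_at \<psi> (antipode H h)}"
    using integral_tens[OF XY(2), of co] by blast
  note [lin] = clinear_compose[OF \<phi>(1)] clinear_compose[OF \<psi>(1)]
  define p where "p = projl \<phi> laA diag"
  define q where "q = projr \<psi> ra co"
  define P where "P = projl \<phi> laA (tens_coact co)"
  define Q where "Q = projr \<psi> (\<lambda>w a. tmap id (\<lambda>v. ra v a) w) (tens_coact co)"
  have p: "clinear p" and q: "clinear q"
    unfolding p_def q_def by (rule AA.projl_lin N.projr_lin \<phi> \<psi> clinear_ident)+
  have P: "clinear P" and Q: "clinear Q"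
    unfolding P_def Q_def by (rule AN.projl_lin AN.projr_lin \<phi> \<psi> clinear_ident)+
  note [lin] = clinear_compose[OF p] clinear_compose[OF q] clinear_compose[OF P] clinear_compose[OF Q]
  define r where "r = tmap id q (unmid la v)"
  have r: "r \<in> tens X (coinv H co)"
    unfolding r_def using XY(3)
    by (rule tmap_tens[rotated 4], simp_all add: clinear_id q, simp add: q_def N.projr_coinv \<psi>)
  \<comment> \<open>The second leg of the translation map passes its degree on to \<open>q\<close>.
    By \<open>T_can_sw\<close> this is the degree of \<open>a\<close>, so the diagonal coaction of
    \<open>a \<otimes> n\<close> appears.\<close>
  have mid_q: "(\<lambda>v. mid la (tmap id q (unmid la v))) = Q"
  proof (rule tensor_ext)
    fix a n
    have "mid la (tmap id q (unmid la (a \<otimes> n))) =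
      tlift (\<lambda>x h. tlift (\<lambda>p q. tlift (\<lambda>y l. tlift (\<lambda>m k. x \<otimes> ra (la (mult A p y) m) (\<psi> (antipode H (mult H l k)))) (co n)) (coact A q)) (T h)) (coact A a)"
      by (simp add: unmid_tensor push lin tmap_tensor mid_tensor tlift_tensor)
        (simp add: q_def projr_def N.co_la push lin tlift_tensor N.la_ra N.la_assoc)
    also have "\<dots> = tlift (\<lambda>x h. tlift (\<lambda>m k. x \<otimes> ra (la (unity A) m) (\<psi> (antipode H (mult H h k)))) (co n)) (coact A a)"
      by (subst T_can_sw) (simp_all add: lin)
    also have "\<dots> = Q (a \<otimes> n)"
      by (simp add: Q_def projr_def tens_coact_tensor N.co_linear lin push tlift_tensor tmap_tensor N.la_unity)
    finally show "mid la (tmap id q (unmid la (a \<otimes> n))) = Q (a \<otimes> n)" .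
  qed (simp_all add: lin)
  have mid_r: "mid la r = v"
    using fun_cong[OF mid_q, of v] AN.projr_ident[OF \<psi>(1,2) v] by (simp add: r_def Q_def)
  define u where "u = tmap p id r"
  have u: "u \<in> tens ES2 (coinv H co)"
    unfolding u_def using r
    by (rule tmap_tens[rotated 4], simp_all add: clinear_id p, simp add: p_def AA.projl_coinv[OF antipode_inv] \<phi>)
  \<comment> \<open>The second legs are coinvariant by now, so the coaction of \<open>la y n\<close>
    comes from \<open>y\<close> alone and \<open>p\<close> matches \<open>P\<close>.\<close>
  have "mid la (tmap p id r) = P (mid la r)"
    using r unfolding tens_def
  proof (rule clinear_eq_on_span[rotated 2])
    fix y assume "y \<in> {x \<otimes> y |x y. x \<in> X \<and> y \<in> coinv H co}"
    then obtain c n where y: "y = c \<otimes> n" and n: "n \<in> coinv H co" by blast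
    have "(\<lambda>c. mid la (tmap p id (c \<otimes> n))) = (\<lambda>c. P (mid la (c \<otimes> n)))"
    proof (rule tensor_ext)
      fix x x'
      have "mid la (tmap p id ((x \<otimes> x') \<otimes> n)) = tlift (\<lambda>x h. tlift (\<lambda>y k.
          mult A (\<phi> (antipode H (mult H h k))) x \<otimes> la y n) (coact A x')) (coact A x)"
        by (simp add: tmap_tensor p clinear_id)
          (simp add: p_def projl_def tens_coact_tensor coact_linear push lin mid_tensor tlift_tensor tmap_tensor)
      also have "\<dots> = P (mid la ((x \<otimes> x') \<otimes> n))"
        using n by (simp add: coinv_def P_def projl_def tens_coact_tensor N.co_linear N.co_la push lin
            mid_tensor tlift_tensor tmap_tensor)
      finally show "mid la (tmap p id ((x \<otimes> x') \<otimes> n)) = P (mid la ((x \<otimes> x') \<otimes> n))" .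
    qed (simp_all add: lin)
    then show "mid la (tmap p id y) = P (mid la y)" by (simp add: y fun_eq_iff)
  qed (simp_all add: lin)
  then have "mid la u = v"
    using AN.projl_ident[OF \<phi>(1,2) v] by (simp add: u_def mid_r P_def)
  then show ?thesis using u by blast
qed

end

lemma tensor_ext3:
  assumes "clinear f" "clinear g" "\<And>x y z. f (x \<otimes> (y \<otimes> z)) = g (x \<otimes> (y \<otimes> z))"
  shows "f = g"
proof (rule tensor_ext[OF assms(1,2)])
  fix x w
  have "(\<lambda>w. f (x \<otimes> w)) = (\<lambda>w. g (x \<otimes> w))"
    by (rule tensor_ext) (simp_all add: lin assms clinear_compose[OF assms(1)] clinear_compose[OF assms(2)])
  then show "f (x \<otimes> w) = g (x \<otimes> w)" by (rule fun_cong)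
qed

lemma tensor_ext4:
  assumes "clinear f" "clinear g"
    "\<And>x p q y. f ((x \<otimes> p) \<otimes> (q \<otimes> y)) = g ((x \<otimes> p) \<otimes> (q \<otimes> y))"
  shows "f = g"
proof (rule tensor_ext3[OF assms(1,2)])
  fix w q y
  have "(\<lambda>w. f (w \<otimes> (q \<otimes> y))) = (\<lambda>w. g (w \<otimes> (q \<otimes> y)))"
    by (rule tensor_ext) (simp_all add: lin assms clinear_compose[OF assms(1)] clinear_compose[OF assms(2)])
  then show "f (w \<otimes> (q \<otimes> y)) = g (w \<otimes> (q \<otimes> y))" by (rule fun_cong)
qed

section \<open>The Ehresmann-Schauenburg bialgebroid\<close>

context comodule_algebra
begin

abbreviation esm :: "'a \<otimes> 'a \<Rightarrow> 'a \<otimes> 'a \<Rightarrow> 'a \<otimes> 'a" where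
  "esm \<equiv> mult (es_algebra A)"

lemma esm_lin [lin]: "clinear f \<Longrightarrow> clinear (\<lambda>x. esm (f x) w)" "clinear f \<Longrightarrow> clinear (\<lambda>x. esm w (f x))"
  by (simp_all add: es_algebra_def tmult_def tlift2_def lin)

lemma esm_tensor: "esm (x \<otimes> x') (y \<otimes> y') = mult A x y \<otimes> mult A y' x'"
  by (simp add: es_algebra_def tmult_tensor amult_bilinear lin)

lemma esm_tgt: "esm (es_tgt A b) w = raA w b"
by (rule tensor_eqI[where u = w])
    (simp_all add: lin esm_tensor es_tgt_def raA_tensor)

lemma esm_src: "esm (es_src A b) = laA b"
  by (rule tensor_ext) (simp_all add: lin esm_tensor es_src_def tmap_tensor)

lemma es_carrier_eq: "es_carrier H A = ES2"
  by (simp add: es_carrier_def coinv_def diagonal_coact_eq)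

lemma es_balance_eq: "es_balance H A M = balance (coinvariants H A) raA laA M M"
  by (simp add: es_balance_def esm_tgt esm_src)

lemma ES2_subspace: "csubspace ES2"
  by (rule coinv_subspace) (simp add: lin coact_linear)

lemma coinvariants_subspace: "csubspace (coinvariants H A)"
  unfolding coinvariants_eq by (rule coinv_subspace) (rule coact_linear)

lemma coinvariants_algebra: "algebra_on (coinvariants H A) A"
proof -
  have "mult A x y \<in> coinvariants H A" if "x \<in> coinvariants H A" "y \<in> coinvariants H A" for x y
    using that by (simp add: coinvariants_def coact_mult_sw tlift_tensor lin)
  moreover have "unity A \<in> coinvariants H A"
    by (simp add: coinvariants_def coact_unity)
  ultimately show ?thesis
    by (simp add: algebra_on_def coinvariants_subspace amult_bilinear amult_assoc)
qed

lemma esm_assoc: "esm (esm x y) z = esm x (esm y z)"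
proof -
  have "esm (esm (a \<otimes> a') (b \<otimes> b')) z = esm (a \<otimes> a') (esm (b \<otimes> b') z)" for a a' b b'
    by (rule fun_cong[of _ _ z], rule tensor_ext) (simp_all add: lin esm_tensor amult_assoc)
  then have "(\<lambda>y. esm (esm (a \<otimes> a') y) z) = (\<lambda>y. esm (a \<otimes> a') (esm y z))" for a a'
    by (intro tensor_ext) (simp_all add: lin)
  then have "(\<lambda>x. esm (esm x y) z) = (\<lambda>x. esm x (esm y z))"
    by (intro tensor_ext) (simp_all add: lin fun_eq_iff)
  then show ?thesis by (rule fun_cong)
qed

text \<open>The opposite product in the second leg nests \<open>y\<close> inside \<open>x\<close>:
  the degree of the product is that of the first leg of \<open>x\<close>, then that of
  \<open>y\<close>, then that of the second leg of \<open>x\<close>. Coinvariance of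
  \<open>y\<close> removes the middle part, and coinvariance of \<open>x\<close> the rest.\<close>

lemma esm_closed:
  assumes x: "x \<in> ES2" and y: "y \<in> ES2"
  shows "esm x y \<in> ES2"
proof -
  have 1: "diag (esm (a \<otimes> a') y) = tlift (\<lambda>c h. tlift (\<lambda>w k. tlift (\<lambda>c' h'.
      esm (c \<otimes> c') w \<otimes> mult H h (mult H k h')) (coact A a')) (diag y)) (coact A a)" for a a' y
  by (rule tensor_eqI[where u = y])
    (simp_all add: lin coact_linear esm_tensor tens_coact_tensor coact_mult_sw push tlift_tensor mult_assoc)
  have "(\<lambda>x. diag (esm x y)) = (\<lambda>x. tlift (\<lambda>w h. esm w y \<otimes> h) (diag x))"
  proof (rule tensor_ext)
    show "diag (esm (a \<otimes> a') y) = tlift (\<lambda>w h. esm w y \<otimes> h) (diag (a \<otimes> a'))" for a a'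
      using y by (simp add: 1 coinv_def tens_coact_tensor coact_linear push lin tlift_tensor)
  qed (simp_all add: lin coact_linear)
  then show ?thesis
    using x by (simp add: coinv_def fun_eq_iff tlift_tensor lin)
qed

lemma es_unity_closed: "unity A \<otimes> unity A \<in> ES2"
  by (simp add: coinv_def tens_coact_tensor coact_linear coact_unity tlift_tensor lin)

lemma es_src_closed: "b \<in> coinvariants H A \<Longrightarrow> es_src A b \<in> ES2"
  by (simp add: coinv_def coinvariants_def es_src_def tens_coact_tensor coact_linear coact_unity tlift_tensor lin)

lemma es_tgt_closed: "b \<in> coinvariants H A \<Longrightarrow> es_tgt A b \<in> ES2"
  by (simp add: coinv_def coinvariants_def es_tgt_def tens_coact_tensor coact_linear coact_unity tlift_tensor lin)

lemma raA_closed: "b \<in> coinvariants H A \<Longrightarrow> x \<in> ES2 \<Longrightarrow> raA x b \<in> ES2"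
  using esm_closed[OF es_tgt_closed] by (simp add: esm_tgt)

lemma laA_closed: "b \<in> coinvariants H A \<Longrightarrow> x \<in> ES2 \<Longrightarrow> laA b x \<in> ES2"
  using esm_closed[OF es_src_closed] by (simp add: esm_src)

text \<open>The multiplication of \<open>A\<close> is colinear for the diagonal coaction.\<close>

lemma es_counit_closed: "w \<in> ES2 \<Longrightarrow> tlift (mult A) w \<in> coinvariants H A"
proof -
  assume w: "w \<in> ES2"
  have "(\<lambda>w. coact A (tlift (mult A) w)) = (\<lambda>w. tlift (\<lambda>u h. tlift (mult A) u \<otimes> h) (diag w))"
    by (rule tensor_ext)
      (simp_all add: lin amult_bilinear tlift_tensor coact_mult_sw tens_coact_tensor coact_linear push)
  then show ?thesis using w
    by (simp add: coinv_def coinvariants_def fun_eq_iff tlift_tensor lin amult_bilinear)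
qed

definition ins :: "'a \<otimes> 'a \<Rightarrow> 'a \<otimes> 'a \<otimes> 'a" where
  "ins = tmap id (\<lambda>y. unity A \<otimes> y)"

lemma ins_lin [lin]: "clinear f \<Longrightarrow> clinear (\<lambda>x. ins (f x))"
  by (simp add: ins_def lin)

lemma ins_tensor: "ins (x \<otimes> y) = x \<otimes> (unity A \<otimes> y)"
  by (simp add: ins_def tmap_tensor lin)

end

text \<open>\<open>flip_closed\<close> and \<open>antipode_inv\<close> are the two consequences of
  commutativity on which the construction rests. As assumptions they can also be supplied for the
  deformed \<open>H\<close>.\<close>

locale ehresmann_schauenburg = integrable_extension H A
  for H :: "('h::complex_vector) hopf" and A :: "('a::complex_vector, 'h) comod" +
  assumes flip_closed: "w \<in> es_carrier H A \<Longrightarrow> tflip w \<in> es_carrier H A"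
begin

sublocale N2: integrable_bimodule H A raA diag laA
  by (intro integrable_bimodule.intro hopf_bimodule_AA integrable_extension_axioms)

sublocale N3: integrable_bimodule H A "\<lambda>w a. tmap id (\<lambda>v. raA v a) w"
    "diag2" laA
  by (intro integrable_bimodule.intro integrable_extension_axioms
      right_hopf_module.hopf_bimodule_tens hopf_bimodule.axioms(1)[OF hopf_bimodule_AA])

end

context ehresmann_schauenburg
begin

text \<open>\<open>kap\<close> vanishes on the balancing relations and is injective on the tensor product of the
  carrier with itself over \<open>B\<close>; the coproduct of \<open>w\<close> is the unique element that it maps to
  \<open>ins w\<close>.  Hence identities between Sweedler expressions may be checked after applying \<open>kap\<close>
  (or \<open>kap3\<close> in the triple tensor product), where no translation map is left.\<close>

abbreviation kap :: "('a \<otimes> 'a) \<otimes> ('a \<otimes> 'a) \<Rightarrow> 'a \<otimes> 'a \<otimes> 'a" where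
  "kap \<equiv> mid laA"

abbreviation kap3 :: "('a \<otimes> 'a) \<otimes> ('a \<otimes> 'a) \<otimes> ('a \<otimes> 'a) \<Rightarrow> 'a \<otimes> 'a \<otimes> 'a \<otimes> 'a" where
  "kap3 u \<equiv> mid laA (tmap id kap u)"

abbreviation balC where
  "balC \<equiv> balance (coinvariants H A) raA laA ES2 ES2"

lemma kap_tensor: "kap ((x \<otimes> p) \<otimes> (q \<otimes> y)) = x \<otimes> (mult A p q \<otimes> y)"
  by (simp add: N2.mid_tensor tlift_tensor lin tmap_tensor)

lemma kap_lin [lin]: "clinear f \<Longrightarrow> clinear (\<lambda>x. kap (f x))"
  by (rule N2.mid_lin)

lemma kap_linear: "clinear kap"
  using kap_lin[OF clinear_ident] .

lemma kap3_lin [lin]: "clinear f \<Longrightarrow> clinear (\<lambda>x. kap3 (f x))"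
  by (intro N3.mid_lin clinear_tmap kap_linear clinear_id)

text \<open>For coinvariant \<open>d\<close>, the map sending \<open>c\<close> to
  \<open>kap (c \<otimes> d)\<close> is colinear.\<close>

lemma kap_coinv:
  assumes u: "u \<in> tens ES2 ES2"
  shows "kap u \<in> coinv H (diag2)"
proof -
  have "diag2 (kap (c \<otimes> d)) = kap (c \<otimes> d) \<otimes> unity H"
    if c: "c \<in> ES2" and d: "d \<in> ES2" for c d
  proof -
    have "(\<lambda>c. diag2 (kap (c \<otimes> d))) =
        (\<lambda>c. tlift (\<lambda>w h. kap (w \<otimes> d) \<otimes> h) (diag c))"
    proof (rule tensor_ext)
      show "diag2 (kap ((x \<otimes> p) \<otimes> d)) =
          tlift (\<lambda>w h. kap (w \<otimes> d) \<otimes> h) (diag (x \<otimes> p))" for x p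
        using d by (simp add: N2.mid_tensor tlift_tensor lin tens_coact_tensor coact_linear
            N2.N.co_linear N2.N.co_la coinv_def push)
    qed (simp_all add: lin coact_linear)
    then show ?thesis using c by (simp add: coinv_def fun_eq_iff tlift_tensor lin)
  qed
  then have "kap y \<in> coinv H (diag2)"
    if "y \<in> {x \<otimes> y |x y. x \<in> ES2 \<and> y \<in> ES2}" for y
    using that by (auto simp: coinv_def)
  from clinear_image_span_subset[OF kap_linear _ this u[unfolded tens_def]] show ?thesis
    by (simp add: coinv_subspace lin coact_linear)
qed

lemma ins_coinv:
  assumes "w \<in> ES2"
  shows "ins w \<in> coinv H (diag2)"
proof -
  have "(\<lambda>w. diag2 (ins w)) = (\<lambda>w. tlift (\<lambda>u h. ins u \<otimes> h) (diag w))"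
    by (rule tensor_ext)
      (simp_all add: lin coact_linear ins_tensor tens_coact_tensor coact_unity tlift_tensor push)
  then show ?thesis using assms by (simp add: coinv_def fun_eq_iff tlift_tensor lin)
qed

lemma kap_eq_iff:
  assumes u: "u \<in> tens ES2 ES2" and v: "v \<in> tens ES2 ES2"
  shows "coset balC u = coset balC v \<longleftrightarrow> kap u = kap v"
proof -
  have "u - v \<in> tens ES2 ES2" using u v by (simp add: cvec.subspace_diff tens_subspace)
  then have "u - v \<in> balC \<longleftrightarrow> kap (u - v) = 0"
    using N2.mid_injective N2.mid_balance by blast
  then show ?thesis
    by (simp add: coset_eq_iff balance_subspace clinear_diff[OF kap_linear])
qed

lemma es_formula_eq: "es_formula H A w = coset (balance (coinvariants H A) raA laA UNIV UNIV)
    (unmid laA (ins w))"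
proof -
  have "tlift (\<lambda>a a'. tlift (\<lambda>x h. tlift (\<lambda>p q. (x \<otimes> p) \<otimes> (q \<otimes> a')) (T h)) (coact A a)) =
    (\<lambda>w. unmid laA (ins w))"
    by (rule tensor_ext) (simp_all add: lin ins_tensor N2.unmid_tensor tlift_tensor tmap_tensor)
  then show ?thesis by (simp add: es_formula_def es_balance_eq fun_eq_iff)
qed

text \<open>Since \<open>unmid\<close> undoes \<open>kap\<close> modulo relations on the full space,
  the class given by \<open>es_formula\<close> contains \<open>u\<close>. Any other candidate
  differs from \<open>u\<close> by such relations, which \<open>kap\<close> kills, and
  \<open>kap\<close> is injective on classes over the carrier.\<close>

lemma es_cop_eq:
  assumes u: "u \<in> tens ES2 ES2" and k: "kap u = ins w"
  shows "es_cop H A w = coset balC u"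
proof -
  let ?U = "balance (coinvariants H A) raA laA UNIV UNIV"
  have sub: "balC \<subseteq> ?U"
    unfolding balance_def by (rule cvec.span_mono) blast
  have "u \<in> tens ES2 UNIV" using u tens_mono by blast
  from N2.unmid_mid[OF this] have eq: "es_formula H A w = coset ?U u"
    by (simp add: es_formula_eq k coset_eq_iff balance_subspace)
  show ?thesis
    unfolding es_cop_def es_balance_eq es_carrier_eq eq
  proof (rule the_equality)
    show "coset balC u \<in> coset balC ` tens ES2 ES2 \<and> coset balC u \<subseteq> coset ?U u"
      using u sub by (auto simp: coset_def)
  next
    fix X assume "X \<in> coset balC ` tens ES2 ES2 \<and> X \<subseteq> coset ?U u"
    then obtain v where v: "v \<in> tens ES2 ES2" "X = coset balC v" "coset balC v \<subseteq> coset ?U u" by blast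
    have "v + 0 \<in> coset balC v" using cvec.subspace_0[OF balance_subspace] by (metis coset_def imageI)
    then have "v \<in> coset ?U u" using v(3) by auto
    then obtain r where r: "r \<in> ?U" "v = u + r" by (auto simp: coset_def)
    then have "kap v = kap u"
      using N2.mid_balance[OF r(1)] by (simp add: clinear_add[OF kap_linear])
    then show "X = coset balC u" using u v kap_eq_iff by metis
  qed
qed

abbreviation "L \<equiv> ES H A"

lemma ES_simps:
  "base_carrier L = coinvariants H A" "base L = alg.truncate A" "total_carrier L = ES2"
  "total L = es_algebra A" "src L = es_src A" "tgt L = es_tgt A" "cop L = es_cop H A"
  "cou L = tlift (mult A)" "ract L = raA" "lact L = laA"
  by (simp_all add: ES_def es_carrier_eq esm_tgt esm_src fun_eq_iff)

lemma class2_eq: "class2 L = coset balC"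
  by (simp add: class2_def ES_simps esm_tgt esm_src)

lemma class2_eqI: "u \<in> tens ES2 ES2 \<Longrightarrow> v \<in> tens ES2 ES2 \<Longrightarrow> kap u = kap v \<Longrightarrow> class2 L u = class2 L v"
  by (simp add: class2_eq kap_eq_iff)

text \<open>Surjectivity of \<open>kap\<close> onto the coinvariants supplies some \<open>u\<close>
  with \<open>kap u = ins w\<close>, hence a representative of the coproduct;
  \<open>kap_eq_iff\<close> compares it with \<open>D w\<close>.\<close>

lemma cop_lift_iff:
  "cop_lift L D \<longleftrightarrow> clinear D \<and> (\<forall>w\<in>ES2. D w \<in> tens ES2 ES2 \<and> kap (D w) = ins w)"
proof -
  have "es_cop H A w = coset balC (D w) \<longleftrightarrow> kap (D w) = ins w"
    if w: "w \<in> ES2" and D: "D w \<in> tens ES2 ES2" for w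
  proof -
    obtain u where u: "u \<in> tens ES2 ES2" "kap u = ins w"
      using N2.mid_surjective[OF ins_coinv[OF w]] by blast
    show ?thesis using es_cop_eq[OF u] kap_eq_iff[OF u(1) D] u(2) by auto
  qed
  then show ?thesis
    unfolding cop_lift_def by (auto simp: ES_simps class2_eq)
qed

text \<open>A linear right inverse of \<open>kap\<close> on \<open>tens ES2 ES2\<close> selects the
  preimages of \<open>ins w\<close> linearly.\<close>

lemma cop_lift_exists: "\<exists>D. cop_lift L D"
proof -
  obtain g where g: "clinear g" "range g \<subseteq> tens ES2 ES2" "\<And>v. v \<in> tens ES2 ES2 \<Longrightarrow> kap (g (kap v)) = kap v"
    using clinear_right_inverse[OF kap_linear tens_subspace[of ES2 ES2]] by blast
  have "kap (g (ins w)) = ins w" if w: "w \<in> ES2" for w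
    using N2.mid_surjective[OF ins_coinv[OF w]] g(3) by metis
  then have "cop_lift L (\<lambda>w. g (ins w))"
    using g(1,2) by (auto simp: cop_lift_iff lin clinear_compose[OF g(1)])
  then show ?thesis by blast
qed

definition bal3 where "bal3 = cspan
     ({ract L x b \<otimes> y \<otimes> z - x \<otimes> lact L b y \<otimes> z | x y z b. x \<in> total_carrier L \<and>
        y \<in> total_carrier L \<and> z \<in> total_carrier L \<and> b \<in> base_carrier L} \<union>
      {x \<otimes> ract L y b \<otimes> z - x \<otimes> y \<otimes> lact L b z | x y z b. x \<in> total_carrier L \<and>
        y \<in> total_carrier L \<and> z \<in> total_carrier L \<and> b \<in> base_carrier L})"

lemma bal3_subspace: "csubspace bal3"
  unfolding bal3_def by (rule cvec.subspace_span)

lemma class3_eq: "class3 L = coset bal3"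
  by (simp add: class3_def bal3_def)

lemma kap_laA: "kap (tmap (laA b) id v) = laA b (kap v)"
proof -
  have "(\<lambda>v. kap (tmap (laA b) id v)) = (\<lambda>v. laA b (kap v))"
    by (rule tensor_ext4) (simp_all add: lin tmap_tensor kap_tensor)
  then show ?thesis by (rule fun_cong)
qed

text \<open>The outer cancellation is undone before the inner one. It presents
  \<open>tmap id kap u\<close> as a combination of balancing relations over coinvariants;
  surjectivity of \<open>kap\<close> lifts these to some \<open>w\<close> in \<open>bal3\<close>,
  and \<open>u - w\<close> lies in the kernel of \<open>tmap id kap\<close>.\<close>

lemma kap3_injective:
  assumes u: "u \<in> tens ES2 (tens ES2 ES2)" and 0: "kap3 u = 0"
  shows "u \<in> bal3"
proof -
  let ?B = "coinvariants H A" and ?N = "coinv H (diag2)"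
  have "tmap id kap u \<in> tens ES2 ?N"
    using u by (rule tmap_tens[OF clinear_id kap_linear, rotated 2]) (simp_all add: kap_coinv)
  then have "tmap id kap u \<in> balance ?B raA laA ES2 ?N"
    using 0 by (rule N3.mid_injective)
  note * = this
  have klin: "clinear (tmap id kap)" by (intro clinear_tmap clinear_id kap_linear clinear_ident)
  have "\<exists>w. w \<in> bal3 \<and> w \<in> tens ES2 (tens ES2 ES2) \<and> tmap id kap w = tmap id kap u"
    using * unfolding balance_def
  proof (induction rule: cvec.span_induct_alt)
    case base
    then show ?case
      using tmap_0[OF clinear_id kap_linear] cvec.subspace_0[OF bal3_subspace] cvec.subspace_0[OF tens_subspace] by blast
  next
    case (step k t r)
    then obtain w where w: "w \<in> bal3" "w \<in> tens ES2 (tens ES2 ES2)" "tmap id kap w = r" by blast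
    obtain x b n where t: "t = raA x b \<otimes> n - x \<otimes> laA b n" "x \<in> ES2" "b \<in> ?B" "n \<in> ?N"
      using step(1) by blast
    obtain v where v: "v \<in> tens ES2 ES2" "kap v = n" using N2.mid_surjective[OF t(4)] by blast
    define s where "s = raA x b \<otimes> v - x \<otimes> tmap (laA b) id v"
    have s1: "tmap id kap s = t"
      using v(2) by (simp add: s_def t(1) tmap_diff clinear_id kap_linear tmap_tensor kap_laA)
    have "tmap (laA b) id v \<in> tens ES2 ES2"
      using v(1) by (rule tmap_tens[rotated 4]) (simp_all add: lin laA_closed t)
    then have s2: "s \<in> tens ES2 (tens ES2 ES2)"
      unfolding s_def using t v by (intro cvec.subspace_diff tens_subspace tens_tensor raA_closed)
    have s3: "s \<in> bal3"
      using v(1) unfolding s_def tens_def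
    proof (rule clinear_image_span_subset[rotated 3])
      fix v assume "v \<in> {x \<otimes> y |x y. x \<in> ES2 \<and> y \<in> ES2}"
      then obtain y z where "v = y \<otimes> z" "y \<in> ES2" "z \<in> ES2" by blast
      then show "raA x b \<otimes> v - x \<otimes> tmap (laA b) id v \<in> bal3"
        unfolding bal3_def ES_simps esm_tgt esm_src using t(2,3)
        by (intro cvec.span_base UnI1) (force simp: tmap_tensor[of "laA b"] lin)
    qed (simp_all add: lin bal3_subspace)
    have "tmap id kap (k *\<^sub>C s + w) = k *\<^sub>C t + r"
      by (simp only: clinear_add[OF klin] clinear_scale[OF klin] s1 w(3))
    moreover have "k *\<^sub>C s + w \<in> bal3" "k *\<^sub>C s + w \<in> tens ES2 (tens ES2 ES2)"
      using w s2 s3 by (simp_all add: cvec.subspace_add cvec.subspace_scale bal3_subspace tens_subspace)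
    ultimately show ?case by blast
  qed
  then obtain w where w: "w \<in> bal3" "w \<in> tens ES2 (tens ES2 ES2)" "tmap id kap w = tmap id kap u" by blast
  \<comment> \<open>Over the complex numbers this kernel comes from the kernel of \<open>kap\<close>
    on the last two factors, which consists of relations of the second kind in
    \<open>bal3\<close>.\<close>
  have "u - w \<in> tens ES2 {m \<in> tens ES2 ES2. kap m = 0}"
    using u w by (intro tens_kernel kap_linear tens_subspace)
      (simp_all add: cvec.subspace_diff tens_subspace tmap_diff clinear_id kap_linear)
  moreover have "{m \<in> tens ES2 ES2. kap m = 0} \<subseteq> balC"
    using N2.mid_injective by blast
  ultimately have "u - w \<in> tens ES2 balC" using tens_mono by blast
  then have "u - w \<in> bal3"
    unfolding tens_def[of _ balC]
  proof (rule clinear_image_span_subset[OF clinear_ident bal3_subspace, rotated])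
    fix t assume "t \<in> {x \<otimes> y |x y. x \<in> ES2 \<and> y \<in> balC}"
    then obtain x m where t: "t = x \<otimes> m" "x \<in> ES2" "m \<in> balC" by blast
    from t(3) have "x \<otimes> m \<in> bal3"
      unfolding balance_def
    proof (rule clinear_image_span_subset[rotated 3])
      fix m assume "m \<in> {raA x b \<otimes> y - x \<otimes> laA b y |x b y. x \<in> ES2 \<and> b \<in> ?B \<and> y \<in> ES2}"
      then obtain y b z where "m = raA y b \<otimes> z - y \<otimes> laA b z" "y \<in> ES2" "b \<in> ?B" "z \<in> ES2" by blast
      then show "x \<otimes> m \<in> bal3"
        unfolding bal3_def ES_simps esm_tgt esm_src using t(2)
        by (intro cvec.span_base UnI2) (force simp: tensor_diff)
    qed (simp_all add: lin bal3_subspace)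
    then show "t \<in> bal3" by (simp add: t(1))
  qed
  then show ?thesis using cvec.subspace_add[OF bal3_subspace _ w(1)] by fastforce
qed

lemma class3_eqI:
  assumes "u \<in> tens ES2 (tens ES2 ES2)" "v \<in> tens ES2 (tens ES2 ES2)" "kap3 u = kap3 v"
  shows "class3 L u = class3 L v"
proof -
  have "kap3 (u - v) = 0"
    using clinear_diff[OF kap3_lin[OF clinear_ident]] assms(3) by simp
  then show ?thesis
    using kap3_injective[of "u - v"] assms
    by (simp add: class3_eq coset_eq_iff bal3_subspace cvec.subspace_diff tens_subspace)
qed

end

section \<open>Verification of the bialgebroid and antipode axioms\<close>

context ehresmann_schauenburg
begin

lemma cop_liftD:
  assumes "cop_lift L D"
  shows "clinear D" "w \<in> ES2 \<Longrightarrow> D w \<in> tens ES2 ES2" "w \<in> ES2 \<Longrightarrow> kap (D w) = ins w"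
  using assms by (auto simp: cop_lift_iff)

lemma kap_eq_on:
  assumes "clinear f" "clinear g" "\<And>c d. c \<in> ES2 \<Longrightarrow> d \<in> ES2 \<Longrightarrow> f (c \<otimes> d) = g (kap (c \<otimes> d))"
    "u \<in> tens ES2 ES2"
  shows "f u = g (kap u)"
  by (rule clinear_eq_on_span[OF assms(1) clinear_compose[OF assms(2) kap_linear]
      assms(4)[unfolded tens_def]]) (use assms(3) in blast)

lemma tens_image_in:
  assumes "clinear f" "csubspace V" "\<And>c d. c \<in> ES2 \<Longrightarrow> d \<in> ES2 \<Longrightarrow> f (c \<otimes> d) \<in> V" "u \<in> tens ES2 ES2"
  shows "f u \<in> V"
  using assms(4) unfolding tens_def
  by (rule clinear_image_span_subset[rotated 3]) (use assms(1-3) in auto)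

lemma flip_ES2: "w \<in> ES2 \<Longrightarrow> tflip w \<in> ES2"
  using flip_closed by (simp add: es_carrier_eq)

lemma cop_unique_rep: "u \<in> tens ES2 ES2 \<Longrightarrow> kap u = ins w \<Longrightarrow> cop L w = class2 L u"
  by (simp add: ES_simps class2_eq es_cop_eq)

lemma total_algebra: "algebra_on ES2 (es_algebra A)"
proof -
  have u: "unity (es_algebra A) = unity A \<otimes> unity A" by (simp add: es_algebra_def)
  have "esm (unity A \<otimes> unity A) w = w" "esm w (unity A \<otimes> unity A) = w" for w
  proof -
    have "esm (unity A \<otimes> unity A) = (\<lambda>w. w)" "(\<lambda>w. esm w (unity A \<otimes> unity A)) = (\<lambda>w. w)"
      by (rule tensor_ext; simp add: lin esm_tensor)+
    then show "esm (unity A \<otimes> unity A) w = w" "esm w (unity A \<otimes> unity A) = w" by metis+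
  qed
  then show ?thesis
    by (simp add: algebra_on_def ES2_subspace u es_unity_closed esm_closed esm_assoc lin)
qed

lemma base_algebra: "algebra_on (coinvariants H A) (alg.truncate A)"
  using coinvariants_algebra by (simp add: algebra_on_def alg.truncate_def)

lemma cou_lin [lin]: "clinear f \<Longrightarrow> clinear (\<lambda>x. tlift (mult A) (f x))"
  by (simp add: lin amult_bilinear)

lemma tlift_amult_tensor: "tlift (mult A) (x \<otimes> y) = mult A x y"
  by (simp add: tlift_tensor amult_bilinear)

text \<open>For \<open>w\<close> a sum of terms \<open>x \<otimes> y\<close>, both sides have the
  image with terms \<open>x \<otimes> 1 \<otimes> 1 \<otimes> y\<close> under
  \<open>kap3\<close>.\<close>

lemma coassoc_ES:
  assumes D: "cop_lift L D" and w: "w \<in> ES2"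
  shows "class3 L (tassoc (tmap D id (D w))) = class3 L (tmap id D (D w))"
proof (rule class3_eqI)
  note Dl = cop_liftD(1)[OF D] and Dt = cop_liftD(2)[OF D] and Dk = cop_liftD(3)[OF D]
  note [lin] = clinear_compose[OF Dl]
  note Dw = Dt[OF w] Dk[OF w]
  show "tmap id D (D w) \<in> tens ES2 (tens ES2 ES2)"
    using Dw(1) by (rule tmap_tens[OF clinear_id Dl, rotated 2]) (simp_all add: Dt)
  have assoc_t: "tassoc (t \<otimes> d) \<in> tens ES2 (tens ES2 ES2)" if "t \<in> tens ES2 ES2" "d \<in> ES2" for t d
    using that(1) by (rule tens_image_in[rotated 3]) (simp_all add: lin tens_subspace tens_tensor that)
  show "tassoc (tmap D id (D w)) \<in> tens ES2 (tens ES2 ES2)"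
    using Dw(1) by (rule tens_image_in[rotated 3])
      (simp_all add: lin Dl tens_subspace tmap_tensor assoc_t Dt)
  \<comment> \<open>\<open>J\<close> and \<open>K\<close> insert a further unit after and before the
    middle factor. They agree on \<open>ins w\<close>, whose middle factor is 1.\<close>
  define J where "J = tmap (id :: 'a \<Rightarrow> 'a) ins"
  define J' where "J' = (\<lambda>t :: 'a \<otimes> 'a. unity A \<otimes> t)"
  define K where "K = tmap (id :: 'a \<Rightarrow> 'a) J'"
  have J: "clinear J" and J': "clinear J'" and K: "clinear K"
    by (simp_all add: J_def J'_def K_def lin)
  have "kap3 (tmap id D (D w)) = J (kap (D w))"
  proof (rule kap_eq_on[OF _ J _ Dw(1)])
    show "clinear (\<lambda>u. kap3 (tmap id D u))" by (intro kap3_lin clinear_tmap clinear_id clinear_ident Dl)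
    fix c d assume "c \<in> ES2" "d \<in> ES2"
    then have "kap3 (tmap id D (c \<otimes> d)) = mid laA (c \<otimes> ins d)"
      by (simp add: tmap_tensor[OF clinear_id Dl] tmap_tensor[OF clinear_id kap_linear] Dk)
    moreover have "(\<lambda>u. mid laA (tmap id ins u)) = (\<lambda>u. J (kap u))"
      by (rule tensor_ext4)
        (simp_all add: lin J clinear_compose[OF J] N3.mid_lin N3.mid_tensor kap_tensor tlift_tensor
          tmap_tensor ins_tensor J_def)
    from fun_cong[OF this, of "c \<otimes> d"] have "mid laA (c \<otimes> ins d) = J (kap (c \<otimes> d))"
      by (simp add: tmap_tensor lin)
    ultimately show "kap3 (tmap id D (c \<otimes> d)) = J (kap (c \<otimes> d))" by simp
  qed
  moreover have "kap3 (tassoc (tmap D id (D w))) = K (kap (D w))"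
  proof (rule kap_eq_on[OF _ K _ Dw(1)])
    show "clinear (\<lambda>u. kap3 (tassoc (tmap D id u)))"
      by (intro kap3_lin clinear_tassoc clinear_tmap clinear_id clinear_ident Dl)
    fix c d assume c: "c \<in> ES2" and "d \<in> ES2"
    \<comment> \<open>\<open>V d\<close> multiplies the last leg of a triple tensor into
      \<open>d\<close>; this is how the third factor \<open>d\<close> enters
      \<open>kap3\<close>.\<close>
    define V where "V d = tmap (id :: 'a \<Rightarrow> 'a) (tmap (id :: 'a \<Rightarrow> 'a) (\<lambda>s. laA s d))" for d :: "'a \<otimes> 'a"
    have V: "clinear (V d)" for d by (simp add: V_def lin)
    have "(\<lambda>t. kap3 (tassoc (t \<otimes> (q \<otimes> y)))) = (\<lambda>t. V (q \<otimes> y) (kap t))" for q y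
    proof (rule tensor_ext4)
      show "clinear (\<lambda>t. kap3 (tassoc (t \<otimes> (q \<otimes> y))))"
        by (intro kap3_lin clinear_tassoc clinear_tensor_left clinear_ident)
      show "clinear (\<lambda>t. V (q \<otimes> y) (kap t))"
        by (rule clinear_compose[OF V kap_linear])
      fix x p r z
      show "kap3 (tassoc (((x \<otimes> p) \<otimes> (r \<otimes> z)) \<otimes> (q \<otimes> y))) = V (q \<otimes> y) (kap ((x \<otimes> p) \<otimes> (r \<otimes> z)))"
        by (simp add: tmap_tensor[OF clinear_id kap_linear] kap_tensor N3.mid_tensor tlift_tensor
          tmap_tensor lin V_def)
    qed
    then have "(\<lambda>d. kap3 (tassoc (t \<otimes> d))) = (\<lambda>d. V d (kap t))" for t
      by (intro tensor_ext kap3_lin clinear_tassoc clinear_tensor_right clinear_ident)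
        (auto simp: V_def lin fun_eq_iff)
    then have "kap3 (tassoc (tmap D id (c \<otimes> d))) = V d (ins c)"
      by (simp add: tmap_tensor[OF Dl clinear_id] Dk[OF c] fun_eq_iff)
    also have "(\<lambda>c. V (q \<otimes> y) (ins c)) = (\<lambda>c. K (kap (c \<otimes> (q \<otimes> y))))" for q y
      by (rule tensor_ext)
        (simp_all add: lin clinear_compose[OF V] clinear_compose[OF K] ins_tensor kap_tensor
          V_def K_def J'_def tmap_tensor)
    then have "(\<lambda>d. V d (ins c)) = (\<lambda>d. K (kap (c \<otimes> d)))"
      by (intro tensor_ext) (auto simp: V_def lin fun_eq_iff clinear_compose[OF K])
    then have "V d (ins c) = K (kap (c \<otimes> d))" by (rule fun_cong)
    finally show "kap3 (tassoc (tmap D id (c \<otimes> d))) = K (kap (c \<otimes> d))" .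
  qed
  moreover have "(\<lambda>w. K (ins w)) = (\<lambda>w. J (ins w))"
    by (rule tensor_ext) (simp_all add: lin clinear_compose[OF J] clinear_compose[OF K] ins_tensor
        K_def J_def J'_def tmap_tensor)
  ultimately show "kap3 (tassoc (tmap D id (D w))) = kap3 (tmap id D (D w))"
    by (simp add: Dw(2) fun_eq_iff)
qed

text \<open>The Sweedler expression factors through \<open>kap\<close> as a linear map
  \<open>E\<close>, which is evaluated at \<open>ins w\<close>. The other axioms follow the same
  pattern.\<close>

lemma cou_left_ES:
  assumes D: "cop_lift L D" and w: "w \<in> ES2"
  shows "tlift (\<lambda>y z. laA (tlift (mult A) y) z) (D w) = w"
proof -
  define E where "E = tlift (\<lambda>a (t :: 'a \<otimes> 'a). laA a t)"
  have E: "clinear E" by (simp add: E_def lin)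
  have "(\<lambda>u. tlift (\<lambda>y z. laA (tlift (mult A) y) z) u) = (\<lambda>u. E (kap u))"
    by (rule tensor_ext4)
      (simp_all add: lin clinear_compose[OF E] kap_tensor tlift_tensor amult_bilinear E_def
        tmap_tensor amult_assoc)
  then have "tlift (\<lambda>y z. laA (tlift (mult A) y) z) (D w) = E (ins w)"
    by (metis cop_liftD(3)[OF D w])
  also have "E (ins w) = w"    by (rule tensor_eqI[where u = w]) (simp_all add: lin clinear_compose[OF E] ins_tensor E_def tlift_tensor tmap_tensor)
  finally show ?thesis .
qed

lemma cou_right_ES:
  assumes D: "cop_lift L D" and w: "w \<in> ES2"
  shows "tlift (\<lambda>y z. raA y (tlift (mult A) z)) (D w) = w"
proof -
  define E where "E = tmap (id :: 'a \<Rightarrow> 'a) (tlift (mult A))"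
  have E: "clinear E" by (simp add: E_def lin)
  have raA_lin2: "clinear f \<Longrightarrow> clinear (\<lambda>x. raA y (f x))" for f :: "'c::complex_vector \<Rightarrow> 'a" and y
    by (simp add: raA_def lin)
  have "(\<lambda>u. tlift (\<lambda>y z. raA y (tlift (mult A) z)) u) = (\<lambda>u. E (kap u))"
    by (rule tensor_ext4)
      (simp_all add: lin raA_lin2 clinear_compose[OF E] kap_tensor tlift_tensor amult_bilinear E_def
        tmap_tensor amult_assoc raA_tensor)
  then have "tlift (\<lambda>y z. raA y (tlift (mult A) z)) (D w) = E (ins w)"
    by (metis cop_liftD(3)[OF D w])
  also have "E (ins w) = w"    by (rule tensor_eqI[where u = w]) (simp_all add: lin clinear_compose[OF E] ins_tensor E_def tlift_amult_tensor tmap_tensor)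
  finally show ?thesis .
qed

lemma cop_bimodule_ES:
  assumes D: "cop_lift L D" and w: "w \<in> ES2" and b: "b \<in> coinvariants H A" "b' \<in> coinvariants H A"
  shows "cop L (raA (laA b w) b') = class2 L (tmap (laA b) (\<lambda>y. raA y b') (D w))"
proof (rule cop_unique_rep)
  show "tmap (laA b) (\<lambda>y. raA y b') (D w) \<in> tens ES2 ES2"
    using cop_liftD(2)[OF D w] by (rule tmap_tens[rotated 4]) (simp_all add: lin laA_closed raA_closed b)
  define E where "E = tmap (mult A b) (\<lambda>y. raA y b')"
  have E: "clinear E" by (simp add: E_def lin)
  have "(\<lambda>u. kap (tmap (laA b) (\<lambda>y. raA y b') u)) = (\<lambda>u. E (kap u))"
    by (rule tensor_ext4) (simp_all add: lin clinear_compose[OF E] kap_tensor tmap_tensor E_def raA_tensor)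
  then have "kap (tmap (laA b) (\<lambda>y. raA y b') (D w)) = E (ins w)"
    by (metis cop_liftD(3)[OF D w])
  also have "E (ins w) = ins (raA (laA b w) b')"    by (rule tensor_eqI[where u = w]) (simp_all add: lin clinear_compose[OF E] ins_tensor tmap_tensor E_def raA_tensor)
  finally show "kap (tmap (laA b) (\<lambda>y. raA y b') (D w)) = ins (raA (laA b w) b')" .
qed

text \<open>The two sides multiply the middle factor of \<open>kap (D w)\<close> by \<open>b\<close>
  from the left and from the right, and at \<open>ins w\<close> this factor is 1.\<close>

lemma cop_takeuchi_ES:
  assumes D: "cop_lift L D" and w: "w \<in> ES2" and b: "b \<in> coinvariants H A"
  shows "class2 L (tmap (\<lambda>y. esm y (es_tgt A b)) id (D w)) = class2 L (tmap id (\<lambda>z. esm z (es_src A b)) (D w))"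
proof (rule class2_eqI)
  show "tmap (\<lambda>y. esm y (es_tgt A b)) id (D w) \<in> tens ES2 ES2"
    using cop_liftD(2)[OF D w] by (rule tmap_tens[rotated 4]) (simp_all add: lin esm_closed es_tgt_closed b)
  show "tmap id (\<lambda>z. esm z (es_src A b)) (D w) \<in> tens ES2 ES2"
    using cop_liftD(2)[OF D w] by (rule tmap_tens[rotated 4]) (simp_all add: lin esm_closed es_src_closed b)
  define E where "E = tmap (id :: 'a \<Rightarrow> 'a) (laA b :: 'a \<otimes> 'a \<Rightarrow> _)"
  define F where "F = tmap (id :: 'a \<Rightarrow> 'a) (tmap (\<lambda>x. mult A x b) (id :: 'a \<Rightarrow> 'a))"
  have E: "clinear E" and F: "clinear F" by (simp_all add: E_def F_def lin)
  have "(\<lambda>u. kap (tmap (\<lambda>y. esm y (es_tgt A b)) id u)) = (\<lambda>u. E (kap u))"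
    by (rule tensor_ext4)
      (simp_all add: lin clinear_compose[OF E] kap_tensor tmap_tensor E_def es_tgt_def esm_tensor amult_assoc)
  then have 1: "kap (tmap (\<lambda>y. esm y (es_tgt A b)) id (D w)) = E (ins w)"
    by (metis cop_liftD(3)[OF D w])
  have "(\<lambda>u. kap (tmap id (\<lambda>z. esm z (es_src A b)) u)) = (\<lambda>u. F (kap u))"
    by (rule tensor_ext4)
      (simp_all add: lin clinear_compose[OF F] kap_tensor tmap_tensor F_def es_src_def esm_tensor amult_assoc)
  then have 2: "kap (tmap id (\<lambda>z. esm z (es_src A b)) (D w)) = F (ins w)"
    by (metis cop_liftD(3)[OF D w])
  have "(\<lambda>w. E (ins w)) = (\<lambda>w. F (ins w))"
    by (rule tensor_ext)
      (simp_all add: lin clinear_compose[OF F] clinear_compose[OF E] ins_tensor tmap_tensor E_def F_def)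
  then show "kap (tmap (\<lambda>y. esm y (es_tgt A b)) id (D w)) = kap (tmap id (\<lambda>z. esm z (es_src A b)) (D w))"
    by (simp add: 1 2 fun_eq_iff)
qed

text \<open>For \<open>(x \<otimes> p) \<otimes> (q \<otimes> y)\<close> times
  \<open>(x' \<otimes> p') \<otimes> (q' \<otimes> y')\<close> the middle factor under
  \<open>kap\<close> is \<open>p' p q q'\<close>, because second legs multiply in the opposite
  order. So \<open>p q\<close> forms a block that \<open>ins v\<close> replaces by 1, and then
  \<open>p' q'\<close> forms a block as well.\<close>

lemma cop_mult_ES:
  assumes D: "cop_lift L D" and v: "v \<in> ES2" and w: "w \<in> ES2"
  shows "cop L (esm v w) = class2 L (tmult esm esm (D v) (D w))"
proof (rule cop_unique_rep)
  have bil: "cbilinear esm" by (simp add: lin)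
  have tm: "tmult esm esm (x \<otimes> y) (x' \<otimes> y') = esm x x' \<otimes> esm y y'" for x y x' y'
    by (rule tmult_tensor[OF bil bil])
  have tm_lin: "clinear f \<Longrightarrow> clinear (\<lambda>x. tmult esm esm (f x) t)" "clinear f \<Longrightarrow> clinear (\<lambda>x. tmult esm esm t (f x))"
    for f :: "'c::complex_vector \<Rightarrow> ('a \<otimes> 'a) \<otimes> ('a \<otimes> 'a)" and t
    by (simp_all add: tmult_def tlift2_def lin)
  have "tmult esm esm u t \<in> tens ES2 ES2" if t: "t \<in> tens ES2 ES2" and u: "u \<in> tens ES2 ES2" for t u
    using u
  proof (rule tens_image_in[rotated 3])
    fix c d assume cd: "c \<in> ES2" "d \<in> ES2"
    show "tmult esm esm (c \<otimes> d) t \<in> tens ES2 ES2"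
      using t by (rule tens_image_in[rotated 3])
        (use cd in \<open>simp_all add: tm_lin lin tens_subspace tm tens_tensor esm_closed\<close>)
  qed (simp_all add: tm_lin lin tens_subspace)
  then show "tmult esm esm (D v) (D w) \<in> tens ES2 ES2"
    using cop_liftD(2)[OF D] v w by blast
  define E where "E = (\<lambda>(s :: 'a \<otimes> 'a) (t :: 'a \<otimes> 'a \<otimes> 'a). tlift (\<lambda>a c. tmap (mult A a) (tmap id (\<lambda>y. mult A y c)) t) s)"
  define W where "W = (\<lambda>x' p' (k :: 'a \<otimes> 'a \<otimes> 'a). tlift (\<lambda>a t. tlift (\<lambda>b c. mult A a x' \<otimes> (mult A p' b \<otimes> c)) t) k)"
  have E1: "clinear (\<lambda>s. E s t)" and E2: "clinear (E s)" for s t by (simp_all add: E_def lin)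
  have W: "clinear (W x' p')" for x' p' by (simp add: W_def lin)
  have "(\<lambda>u. kap (tmult esm esm u ((x' \<otimes> p') \<otimes> (q' \<otimes> y')))) =
      (\<lambda>u. tmap id (tmap (\<lambda>b. mult A b q') (mult A y')) (W x' p' (kap u)))" for x' p' q' y'
    by (rule tensor_ext4)
      (simp_all add: lin tm_lin clinear_compose[OF W] kap_tensor tm esm_tensor tlift_tensor tmap_tensor
        W_def amult_assoc)
  then have "kap (tmult esm esm (D v) ((x' \<otimes> p') \<otimes> (q' \<otimes> y'))) =
      tmap id (tmap (\<lambda>b. mult A b q') (mult A y')) (W x' p' (ins v))" for x' p' q' y'
    by (metis cop_liftD(3)[OF D v])
  also have "tmap id (tmap (\<lambda>b. mult A b q') (mult A y')) (W x' p' (ins v)) =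
     E v (kap ((x' \<otimes> p') \<otimes> (q' \<otimes> y')))" for x' p' q' y'
  proof -
    have "(\<lambda>v. tmap id (tmap (\<lambda>b. mult A b q') (mult A y')) (W x' p' (ins v))) =
      (\<lambda>v. E v (kap ((x' \<otimes> p') \<otimes> (q' \<otimes> y'))))"
      by (rule tensor_ext)
        (simp_all add: lin clinear_compose[OF W] E1 ins_tensor W_def E_def kap_tensor tlift_tensor tmap_tensor)
    then show ?thesis by (rule fun_cong)
  qed
  finally have "(\<lambda>t. kap (tmult esm esm (D v) t)) = (\<lambda>t. E v (kap t))"
    by (intro tensor_ext4) (simp_all add: lin tm_lin clinear_compose[OF E2])
  then have "kap (tmult esm esm (D v) (D w)) = E v (ins w)"
    by (metis cop_liftD(3)[OF D w])
  also have "E v (ins w) = ins (esm v w)"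
  proof -
    have "(\<lambda>v. E v (ins (x \<otimes> y))) = (\<lambda>v. ins (esm v (x \<otimes> y)))" for x y
      by (rule tensor_ext) (simp_all add: lin E1 ins_tensor E_def tlift_tensor tmap_tensor esm_tensor)
    then have "(\<lambda>w. E v (ins w)) = (\<lambda>w. ins (esm v w))"
      by (intro tensor_ext) (simp_all add: lin clinear_compose[OF E2] fun_eq_iff)
    then show ?thesis by (rule fun_cong)
  qed
  finally show "kap (tmult esm esm (D v) (D w)) = ins (esm v w)" .
qed

text \<open>With \<open>h1 = x \<otimes> p\<close> and \<open>h2 = q \<otimes> y\<close>,
  \<open>kap\<close> of the inner term is \<open>p q \<otimes> y \<otimes> x\<close>. This is the
  permutation \<open>Y\<close> of the legs of \<open>x \<otimes> p q \<otimes> y\<close>, and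
  \<open>p q\<close> becomes 1 at \<open>ins w\<close>.\<close>

lemma S_axiom_ES:
  assumes D: "cop_lift L D" and w: "w \<in> ES2"
  shows "class2 L (tlift (\<lambda>h1 h2. tmap (\<lambda>y. esm y h2) id (D (tflip h1))) (D w)) =
    class2 L ((unity A \<otimes> unity A) \<otimes> tflip w)"
proof (rule class2_eqI)
  note Dl = cop_liftD(1)[OF D] and Dt = cop_liftD(2)[OF D] and Dk = cop_liftD(3)[OF D]
  note [lin] = clinear_compose[OF Dl]
  let ?F = "tlift (\<lambda>h1 h2. tmap (\<lambda>y. esm y h2) id (D (tflip h1)))"
  have F: "clinear ?F" and F_tensor: "?F (c \<otimes> d) = tmap (\<lambda>y. esm y d) id (D (tflip c))" for c d
    by (simp_all add: lin tlift_tensor)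
  show "?F (D w) \<in> tens ES2 ES2"
  proof (rule tens_image_in[OF F tens_subspace _ Dt[OF w]])
    fix c d assume "c \<in> ES2" "d \<in> ES2"
    then show "?F (c \<otimes> d) \<in> tens ES2 ES2"
      unfolding F_tensor by (intro tmap_tens[OF _ clinear_id _ _ Dt[OF flip_ES2]])
        (simp_all add: lin esm_closed)
  qed
  show "(unity A \<otimes> unity A) \<otimes> tflip w \<in> tens ES2 ES2"
    using w by (intro tens_tensor es_unity_closed flip_ES2)
  define Y where "Y = tlift (\<lambda>x t. tlift (\<lambda>r y. r \<otimes> (y \<otimes> (x::'a))) (t :: 'a \<otimes> 'a))"
  have Y: "clinear Y" by (simp add: Y_def lin)
  have "kap (?F (D w)) = Y (kap (D w))"
  proof (rule kap_eq_on[OF clinear_compose[OF kap_linear F] Y _ Dt[OF w]])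
    fix c d assume c: "c \<in> ES2" and d: "d \<in> ES2"
    define W where "W = (\<lambda>(d :: 'a \<otimes> 'a) (t :: 'a \<otimes> 'a \<otimes> 'a). tlift (\<lambda>q y. tmap (\<lambda>a. mult A a q) (tmap (mult A y) id) t) d)"
    have W1: "clinear (\<lambda>d. W d t)" and W2: "clinear (W d)" for d t by (simp_all add: W_def lin)
    have "(\<lambda>t. kap (tmap (\<lambda>y. esm y (q \<otimes> y')) id t)) = (\<lambda>t. W (q \<otimes> y') (kap t))" for q y'
      by (rule tensor_ext4)
        (simp_all add: lin clinear_compose[OF W2] kap_tensor tmap_tensor esm_tensor W_def tlift_tensor amult_assoc)
    then have "(\<lambda>d. kap (tmap (\<lambda>y. esm y d) id t)) = (\<lambda>d. W d (kap t))" for t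
      by (intro tensor_ext) (simp_all add: lin W1 fun_eq_iff)
    then have "kap (?F (c \<otimes> d)) = W d (ins (tflip c))"
      by (simp add: F_tensor Dk flip_ES2 c fun_eq_iff)
    also have "(\<lambda>u. tlift (\<lambda>c d. W d (ins (tflip c))) u) = (\<lambda>u. Y (kap u))"
      by (rule tensor_ext4)
        (simp_all add: lin W1 clinear_compose[OF W2] clinear_compose[OF Y] tlift_tensor kap_tensor
          ins_tensor, simp add: W_def Y_def tlift_tensor lin tmap_tensor)
    then have "W d (ins (tflip c)) = Y (kap (c \<otimes> d))"
      using tlift_tensor[of "\<lambda>c d. W d (ins (tflip c))" c d]
      by (simp add: lin W1 clinear_compose[OF W2] fun_eq_iff)
    finally show "kap (?F (c \<otimes> d)) = Y (kap (c \<otimes> d))" .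
  qed
  also have "(\<lambda>w. Y (ins w)) = (\<lambda>w. kap ((unity A \<otimes> unity A) \<otimes> tflip w))"
    by (rule tensor_ext) (simp_all add: lin clinear_compose[OF Y] ins_tensor Y_def tlift_tensor kap_tensor)
  then have "Y (kap (D w)) = kap ((unity A \<otimes> unity A) \<otimes> tflip w)"
    by (simp add: Dk[OF w] fun_eq_iff)
  finally show "kap (?F (D w)) = kap ((unity A \<otimes> unity A) \<otimes> tflip w)" .
qed

text \<open>On the carrier \<open>S'\<close> is the flip, since the flip is an involution there.
  With the same letters as for \<open>S_axiom_ES\<close>, the inner term becomes
  \<open>y \<otimes> x \<otimes> p q\<close>.\<close>

lemma S_inv_axiom_ES:
  assumes D: "cop_lift L D" and S': "clinear S'" "\<And>x. x \<in> ES2 \<Longrightarrow> S' (tflip x) = x" and w: "w \<in> ES2"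
  shows "class2 L (tlift (\<lambda>h1 h2. tmap id (\<lambda>z. esm z h1) (D (S' h2))) (D w)) =
    class2 L (S' w \<otimes> (unity A \<otimes> unity A))"
proof (rule class2_eqI)
  note Dl = cop_liftD(1)[OF D] and Dt = cop_liftD(2)[OF D] and Dk = cop_liftD(3)[OF D]
  note [lin] = clinear_compose[OF Dl] clinear_compose[OF S'(1)]
  have S'_eq: "S' x = tflip x" if "x \<in> ES2" for x
    using S'(2)[OF flip_ES2[OF that]] by simp
  let ?F = "tlift (\<lambda>h1 h2. tmap id (\<lambda>z. esm z h1) (D (S' h2)))"
  have F: "clinear ?F" and F_tensor: "?F (c \<otimes> d) = tmap id (\<lambda>z. esm z c) (D (S' d))" for c d
    by (simp_all add: lin tlift_tensor)
  show "?F (D w) \<in> tens ES2 ES2"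
  proof (rule tens_image_in[OF F tens_subspace _ Dt[OF w]])
    fix c d assume cd: "c \<in> ES2" "d \<in> ES2"
    then show "?F (c \<otimes> d) \<in> tens ES2 ES2"
      unfolding F_tensor S'_eq[OF cd(2)] by (intro tmap_tens[OF clinear_id _ _ _ Dt[OF flip_ES2]])
        (simp_all add: lin esm_closed)
  qed
  show "S' w \<otimes> (unity A \<otimes> unity A) \<in> tens ES2 ES2"
    using w unfolding S'_eq[OF w] by (intro tens_tensor es_unity_closed flip_ES2)
  define Y where "Y = tlift (\<lambda>x t. tlift (\<lambda>r y. y \<otimes> ((x::'a) \<otimes> r)) (t :: 'a \<otimes> 'a))"
  have Y: "clinear Y" by (simp add: Y_def lin)
  have "kap (?F (D w)) = Y (kap (D w))"
  proof (rule kap_eq_on[OF clinear_compose[OF kap_linear F] Y _ Dt[OF w]])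
    fix c d assume c: "c \<in> ES2" and d: "d \<in> ES2"
    define W where "W = (\<lambda>(c :: 'a \<otimes> 'a) (t :: 'a \<otimes> 'a \<otimes> 'a). tlift (\<lambda>x p. tmap id (tmap (\<lambda>r. mult A r x) (mult A p)) t) c)"
    have W1: "clinear (\<lambda>c. W c t)" and W2: "clinear (W c)" for c t by (simp_all add: W_def lin)
    have "(\<lambda>t. kap (tmap id (\<lambda>z. esm z (x \<otimes> p)) t)) = (\<lambda>t. W (x \<otimes> p) (kap t))" for x p
      by (rule tensor_ext4)
        (simp_all add: lin clinear_compose[OF W2] kap_tensor tmap_tensor esm_tensor W_def tlift_tensor amult_assoc)
    then have "(\<lambda>c. kap (tmap id (\<lambda>z. esm z c) t)) = (\<lambda>c. W c (kap t))" for t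
      by (intro tensor_ext) (simp_all add: lin W1 fun_eq_iff)
    then have "kap (?F (c \<otimes> d)) = W c (ins (tflip d))"
      by (simp add: F_tensor Dk flip_ES2 d S'_eq fun_eq_iff)
    also have "(\<lambda>u. tlift (\<lambda>c d. W c (ins (tflip d))) u) = (\<lambda>u. Y (kap u))"
      by (rule tensor_ext4)
        (simp_all add: lin W1 clinear_compose[OF W2] clinear_compose[OF Y] tlift_tensor kap_tensor
          ins_tensor, simp add: W_def Y_def tlift_tensor lin tmap_tensor)
    then have "W c (ins (tflip d)) = Y (kap (c \<otimes> d))"
      using tlift_tensor[of "\<lambda>c d. W c (ins (tflip d))" c d]
      by (simp add: lin W1 clinear_compose[OF W2] fun_eq_iff)
    finally show "kap (?F (c \<otimes> d)) = Y (kap (c \<otimes> d))" .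
  qed
  also have "(\<lambda>w. Y (ins w)) = (\<lambda>w. kap (tflip w \<otimes> (unity A \<otimes> unity A)))"
    by (rule tensor_ext) (simp_all add: lin clinear_compose[OF Y] ins_tensor Y_def tlift_tensor kap_tensor)
  then have "Y (kap (D w)) = kap (S' w \<otimes> (unity A \<otimes> unity A))"
    by (simp add: Dk[OF w] S'_eq[OF w] fun_eq_iff)
  finally show "kap (?F (D w)) = kap (S' w \<otimes> (unity A \<otimes> unity A))" .
qed

end

context ehresmann_schauenburg
begin

lemma left_bialgebroid_ES: "left_bialgebroid L"
proof -
  have cou_src: "tlift (mult A) (laA b w) = mult A b (tlift (mult A) w)" for b w
  by (rule tensor_eqI[where u = w])
    (simp_all add: lin tlift_amult_tensor tmap_tensor amult_assoc)
  have cou_tgt: "tlift (mult A) (raA w b) = mult A (tlift (mult A) w) b" for b w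
  by (rule tensor_eqI[where u = w])
    (simp_all add: lin tlift_amult_tensor raA_tensor amult_assoc)
  have cou_mult: "tlift (mult A) (esm v (es_src A (tlift (mult A) w))) = tlift (mult A) (esm v w)"
    "tlift (mult A) (esm v (es_tgt A (tlift (mult A) w))) = tlift (mult A) (esm v w)" for v w
  proof -
    have *: "tlift (mult A) (esm (x \<otimes> x') (es_src A (tlift (mult A) w))) = tlift (mult A) (esm (x \<otimes> x') w)"
      "tlift (mult A) (esm (x \<otimes> x') (es_tgt A (tlift (mult A) w))) = tlift (mult A) (esm (x \<otimes> x') w)" for x x'
    proof -
      have "(\<lambda>w. tlift (mult A) (esm (x \<otimes> x') (es_src A (tlift (mult A) w)))) = (\<lambda>w. tlift (mult A) (esm (x \<otimes> x') w))"
        "(\<lambda>w. tlift (mult A) (esm (x \<otimes> x') (es_tgt A (tlift (mult A) w)))) = (\<lambda>w. tlift (mult A) (esm (x \<otimes> x') w))"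
        by (rule tensor_ext; simp add: lin es_src_def es_tgt_def esm_tensor tlift_amult_tensor amult_assoc)+
      then show "tlift (mult A) (esm (x \<otimes> x') (es_src A (tlift (mult A) w))) = tlift (mult A) (esm (x \<otimes> x') w)"
        "tlift (mult A) (esm (x \<otimes> x') (es_tgt A (tlift (mult A) w))) = tlift (mult A) (esm (x \<otimes> x') w)"
        by metis+
    qed
    have "(\<lambda>v. tlift (mult A) (esm v (es_src A (tlift (mult A) w)))) = (\<lambda>v. tlift (mult A) (esm v w))"
      "(\<lambda>v. tlift (mult A) (esm v (es_tgt A (tlift (mult A) w)))) = (\<lambda>v. tlift (mult A) (esm v w))"
      by (rule tensor_ext; simp add: lin *)+
    then show "tlift (mult A) (esm v (es_src A (tlift (mult A) w))) = tlift (mult A) (esm v w)"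
      "tlift (mult A) (esm v (es_tgt A (tlift (mult A) w))) = tlift (mult A) (esm v w)" by metis+
  qed
  have unity: "unity (es_algebra A) = unity A \<otimes> unity A" by (simp add: es_algebra_def)
  have trunc: "mult (alg.truncate A) = mult A" "unity (alg.truncate A) = unity A"
    by (simp_all add: alg.truncate_def)
  have srct: "es_src A b = b \<otimes> unity A" "es_tgt A b = unity A \<otimes> b" for b
    by (simp_all add: es_src_def es_tgt_def)
  have st: "esm (es_src A b) (es_tgt A b') = esm (es_tgt A b') (es_src A b)" for b b'
    by (simp add: srct esm_tensor)
  have srcl: "clinear (es_src A)" "clinear (es_tgt A)"
    unfolding srct[abs_def] by (simp_all add: lin)
  have uu: "(unity A \<otimes> unity A) \<otimes> (unity A \<otimes> unity A) \<in> tens ES2 ES2"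
    "kap ((unity A \<otimes> unity A) \<otimes> (unity A \<otimes> unity A)) = ins (unity A \<otimes> unity A)"
    by (simp_all add: tens_tensor es_unity_closed kap_tensor ins_tensor)
  have copu: "es_cop H A (unity A \<otimes> unity A) = class2 L ((unity A \<otimes> unity A) \<otimes> (unity A \<otimes> unity A))"
    using cop_unique_rep[OF uu] by (simp add: ES_simps)
  have sm: "es_src A (mult A b b') = esm (es_src A b) (es_src A b')"
    "es_tgt A (mult A b b') = esm (es_tgt A b') (es_tgt A b)" for b b'
    by (simp_all add: srct esm_tensor)
  show ?thesis
  proof (rule left_bialgebroid.intro)
    show "algebra_on (base_carrier L) (base L)" by (simp add: ES_simps base_algebra)
    show "algebra_on (total_carrier L) (total L)" by (simp add: ES_simps total_algebra)
    show "clinear (src L)" "clinear (tgt L)" by (simp_all add: ES_simps srcl)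
    show "clinear (cou L)" unfolding ES_simps by (rule cou_lin[OF clinear_ident])
    show "\<exists>D. cop_lift L D" by (rule cop_lift_exists)
    show "cou L (unity (total L)) = unity (base L)"
      by (simp add: ES_simps unity trunc tlift_amult_tensor)
    show "cop L (unity (total L)) = class2 L (unity (total L) \<otimes> unity (total L))"
      by (simp add: ES_simps(4,7) unity copu)
    show "src L (unity (base L)) = unity (total L)" "tgt L (unity (base L)) = unity (total L)"
      by (simp_all add: ES_simps unity trunc srct)
    fix b assume "b \<in> base_carrier L"
    then have b: "b \<in> coinvariants H A" by (simp add: ES_simps)
    show "src L b \<in> total_carrier L" "tgt L b \<in> total_carrier L"
      using b by (simp_all add: ES_simps es_src_closed es_tgt_closed)
    show "src L (mult (base L) b b') = mult (total L) (src L b) (src L b')"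
      "tgt L (mult (base L) b b') = mult (total L) (tgt L b') (tgt L b)"
      "mult (total L) (src L b) (tgt L b') = mult (total L) (tgt L b') (src L b)" for b'
      by (simp_all add: ES_simps trunc sm st)
    fix x assume "x \<in> total_carrier L"
    then have x: "x \<in> ES2" by (simp add: ES_simps)
    show "cou L (mult (total L) (src L b) x) = mult (base L) b (cou L x)"
      by (simp add: ES_simps trunc esm_src cou_src)
    show "cou L (ract L (lact L b x) b') = mult (base L) (mult (base L) b (cou L x)) b'" for b'
      by (simp add: ES_simps trunc esm_src esm_tgt cou_src cou_tgt)
    show "cop L (ract L (lact L b x) b') = class2 L (tmap (lact L b) (\<lambda>y. ract L y b') (D x))"
      if "cop_lift L D" "b' \<in> base_carrier L" for D b'
      using cop_bimodule_ES[OF that(1) x b, of b'] that(2)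
      by (simp add: ES_simps esm_src esm_tgt)
    show "class2 L (tmap (\<lambda>y. mult (total L) y (tgt L b)) id (D x)) =
      class2 L (tmap id (\<lambda>z. mult (total L) z (src L b)) (D x))" if "cop_lift L D" for D
      using cop_takeuchi_ES[OF that x b] by (simp add: ES_simps)
  next
    fix x assume "x \<in> total_carrier L"
    then have x: "x \<in> ES2" by (simp add: ES_simps)
    show "cou L x \<in> base_carrier L" using x by (simp add: ES_simps es_counit_closed)
    show "cou L (mult (total L) x (src L (cou L y))) = cou L (mult (total L) x y)"
      "cou L (mult (total L) x (tgt L (cou L y))) = cou L (mult (total L) x y)" for y
      by (simp_all add: ES_simps cou_mult)
    fix D assume D: "cop_lift L D"
    show "class3 L (tassoc (tmap D id (D x))) = class3 L (tmap id D (D x))"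
      by (rule coassoc_ES[OF D x])
    show "tlift (\<lambda>y z. lact L (cou L y) z) (D x) = x"
      using cou_left_ES[OF D x] by (simp add: ES_simps esm_src)
    show "tlift (\<lambda>y z. ract L y (cou L z)) (D x) = x"
      using cou_right_ES[OF D x] by (simp add: ES_simps esm_tgt)
    show "cop L (mult (total L) x y) = class2 L (tmult (mult (total L)) (mult (total L)) (D x) (D y))"
      if "y \<in> total_carrier L" for y
      using cop_mult_ES[OF D x, of y] that by (simp add: ES_simps)
  qed
qed

theorem hopf_algebroid_ES: "hopf_algebroid L tflip"
proof (rule hopf_algebroid.intro[OF left_bialgebroid_ES], rule hopf_algebroid_axioms.intro)
  have unity: "unity (es_algebra A) = unity A \<otimes> unity A" by (simp add: es_algebra_def)
  show "clinear (tflip :: 'a \<otimes> 'a \<Rightarrow> 'a \<otimes> 'a)" by (rule clinear_tflip[OF clinear_ident])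
  show "bij_betw tflip (total_carrier L) (total_carrier L)"
    by (rule bij_betw_byWitness[where f' = tflip]) (auto simp: ES_simps flip_ES2)
  show "tflip (unity (total L)) = unity (total L)" by (simp add: ES_simps unity)
  show "tflip (tgt L b) = src L b" for b by (simp add: ES_simps es_src_def es_tgt_def)
  show "tflip (mult (total L) x y) = mult (total L) (tflip y) (tflip x)" for x y
  proof -
    have "(\<lambda>x. tflip (esm x (c \<otimes> d))) = (\<lambda>x. esm (tflip (c \<otimes> d)) (tflip x))" for c d
      by (rule tensor_ext) (simp_all add: lin esm_tensor)
    then have "(\<lambda>y. tflip (esm x y)) = (\<lambda>y. esm (tflip y) (tflip x))"
      by (intro tensor_ext) (simp_all add: lin fun_eq_iff)
    then show ?thesis by (simp add: ES_simps fun_eq_iff)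
  qed
  fix D w assume D: "cop_lift L D" and "w \<in> total_carrier L"
  then have w: "w \<in> ES2" by (simp add: ES_simps)
  show "class2 L (tlift (\<lambda>h1 h2. tmap (\<lambda>y. mult (total L) y h2) id (D (tflip h1))) (D w)) =
      class2 L (unity (total L) \<otimes> tflip w)"
    using S_axiom_ES[OF D w] by (simp add: ES_simps unity)
  show "class2 L (tlift (\<lambda>h1 h2. tmap id (\<lambda>z. mult (total L) z h1) (D (S' h2))) (D w)) =
      class2 L (S' w \<otimes> unity (total L))"
    if "clinear S'" "\<And>x. x \<in> total_carrier L \<Longrightarrow> S' (tflip x) = x" for S'
    using S_inv_axiom_ES[OF D that(1) _ w] that(2) by (simp add: ES_simps unity)
qed

end

section \<open>Faithful flatness yields total integrals\<close>

lemma clinear_lookup [lin]: "clinear f \<Longrightarrow> clinear (\<lambda>x. Poly_Mapping.lookup (f x) k)"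
  by (simp add: clinear_iff lookup_add scaleC_poly_mapping.rep_eq)

lemma clinear_from_singles:
  fixes k :: "'b \<Rightarrow> 'v::complex_vector"
  obtains g :: "('b \<Rightarrow>\<^sub>0 complex) \<Rightarrow> 'v" where "clinear g" "\<And>b. g (Poly_Mapping.single b 1) = k b"
proof -
  define g where "g u = (\<Sum>b\<in>Poly_Mapping.keys u. Poly_Mapping.lookup u b *\<^sub>C k b)" for u :: "'b \<Rightarrow>\<^sub>0 complex"
  have g_eq: "g u = (\<Sum>b\<in>K. Poly_Mapping.lookup u b *\<^sub>C k b)"
    if "finite K" "Poly_Mapping.keys u \<subseteq> K" for K u
    unfolding g_def using that by (intro sum.mono_neutral_left) (auto simp: in_keys_iff)
  have "g (u + v) = g u + g v" for u v
  proof -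
    let ?K = "Poly_Mapping.keys u \<union> Poly_Mapping.keys v"
    have "finite ?K" "Poly_Mapping.keys (u + v) \<subseteq> ?K"
      by (simp_all add: Poly_Mapping.keys_add)
    then show ?thesis
      by (simp add: g_eq[of ?K] lookup_add scaleC_add_left sum.distrib)
  qed
  moreover have "g (c *\<^sub>C u) = c *\<^sub>C g u" for c u
  proof -
    have "Poly_Mapping.keys (c *\<^sub>C u) \<subseteq> Poly_Mapping.keys u"
      by (auto simp: in_keys_iff scaleC_poly_mapping.rep_eq)
    then show ?thesis
      by (simp add: g_eq[of "Poly_Mapping.keys u"] scaleC_poly_mapping.rep_eq scaleC_complex_def
          scaleC_scaleC cvec.scale_sum_right)
  qed
  ultimately have "clinear g" by (simp add: clinear_iff)
  moreover have "g (Poly_Mapping.single b 1) = k b" for b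
    by (simp add: g_def scaleC_one)
  ultimately show ?thesis using that by blast
qed

text \<open>The modules in the definition of faithful flatness live in free spaces on lists, so a module
  enters it only through an embedding; any space spanned by a family indexed by lists has one.\<close>

lemma embedding_into_free:
  fixes k :: "'b \<Rightarrow> 'v::complex_vector"
  assumes "cspan (range k) = UNIV"
  obtains j :: "'v \<Rightarrow> ('b \<Rightarrow>\<^sub>0 complex)" and g where "clinear j" "clinear g" "\<And>v. g (j v) = v"
proof -
  obtain g :: "('b \<Rightarrow>\<^sub>0 complex) \<Rightarrow> 'v" where g: "clinear g" "\<And>b. g (Poly_Mapping.single b 1) = k b"
    using clinear_from_singles by blast
  have "csubspace (range g)"
    by (rule cpair.linear_subspace_image[OF g(1) cvec.subspace_UNIV])
  then have "cspan (range k) \<subseteq> range g"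
    using g(2) by (intro cvec.span_minimal) (auto simp: image_iff intro: sym)
  then have surj: "range g = UNIV" using assms by auto
  obtain j where "clinear j" "\<And>v. g (j (g v)) = g v"
    using clinear_right_inverse[OF g(1) cvec.subspace_UNIV] by (metis UNIV_I)
  then show ?thesis using that[of j g] g(1) surj by (metis surjD)
qed

lemma left_module_transport:
  assumes M: "left_module A B M act" and j: "clinear j" and g: "clinear g" and gj: "\<And>v. g (j v) = v"
  shows "left_module A B (j ` M) (\<lambda>b x. j (act b (g x)))"
proof -
  have "csubspace (j ` M)"
    using M by (intro cpair.linear_subspace_image[OF j]) (simp add: left_module_def)
  then show ?thesis
    using M by (auto simp: left_module_def gj clinear_add[OF j] clinear_add[OF g]
        clinear_scale[OF j] clinear_scale[OF g])
qed

text \<open>The inclusion of the kernel of \<open>h\<close> followed by \<open>h\<close> is exact.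
  It is carried into the free spaces along \<open>j2\<close> and \<open>j3\<close>, tensored with
  \<open>A\<close> by flatness, and the result is carried back along \<open>g2\<close>. The families
  \<open>k2\<close> and \<open>k3\<close> bound the size of the modules.\<close>

lemma flat_kernel:
  fixes act2 :: "'a::complex_vector \<Rightarrow> 'v \<Rightarrow> 'v::complex_vector"
    and act3 :: "'a \<Rightarrow> 'w \<Rightarrow> 'w::complex_vector"
    and k2 :: "'a list \<Rightarrow> 'v" and k3 :: "'a list \<Rightarrow> 'w"
  assumes ff: "faithfully_flat A B"
    and M2: "left_module A B UNIV act2" and M3: "left_module A B UNIV act3"
    and span2: "cspan (range k2) = UNIV" and span3: "cspan (range k3) = UNIV"
    and h: "clinear h" "\<And>b x. b \<in> B \<Longrightarrow> h (act2 b x) = act3 b (h x)"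
    and w: "tmap id h w \<in> balance B (mult A) act3 UNIV UNIV"
  shows "\<exists>w'\<in>tens UNIV {v. h v = 0}. w - w' \<in> balance B (mult A) act2 UNIV UNIV"
proof -
  obtain j2 :: "'v \<Rightarrow> ('a list \<Rightarrow>\<^sub>0 complex)" and g2
    where j2: "clinear j2" and g2: "clinear g2" and gj2: "\<And>v. g2 (j2 v) = v"
    using embedding_into_free[OF span2] by blast
  obtain j3 :: "'w \<Rightarrow> ('a list \<Rightarrow>\<^sub>0 complex)" and g3
    where j3: "clinear j3" and g3: "clinear g3" and gj3: "\<And>v. g3 (j3 v) = v"
    using embedding_into_free[OF span3] by blast
  let ?K = "{v. h v = 0}"
  let ?a2 = "\<lambda>b x. j2 (act2 b (g2 x))" and ?a3 = "\<lambda>b x. j3 (act3 b (g3 x))"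
  let ?g = "\<lambda>x. j3 (h (g2 x))"
  have act3_0: "act3 b 0 = 0" if "b \<in> B" for b
    using M3 that unfolding left_module_def by (metis UNIV_I cvec.scale_zero_left)
  have K: "left_module A B ?K act2"
    using M2 h act3_0 by (auto simp: left_module_def cvec.subspace_def clinear_0 clinear_add clinear_scale)
  note M1' = left_module_transport[OF K j2 g2 gj2]
    and M2' = left_module_transport[OF M2 j2 g2 gj2]
    and M3' = left_module_transport[OF M3 j3 g3 gj3]
  have g: "clinear ?g"
    by (rule clinear_compose[OF j3 clinear_compose[OF h(1) g2]])
  have j3_0: "j3 x = 0 \<longleftrightarrow> x = 0" for x
    using clinear_0[OF j3] clinear_0[OF g3] gj3 by metis
  have "id ` (j2 ` ?K) = {y \<in> range j2. ?g y = 0}"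
    using gj2 by (auto simp: j3_0)
  moreover have "left_module_hom B (j2 ` ?K) ?a2 (range j2) ?a2 id"
    by (auto simp: left_module_hom_def lin)
  moreover have "left_module_hom B (range j2) ?a2 (range j3) ?a3 ?g"
    using g h(2) by (auto simp: left_module_hom_def gj2 gj3)
  ultimately have exact: "(let U2 = balance B (mult A) ?a2 UNIV (range j2); U3 = balance B (mult A) ?a3 UNIV (range j3)
          in {coset U2 (tmap id id w) | w. w \<in> tens UNIV (j2 ` ?K)} =
             {coset U2 w | w. w \<in> tens UNIV (range j2) \<and> coset U3 (tmap id ?g w) = coset U3 0})"
    using ff[unfolded faithfully_flat_def, rule_format, of "j2 ` ?K" ?a2 "range j2" ?a2 "range j3" ?a3 id ?g]
      M1' M2' M3' by blast
  let ?U2 = "balance B (mult A) ?a2 UNIV (range j2)" and ?U3 = "balance B (mult A) ?a3 UNIV (range j3)"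
  let ?w = "tmap id j2 w"
  have "tmap id j3 (tmap id h w) \<in> ?U3"
    using w unfolding balance_def[of _ _ act3]
    by (rule clinear_image_span_subset[of "tmap id j3", rotated 3])
      (auto simp: lin j3 balance_subspace tmap_diff tmap_tensor clinear_id
        intro!: balance_base[of _ _ _ _ "j3 _" _ "mult A" "\<lambda>b x. j3 (act3 b (g3 x))", simplified gj3])
  then have "tmap id ?g ?w \<in> ?U3"
    by (simp add: tmap_tmap clinear_id j2 j3 h g gj2)
  then have "coset ?U3 (tmap id ?g ?w) = coset ?U3 0"
    by (simp add: coset_eq_iff balance_subspace)
  moreover have "?w \<in> tens UNIV (range j2)"
    by (rule tmap_tens[of id j2 UNIV UNIV UNIV]) (simp_all add: lin j2)
  ultimately obtain w1 where w1: "w1 \<in> tens UNIV (j2 ` ?K)" "coset ?U2 ?w = coset ?U2 (tmap id id w1)"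
    using exact unfolding Let_def by blast
  have "tmap id id w1 = w1" by (simp add: tmap_def)
  then have "?w - w1 \<in> ?U2" using w1(2) by (simp add: coset_eq_iff balance_subspace)
  then have "tmap id g2 (?w - w1) \<in> balance B (mult A) act2 UNIV UNIV"
    unfolding balance_def[of _ _ ?a2]
    by (rule clinear_image_span_subset[of "tmap id g2", rotated 3])
      (auto simp: lin g2 balance_subspace tmap_diff tmap_tensor clinear_id gj2 intro!: balance_base)
  moreover have "tmap id g2 ?w = w"
    by (simp add: tmap_tmap clinear_id j2 g2 gj2) (simp add: tmap_def)
  moreover have "tmap id g2 w1 \<in> tens UNIV ?K"
    using w1(1) by (rule tmap_tens[of id g2, rotated 4]) (auto simp: lin g2 gj2)
  ultimately show ?thesis
    using tmap_diff[OF clinear_id g2, of ?w w1] by auto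
qed

text \<open>The sequence from \<open>I\<close> to \<open>B\<close> to 0 becomes exact after
  tensoring with \<open>A\<close>: every \<open>a \<otimes> b\<close> is congruent to
  \<open>a b \<otimes> 1\<close>, and 1 lies in \<open>A I\<close>. Faithfulness gives exactness
  before tensoring, that is \<open>I = B\<close>.\<close>

lemma faithful_ideal:
  fixes A :: "('a::complex_vector, 'z) alg_scheme"
  assumes ff: "faithfully_flat A B" and A: "algebra_on UNIV A" and B: "algebra_on B A"
    and I: "csubspace I" "I \<subseteq> B" "\<And>b x. b \<in> B \<Longrightarrow> x \<in> I \<Longrightarrow> mult A b x \<in> I"
    and 1: "unity A \<in> cspan {mult A a x | a x. x \<in> I}"
  shows "unity A \<in> I"
proof -
  have "range (hd :: 'a list \<Rightarrow> 'a) = UNIV" by (rule surjI[of _ "\<lambda>x. [x]"]) simp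
  then have "cspan (range (hd :: 'a list \<Rightarrow> 'a)) = UNIV" by simp
  then obtain j :: "'a \<Rightarrow> ('a list \<Rightarrow>\<^sub>0 complex)" and g
    where j: "clinear j" and g: "clinear g" and gj: "\<And>v. g (j v) = v"
    using embedding_into_free by blast
  have bil: "cbilinear (mult A)" and unit: "mult A x (unity A) = x"
    and assoc: "mult A (mult A x y) z = mult A x (mult A y z)" for x y z
    using A by (auto simp: algebra_on_def)
  have m1: "clinear (\<lambda>x. mult A x y)" and m2: "clinear (mult A x)" for x y
    using bil by (auto simp: cbilinear_def)
  let ?a = "\<lambda>b x. j (mult A b (g x))"
  have mod: "left_module A B M (mult A)" if "csubspace M" "\<And>b x. b \<in> B \<Longrightarrow> x \<in> M \<Longrightarrow> mult A b x \<in> M" for M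
    using that A by (auto simp: left_module_def algebra_on_def clinear_add[OF m1] clinear_add[OF m2]
        clinear_scale[OF m1] clinear_scale[OF m2])
  have MI: "left_module A B (j ` I) ?a"
    by (intro left_module_transport mod I j g gj)
  have MB: "left_module A B (j ` B) ?a"
    using B by (intro left_module_transport mod j g gj) (auto simp: algebra_on_def)
  have M0: "left_module A B {0} (\<lambda>_ _. 0 :: 'a list \<Rightarrow>\<^sub>0 complex)"
    by (auto simp: left_module_def cvec.subspace_single_0)
  have h1: "left_module_hom B (j ` I) ?a (j ` B) ?a id"
    using I(2) by (auto simp: left_module_hom_def lin)
  have h2: "left_module_hom B (j ` B) ?a {0} (\<lambda>_ _. 0) (\<lambda>_. 0)"
    by (auto simp: left_module_hom_def lin)
  let ?U = "balance B (mult A) ?a UNIV (j ` B)"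
  \<comment> \<open>\<open>S\<close> collects the tensors that are congruent to an element of
    \<open>A \<otimes> I\<close>; the goal is that it contains all of
    \<open>A \<otimes> B\<close>.\<close>
  define S where "S = {x + y | x y. x \<in> tens UNIV (j ` I) \<and> y \<in> ?U}"
  have S: "csubspace S"
    unfolding S_def by (intro cvec.subspace_sums tens_subspace balance_subspace)
  have S_I: "y \<in> S" if "x \<in> tens UNIV (j ` I)" "y - x \<in> ?U" for x y
    unfolding S_def using that by (intro CollectI exI[of _ x] exI[of _ "y - x"]) simp
  have u: "unity A \<in> B" using B by (simp add: algebra_on_def)
  have base: "a \<otimes> j (unity A) \<in> S" for a
  proof -
    have "mult A a y \<otimes> j (unity A) \<in> S" if "y \<in> cspan {mult A a x | a x. x \<in> I}" for y
    proof (rule clinear_image_span_subset[OF _ S _ that, of "\<lambda>y. mult A a y \<otimes> j (unity A)"])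
      show "clinear (\<lambda>y. mult A a y \<otimes> j (unity A))" by (simp add: lin m2)
      fix y assume "y \<in> {mult A a x | a x. x \<in> I}"
      then obtain c x where y: "y = mult A c x" "x \<in> I" by blast
      have "mult A (mult A a c) x \<otimes> j (unity A) - mult A a c \<otimes> j (mult A x (g (j (unity A)))) \<in> ?U"
        using y(2) I(2) u by (intro balance_base) auto
      then have "mult A a y \<otimes> j (unity A) - mult A a c \<otimes> j x \<in> ?U"
        by (simp add: y gj unit assoc)
      moreover have "mult A a c \<otimes> j x \<in> tens UNIV (j ` I)"
        using y(2) by (simp add: tens_tensor)
      ultimately show "mult A a y \<otimes> j (unity A) \<in> S"
        using S_I by blast
    qed
    from this[OF 1] show ?thesis by (simp add: unit)
  qed
  have "tens UNIV (j ` B) \<subseteq> S"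
    unfolding tens_def[of UNIV "j ` B"]
  proof (rule cvec.span_minimal[OF _ S], rule subsetI)
    fix t :: "'a \<otimes> ('a list \<Rightarrow>\<^sub>0 complex)"
    assume "t \<in> {x \<otimes> y |x y. x \<in> UNIV \<and> y \<in> j ` B}"
    then obtain a b where t: "t = a \<otimes> j b" "b \<in> B" by blast
    have "mult A a b \<otimes> j (unity A) - a \<otimes> j (mult A b (g (j (unity A)))) \<in> ?U"
      using t(2) u by (intro balance_base) auto
    then have "- (mult A a b \<otimes> j (unity A) - t) \<in> ?U"
      by (intro cvec.subspace_neg balance_subspace) (simp add: t gj unit)
    then have "t - mult A a b \<otimes> j (unity A) \<in> S"
      using S_I[OF cvec.subspace_0[OF tens_subspace]] by simp
    from cvec.subspace_add[OF S this base[of "mult A a b"]] show "t \<in> S" by simp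
  qed
  then have ex: "\<exists>w'. w' \<in> tens UNIV (j ` I) \<and> coset ?U w = coset ?U w'" if "w \<in> tens UNIV (j ` B)" for w
    using that unfolding S_def by (fastforce simp: coset_eq_iff balance_subspace)
  have "tens (UNIV :: 'a set) (j ` I) \<subseteq> tens UNIV (j ` B)"
    using I(2) by (intro tens_mono) auto
  then have "{coset ?U (tmap id id w) | w. w \<in> tens UNIV (j ` I)} =
      {coset ?U w | w. w \<in> tens UNIV (j ` B) \<and>
        coset (balance B (mult A) (\<lambda>_ _. 0) UNIV {0}) (tmap id (\<lambda>_. 0 :: 'a list \<Rightarrow>\<^sub>0 complex) w) =
        coset (balance B (mult A) (\<lambda>_ _. 0) UNIV {0}) 0}"
  proof -
    assume sub: "tens (UNIV :: 'a set) (j ` I) \<subseteq> tens UNIV (j ` B)"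
    have "tmap id id w = w" for w :: "'a \<otimes> ('a list \<Rightarrow>\<^sub>0 complex)" by (simp add: tmap_def)
    moreover have "tmap id (\<lambda>_. 0 :: 'a list \<Rightarrow>\<^sub>0 complex) w = 0" for w :: "'a \<otimes> ('a list \<Rightarrow>\<^sub>0 complex)"
    proof -
      have "tmap id (\<lambda>_. 0 :: 'a list \<Rightarrow>\<^sub>0 complex) = (\<lambda>w :: 'a \<otimes> ('a list \<Rightarrow>\<^sub>0 complex). 0)"
        by (rule tensor_ext)
          (simp_all add: lin tmap_tensor tensor_zero)
      then show ?thesis by (rule fun_cong)
    qed
    moreover have "coset ?U ` tens UNIV (j ` I) = coset ?U ` tens UNIV (j ` B)"
    proof (rule equalityI[OF image_mono[OF sub]], rule image_subsetI)
      fix w :: "'a \<otimes> ('a list \<Rightarrow>\<^sub>0 complex)" assume "w \<in> tens UNIV (j ` B)"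
      then obtain w' where "w' \<in> tens UNIV (j ` I)" and w': "coset ?U w = coset ?U w'" using ex by blast
      then show "coset ?U w \<in> coset ?U ` tens UNIV (j ` I)"
        unfolding w' by (intro imageI)
    qed
    ultimately show ?thesis by (simp only: simp_thms setcompr_eq_image Collect_mem_eq)
  qed
  then have "id ` (j ` I) = {y \<in> j ` B. (\<lambda>_. 0 :: 'a list \<Rightarrow>\<^sub>0 complex) y = 0}"
    using ff[unfolded faithfully_flat_def, rule_format, of "j ` I" ?a "j ` B" ?a "{0}" "\<lambda>_ _. 0" id "\<lambda>_. 0"]
      MI MB M0 h1 h2 unfolding Let_def by blast
  then have "j (unity A) \<in> j ` I" using u by auto
  then show ?thesis using gj by (metis imageE)
qed

lemma span_singles: "cspan (range (\<lambda>k. Poly_Mapping.single k (1::complex))) = UNIV"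
proof -
  have "u \<in> cspan (range (\<lambda>k. Poly_Mapping.single k (1::complex)))" for u :: "'k \<Rightarrow>\<^sub>0 complex"
  proof -
    have "u = (\<Sum>k\<in>Poly_Mapping.keys u.
        Poly_Mapping.lookup u k *\<^sub>C Poly_Mapping.single k (1::complex))"
      by (rule poly_mapping_eqI)
         (simp add: lookup_sum scaleC_poly_mapping.rep_eq scaleC_complex_def lookup_single
            when_def in_keys_iff if_distrib cong: if_cong)
    also have "\<dots> \<in> cspan (range (\<lambda>k. Poly_Mapping.single k (1::complex)))"
      by (intro cvec.span_sum cvec.span_scale cvec.span_base) blast
    finally show ?thesis .
  qed
  then show ?thesis by blast
qed

lemma span_tensor_UNIV:
  assumes S: "cspan S = UNIV" and S': "cspan S' = UNIV"
  shows "cspan {x \<otimes> y | x y. x \<in> S \<and> y \<in> S'} = UNIV"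
proof -
  let ?V = "cspan {x \<otimes> y | x y. x \<in> S \<and> y \<in> S'}"
  have 1: "x \<otimes> y \<in> ?V" if x: "x \<in> S" for x y
    by (rule clinear_image_span_subset[of "\<lambda>y. x \<otimes> y" ?V S'])
      (use x S' in \<open>auto simp: lin intro: cvec.span_base\<close>)
  have "x \<otimes> y \<in> ?V" for x y
    by (rule clinear_image_span_subset[of "\<lambda>x. x \<otimes> y" ?V S]) (use S 1 in \<open>auto simp: lin\<close>)
  then have "cspan {x \<otimes> y | x y. True} \<subseteq> ?V"
    by (intro cvec.span_minimal) auto
  then show ?thesis using span_elem_tensor by blast
qed

lemma tmap_action:
  assumes bil: "cbilinear act" and assoc: "\<And>b b' x. act (mult A b b') x = act b (act b' x)"
    and unit: "\<And>x. act (unity A) x = x"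
  shows "cbilinear (\<lambda>b. tmap (act b) id)"
    and "tmap (act (mult A b b')) id u = tmap (act b) id (tmap (act b') id u)"
    and "tmap (act (unity A)) id u = u"
proof -
  have l: "clinear (\<lambda>b. act b x)" "clinear (act b)" for b x
    using bil by (auto simp: cbilinear_def)
  show "cbilinear (\<lambda>b. tmap (act b) id)" by (simp add: lin l)
  have "act (mult A b b') = (\<lambda>x. act b (act b' x))" by (simp add: assoc fun_eq_iff)
  then show "tmap (act (mult A b b')) id u = tmap (act b) id (tmap (act b') id u)"
    by (subst tmap_tmap) (simp_all add: lin l id_def)
  show "tmap (act (unity A)) id u = u"
    by (simp add: unit tmap_def)
qed

lemma left_module_of_action:
  assumes bil: "cbilinear act" and assoc: "\<And>b b' x. act (mult A b b') x = act b (act b' x)"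
    and unit: "\<And>x. act (unity A) x = x"
  shows "left_module A B UNIV act"
proof -
  have l: "clinear (\<lambda>b. act b x)" "clinear (act b)" for b x
    using bil by (auto simp: cbilinear_def)
  show ?thesis
    by (simp add: left_module_def assoc unit clinear_add[OF l(1)] clinear_add[OF l(2)]
      clinear_scale[OF l(1)] clinear_scale[OF l(2)])
qed

context galois_extension
begin

abbreviation laH :: "'a \<Rightarrow> 'a \<otimes> 'h \<Rightarrow> 'a \<otimes> 'h" where
  "laH b \<equiv> tmap (mult A b) id"

text \<open>The translation map is colinear in its second leg. Under the canonical map on the first
  two legs both terms become the sum of the tensors \<open>1 \<otimes> h1 \<otimes> h2\<close> over
  the coproduct of \<open>d\<close>, and the canonical map is injective on classes.\<close>

lemma translation_colinear:
  "tmap id (coact A) (T d) - tlift (\<lambda>x y. tmap id (\<lambda>q. q \<otimes> y) (T x)) (comul H d)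
    \<in> balance (coinvariants H A) (mult A) laH UNIV UNIV"
proof -
  define Z where "Z = tlift (\<lambda>p q. tlift (\<lambda>y k. (p \<otimes> y) \<otimes> k) (coact A q)) (T d) - tlift (\<lambda>x y. T x \<otimes> y) (comul H d)"
  have "tmap (can_lift A) id (tlift (\<lambda>p q. tlift (\<lambda>y k. (p \<otimes> y) \<otimes> k) (coact A q)) (T d)) =
    tlift (\<lambda>p q. tlift (\<lambda>y k. tlift (\<lambda>x h. (mult A p x \<otimes> h) \<otimes> k) (coact A y)) (coact A q)) (T d)"
    by (simp add: lin push tmap_tensor can_lift_tensor)
  also have "\<dots> = tlift (\<lambda>p q. tlift (\<lambda>x h. tlift (\<lambda>h1 h2. (mult A p x \<otimes> h1) \<otimes> h2) (comul H h)) (coact A q)) (T d)"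
    by (subst coact_coassoc_sw) (simp_all add: lin)
  also have "\<dots> = tlift (\<lambda>h1 h2. (unity A \<otimes> h1) \<otimes> h2) (comul H d)"
    by (rule T_can_sw) (simp add: lin)
  also have "\<dots> = tmap (can_lift A) id (tlift (\<lambda>x y. T x \<otimes> y) (comul H d))"
    by (simp add: lin push tmap_tensor can_lift_T)
  finally have "tmap (can_lift A) id Z = 0"
    by (simp add: Z_def tmap_diff lin)
  then have "Z \<in> tens bal UNIV"
    using tens_kernel_left[OF can_lift_lin[OF clinear_ident], of Z] by (simp add: can_lift_eq_0_iff)
  then have "tassoc Z \<in> balance (coinvariants H A) (mult A) laH UNIV UNIV"
    unfolding tens_def
  proof (rule clinear_image_span_subset[OF clinear_tassoc[OF clinear_ident] balance_subspace, rotated])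
    fix t :: "('a \<otimes> 'a) \<otimes> 'h" assume "t \<in> {x \<otimes> y |x y. x \<in> bal \<and> y \<in> UNIV}"
    then obtain u k where t: "t = u \<otimes> k" "u \<in> bal" by blast
    have "tassoc (u \<otimes> k) \<in> balance (coinvariants H A) (mult A) laH UNIV UNIV"
      using t(2) unfolding balance_def[of _ _ "mult A"]
    proof (rule clinear_image_span_subset[of "\<lambda>u. tassoc (u \<otimes> k)", rotated 3])
      fix s assume "s \<in> {mult A x b \<otimes> y - x \<otimes> mult A b y |x b y. x \<in> UNIV \<and> b \<in> coinvariants H A \<and> y \<in> UNIV}"
      then obtain x b y where s: "s = mult A x b \<otimes> y - x \<otimes> mult A b y" "b \<in> coinvariants H A" by blast
      have "tassoc (s \<otimes> k) = mult A x b \<otimes> (y \<otimes> k) - x \<otimes> laH b (y \<otimes> k)"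
        by (simp add: s(1) clinear_diff[OF clinear_tassoc[OF clinear_tensor_left[OF clinear_ident]]]
          tmap_tensor lin)
      then show "tassoc (s \<otimes> k) \<in> balance (coinvariants H A) (mult A) laH UNIV UNIV"
        using s(2) by (simp add: balance_base[where la = laH])
    qed (simp_all add: lin balance_subspace)
    then show "tassoc t \<in> balance (coinvariants H A) (mult A) laH UNIV UNIV" by (simp add: t(1))
  qed
  moreover have "tassoc Z = tmap id (coact A) (T d) - tlift (\<lambda>x y. tmap id (\<lambda>q. q \<otimes> y) (T x)) (comul H d)"
  proof -
    have 1: "tassoc (tlift (\<lambda>p q. tlift (\<lambda>y k. (p \<otimes> y) \<otimes> k) (coact A q)) t) = tmap id (coact A) t" for t      by (rule tensor_eqI[where u = t]) (simp_all add: lin coact_linear tlift_tensor tmap_tensor push,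
        rule tlift_eqI, simp_all add: lin)
    have "(\<lambda>t. tassoc (t \<otimes> y)) = (\<lambda>t. tmap id (\<lambda>q. q \<otimes> y) t)" for y :: 'h
      by (rule tensor_ext) (simp_all add: lin tmap_tensor)
    then have 2: "tassoc (t \<otimes> y) = tmap id (\<lambda>q. q \<otimes> y) t" for t and y :: 'h
      by (rule fun_cong)
    have 3: "cbilinear (\<lambda>x y. T x \<otimes> y)" by (simp add: lin)
    show ?thesis
      unfolding Z_def clinear_diff[OF clinear_tassoc[OF clinear_ident]] 1 tassoc_tlift[OF 3] 2 ..
  qed
  ultimately show ?thesis by simp
qed

text \<open>The module \<open>A \<otimes> (nat \<Rightarrow>\<^sub>0 complex)\<close> below represents the linear maps from the span of the
  finite family \<open>z\<close> to \<open>A\<close> (by \<open>ext\<close>), and \<open>g\<close> measures the failure of colinearity.  The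
  translation map is the element \<open>w\<close>; it is colinear in its second leg, hence lies in the kernel
  of \<open>id \<otimes> g\<close>, which by flatness comes from the kernel of \<open>g\<close>.\<close>

lemma integral_exists:
  assumes ff: "faithfully_flat A (coinvariants H A)" and F: "finite F"
  shows "\<exists>\<phi>. clinear \<phi> \<and> \<phi> (unity H) = unity A \<and> (\<forall>h\<in>F. colinear_at \<phi> h)"
proof -
  let ?B = "coinvariants H A"
  \<comment> \<open>The unit is included because colinearity at 1 makes the value at 1
    coinvariant.\<close>
  define F' where "F' = insert (unity H) F"
  \<comment> \<open>Colinearity at \<open>d\<close> also involves values at the first legs of its
    coproduct, so these go into \<open>Z\<close>.\<close>
  have "\<exists>X. finite X \<and> comul H d \<in> tens X UNIV" for d
    using tens_finite[of "comul H d" UNIV UNIV] tens_mono[OF subset_refl subset_UNIV] by fastforce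
  then obtain X where X: "\<And>d. finite (X d)" "\<And>d. comul H d \<in> tens (X d) UNIV" by metis
  define Z where "Z = F' \<union> (\<Union>d\<in>F'. X d)"
  have "finite F'" "finite Z" using F X(1) by (auto simp: F'_def Z_def)
  then obtain d z and m n :: nat where d: "F' = d ` {i. i < m}" and z: "Z = z ` {i. i < n}"
    using finite_imp_nat_seg_image_inj_on by metis
  \<comment> \<open>The family \<open>z\<close> may be linearly dependent; the coordinates
    \<open>xi\<close> come from a right inverse of \<open>q\<close>, and \<open>combine\<close>
    takes the place of an expansion in a basis.\<close>
  define q where "q s = (\<Sum>i<n. Poly_Mapping.lookup s i *\<^sub>C z i)" for s :: "nat \<Rightarrow>\<^sub>0 complex"
  have q: "clinear q" unfolding q_def by (simp add: lin)
  obtain r where r: "clinear r" "\<And>s. q (r (q s)) = q s"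
    using clinear_right_inverse[OF q cvec.subspace_UNIV] by (metis UNIV_I)
  have qr: "q (r x) = x" if x: "x \<in> Z" for x
  proof -
    obtain i where i: "i < n" "x = z i" using x unfolding z by auto
    have "q (Poly_Mapping.single i 1) = x"
      using i by (simp add: q_def lookup_single when_def scaleC_one if_distrib[of "\<lambda>c. c *\<^sub>C _"] cong: if_cong)
    then show ?thesis using r(2) by metis
  qed
  define xi where "xi i x = Poly_Mapping.lookup (r x) i" for i x
  have xi_lin: "clinear f \<Longrightarrow> clinear (\<lambda>x. xi i (f x))" for i and f :: "'c::complex_vector \<Rightarrow> 'h"
    by (simp add: xi_def lin clinear_compose[OF r(1)])
  have combine: "(\<Sum>i<n. xi i x *\<^sub>C f (z i)) = f x" if x: "x \<in> Z" and f: "clinear f" for f :: "'h \<Rightarrow> 'c::complex_vector" and x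
  proof -
    have "f x = f (q (r x))" using qr[OF x] by simp
    also have "\<dots> = (\<Sum>i<n. xi i x *\<^sub>C f (z i))"
      by (simp add: q_def clinear_sum[OF f] clinear_scale[OF f] xi_def)
    finally show ?thesis by simp
  qed
  \<comment> \<open>\<open>a \<otimes> s\<close> is read as the map that pairs \<open>s\<close> with
    the coordinates of \<open>h\<close> and multiplies \<open>a\<close> by the result; it is linear
    on all of \<open>H\<close>.\<close>
  define ext where "ext v h = tlift (\<lambda>a s. (\<Sum>i<n. Poly_Mapping.lookup s i * xi i h) *\<^sub>C a) v"
    for v :: "'a \<otimes> (nat \<Rightarrow>\<^sub>0 complex)" and h
  have ext_lin: "clinear f \<Longrightarrow> clinear (\<lambda>x. ext (f x) h)" for f :: "'c::complex_vector \<Rightarrow> 'a \<otimes> (nat \<Rightarrow>\<^sub>0 complex)" and h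
    by (simp add: ext_def lin)
  have ext_lin2: "clinear g \<Longrightarrow> clinear (\<lambda>x. ext v (g x))" for g :: "'c::complex_vector \<Rightarrow> 'h" and v
    unfolding ext_def by (rule lin)+ (simp_all add: lin xi_lin)
  have ext_tensor: "ext (a \<otimes> s) h = (\<Sum>i<n. Poly_Mapping.lookup s i * xi i h) *\<^sub>C a" for a s h
    by (simp add: ext_def tlift_tensor lin)
  have ext_single: "ext (a \<otimes> Poly_Mapping.single i 1) h = xi i h *\<^sub>C a" if "i < n" for a i h
    using that by (simp add: ext_tensor lookup_single when_def if_distrib[of "\<lambda>c. c * _"] cong: if_cong)
  let ?a2 = "\<lambda>b. tmap (mult A b) (id :: (nat \<Rightarrow>\<^sub>0 complex) \<Rightarrow> _)"
  let ?a3 = "\<lambda>b. tmap (laH b) (id :: (nat \<Rightarrow>\<^sub>0 complex) \<Rightarrow> _)"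
  have ext_act: "ext (?a2 b v) h = mult A b (ext v h)" for b v h
  by (rule tensor_eqI[where u = v])
    (simp_all add: lin ext_lin ext_tensor tmap_tensor clinear_scale[OF amult_lin(2)[OF clinear_ident]])
  define e where "e j = (Poly_Mapping.single j 1 :: nat \<Rightarrow>\<^sub>0 complex)" for j
  define dev where "dev v h = coact A (ext v h) - tlift (\<lambda>x y. ext v x \<otimes> y) (comul H h)" for v h
  have dev_lin: "clinear f \<Longrightarrow> clinear (\<lambda>x. dev (f x) h)" for f :: "'c::complex_vector \<Rightarrow> _" and h
    by (simp add: dev_def lin ext_lin ext_lin2)
  \<comment> \<open>The coordinate of \<open>g v\<close> at \<open>j\<close> is the deviation at
    \<open>d j\<close>, so the kernel of \<open>g\<close> consists of maps that are colinear at
    every element of \<open>F'\<close>.\<close>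
  define g where "g v = (\<Sum>j<m. dev v (d j) \<otimes> e j)" for v
  have g_lin: "clinear f \<Longrightarrow> clinear (\<lambda>x. g (f x))" for f :: "'c::complex_vector \<Rightarrow> _"
    by (simp add: g_def lin dev_lin)
  have dev_act: "dev (?a2 b v) h = laH b (dev v h)" if "b \<in> ?B" for b v h
  proof -
    have "laH b (coact A x) = coact A (mult A b x)" for x
      using that by (simp add: coact_mult_coinvariant tmap_def)
    then show ?thesis
      by (simp add: dev_def ext_act tmap_diff lin tmap_tlift ext_lin2 tmap_tensor)
  qed
  have g_act: "g (?a2 b v) = ?a3 b (g v)" if "b \<in> ?B" for b v
  proof -
    have l: "clinear (?a3 b)" by (simp add: lin)
    show ?thesis
      by (simp add: g_def dev_act[OF that] clinear_sum[OF l] tmap_tensor lin)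
  qed
  have comp_zero: "dev v h = 0" if v: "g v = 0" and h: "h \<in> F'" for v h
  proof -
    obtain j where j: "j < m" "h = d j" using h d by auto
    have l: "clinear (tlift (\<lambda>t s. Poly_Mapping.lookup s j *\<^sub>C (t :: 'a \<otimes> 'h)))" by (simp add: lin)
    have "tlift (\<lambda>t s. Poly_Mapping.lookup s j *\<^sub>C t) (g v) = dev v (d j)"
      using j by (simp add: g_def clinear_sum[OF l] tlift_tensor lin e_def lookup_single when_def
          scaleC_one if_distrib[of "\<lambda>c. c *\<^sub>C _"] cong: if_cong)
    then show ?thesis using clinear_0[OF l] v j by simp
  qed
  have act2: "left_module A ?B UNIV ?a2" and act3: "left_module A ?B UNIV ?a3"
    by (intro left_module_of_action[where A = A] tmap_action[where A = A] amult_bilinear amult_assoc amult_unity)+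
  \<comment> \<open>The length of a list encodes the index and its first entries encode elements of
    \<open>A\<close>; the subtracted 1 and 2 discount these entries. Two entries suffice for
    \<open>k3\<close> because the canonical map is onto, which bounds the dimension of
    \<open>A \<otimes> H\<close> in terms of \<open>A\<close>.\<close>
  define k2 where "k2 xs = hd xs \<otimes> e (length xs - 1)" for xs :: "'a list"
  define k3 where "k3 xs = can_lift A (hd xs \<otimes> hd (tl xs)) \<otimes> e (length xs - 2)" for xs :: "'a list"
  have k2: "cspan (range k2) = UNIV"
  proof -
    have "k2 (x # replicate j undefined) = x \<otimes> e j" for x j by (simp add: k2_def)
    then have "{x \<otimes> y | x y. x \<in> UNIV \<and> y \<in> range e} \<subseteq> range k2" by (auto simp: image_iff) metis
    from cvec.span_mono[OF this] show ?thesis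
      using span_tensor_UNIV[of UNIV "range e"] span_singles by (auto simp: e_def)
  qed
  have k3: "cspan (range k3) = UNIV"
  proof -
    have "k3 (x # y # replicate j undefined) = can_lift A (x \<otimes> y) \<otimes> e j" for x y j by (simp add: k3_def)
    then have sub: "{x \<otimes> y | x y. x \<in> can_lift A ` {x \<otimes> y | x y. True} \<and> y \<in> range e} \<subseteq> range k3"
      by (auto simp: image_iff) metis
    have "cspan (can_lift A ` {x \<otimes> y | x y. True}) = can_lift A ` cspan {x \<otimes> y | x y. True}"
      by (rule cpair.linear_span_image) (rule can_lift_lin[OF clinear_ident])
    also have "cspan {x \<otimes> y | x y. True} = (UNIV :: ('a \<otimes> 'a) set)"
      using span_elem_tensor by blast
    also have "range (can_lift A) = UNIV"
      using galois by (simp add: hopf_galois_iff)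
    finally show ?thesis
      using cvec.span_mono[OF sub] span_tensor_UNIV[of _ "range e"] span_singles by (auto simp: e_def)
  qed
  define w where "w = (\<Sum>i<n. tmap id (\<lambda>q. q \<otimes> e i) (T (z i)))"
  have w_bal: "tmap id g w \<in> balance ?B (mult A) ?a3 UNIV UNIV"
  proof -
    define Y where "Y h = tmap id (coact A) (T h) - tlift (\<lambda>x y. tmap id (\<lambda>q. q \<otimes> y) (T x)) (comul H h)" for h
    \<comment> \<open>Expanding \<open>h\<close> and the first legs of its coproduct in the
      \<open>z i\<close> reassembles the values of \<open>T\<close> there; what results is the
      expression treated in \<open>translation_colinear\<close>.\<close>
    have dev_sum: "(\<Sum>i<n. tmap id (\<lambda>q. dev (q \<otimes> e i) h) (T (z i))) = Y h" if h: "h \<in> F'" for h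
    proof -
      have hZ: "h \<in> Z" and sub: "X h \<subseteq> Z" using h by (auto simp: Z_def)
      define M where "M i u = tmap (id :: 'a \<Rightarrow> 'a) (\<lambda>q :: 'a. tlift (\<lambda>x y. xi i x *\<^sub>C (q \<otimes> y)) u)" for i and u :: "'h \<otimes> 'h"
      have "tmap id (\<lambda>q. dev (q \<otimes> e i) h) t = xi i h *\<^sub>C tmap id (coact A) t - M i (comul H h) t" if "i < n" for i t
      proof -
        have dq: "dev (q \<otimes> e i) h = xi i h *\<^sub>C coact A q - tlift (\<lambda>x y. xi i x *\<^sub>C (q \<otimes> y)) (comul H h)" for q
          using that by (simp add: dev_def e_def ext_single clinear_scale[OF coact_linear]
              tensor_scale)
        have "(\<lambda>t. tmap id (\<lambda>q. dev (q \<otimes> e i) h) t) = (\<lambda>t. xi i h *\<^sub>C tmap id (coact A) t - M i (comul H h) t)"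
          by (rule tensor_ext)
            (simp_all add: lin dev_lin coact_linear xi_lin M_def tmap_tensor,
             simp add: dq tensor_diff
              tensor_scale)
        then show ?thesis by (rule fun_cong)
      qed
      then have "(\<Sum>i<n. tmap id (\<lambda>q. dev (q \<otimes> e i) h) (T (z i))) =
          (\<Sum>i<n. xi i h *\<^sub>C tmap id (coact A) (T (z i))) - (\<Sum>i<n. M i (comul H h) (T (z i)))"
        by (simp add: sum_subtractf)
      also have "(\<Sum>i<n. xi i h *\<^sub>C tmap id (coact A) (T (z i))) = tmap id (coact A) (T h)"
        by (rule combine[OF hZ]) (simp add: lin coact_linear)
      also have "(\<Sum>i<n. M i (comul H h) (T (z i))) = tlift (\<lambda>x y. tmap id (\<lambda>q. q \<otimes> y) (T x)) (comul H h)"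
      proof (rule clinear_eq_on_span[OF _ _ X(2)[of h, unfolded tens_def]])
        show "clinear (\<lambda>u. \<Sum>i<n. M i u (T (z i)))"
          unfolding M_def by (simp add: lin xi_lin)
        show "clinear (\<lambda>u. tlift (\<lambda>x y. tmap id (\<lambda>q. q \<otimes> y) (T x)) u)"
          by (simp add: lin)
        fix u :: "'h \<otimes> 'h" assume "u \<in> {x \<otimes> y |x y. x \<in> X h \<and> y \<in> UNIV}"
        then obtain x y where u: "u = x \<otimes> y" "x \<in> Z" using sub by blast
        have "M i (x \<otimes> y) t = xi i x *\<^sub>C tmap id (\<lambda>q. q \<otimes> y) t" for i t
        by (rule tensor_eqI[where u = t])
    (simp_all add: lin xi_lin M_def tmap_tensor tlift_tensor
      tensor_scale)
        then show "(\<Sum>i<n. M i u (T (z i))) = tlift (\<lambda>x y. tmap id (\<lambda>q. q \<otimes> y) (T x)) u"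
          using combine[OF u(2), of "\<lambda>x. tmap id (\<lambda>q. q \<otimes> y) (T x)"]
          by (simp add: u(1) tlift_tensor lin)
      qed
      finally show ?thesis by (simp add: Y_def id_def)
    qed
    have "tmap id g (tmap id (\<lambda>q. q \<otimes> e i) t) = (\<Sum>j<m. tmap id (\<lambda>s. s \<otimes> e j) (tmap id (\<lambda>q. dev (q \<otimes> e i) (d j)) t))" for i t
    by (rule tensor_eqI[where u = t])
    (simp_all add: lin g_lin[OF clinear_ident] dev_lin tmap_tensor,
      simp add: g_def clinear_sum[OF clinear_tensor_right[OF clinear_ident]])
    then have "(\<Sum>i<n. tmap id g (tmap id (\<lambda>q. q \<otimes> e i) (T (z i)))) =
        (\<Sum>i<n. \<Sum>j<m. tmap id (\<lambda>s. s \<otimes> e j) (tmap id (\<lambda>q. dev (q \<otimes> e i) (d j)) (T (z i))))"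
      by (intro sum.cong refl)
    moreover have "tmap id g w = (\<Sum>i<n. tmap id g (tmap id (\<lambda>q. q \<otimes> e i) (T (z i))))"
      unfolding w_def
      by (rule clinear_sum[OF clinear_tmap[OF clinear_id g_lin[OF clinear_ident] clinear_ident]])
    ultimately have "tmap id g w =
        (\<Sum>i<n. \<Sum>j<m. tmap id (\<lambda>s. s \<otimes> e j) (tmap id (\<lambda>q. dev (q \<otimes> e i) (d j)) (T (z i))))"
      by simp
    also have "\<dots> = (\<Sum>j<m. tmap id (\<lambda>s. s \<otimes> e j) (\<Sum>i<n. tmap id (\<lambda>q. dev (q \<otimes> e i) (d j)) (T (z i))))"
      by (subst sum.swap)
        (simp add: clinear_sum[OF clinear_tmap[OF clinear_id clinear_tensor_left[OF clinear_ident] clinear_ident]])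
    also have "\<dots> = (\<Sum>j<m. tmap id (\<lambda>s. s \<otimes> e j) (Y (d j)))"
      using d by (intro sum.cong refl arg_cong[where f = "tmap _ _"] dev_sum) auto
    also have "\<dots> \<in> balance ?B (mult A) ?a3 UNIV UNIV"
    proof (rule cvec.subspace_sum[OF balance_subspace])
      fix j
      have "Y (d j) \<in> balance ?B (mult A) laH UNIV UNIV"
        unfolding Y_def by (rule translation_colinear)
      then show "tmap id (\<lambda>s. s \<otimes> e j) (Y (d j)) \<in> balance ?B (mult A) ?a3 UNIV UNIV"
        unfolding balance_def[of _ _ laH]
      proof (rule clinear_image_span_subset[of "tmap id (\<lambda>s. s \<otimes> e j)", rotated 3])
        fix t assume "t \<in> {mult A x b \<otimes> y - x \<otimes> laH b y |x b y. x \<in> UNIV \<and> b \<in> ?B \<and> y \<in> UNIV}"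
        then obtain x b y where t: "t = mult A x b \<otimes> y - x \<otimes> laH b y" "b \<in> ?B" by blast
        have "tmap id (\<lambda>s. s \<otimes> e j) t = mult A x b \<otimes> (y \<otimes> e j) - x \<otimes> ?a3 b (y \<otimes> e j)"
          by (simp add: t(1) tmap_diff tmap_tensor lin)
        then show "tmap id (\<lambda>s. s \<otimes> e j) t \<in> balance ?B (mult A) ?a3 UNIV UNIV"
          using t(2) by (simp only: balance_base[where la = ?a3] UNIV_I)
      qed (simp_all add: lin balance_subspace)
    qed
    finally show ?thesis .
  qed
  obtain w' where w': "w' \<in> tens UNIV {v. g v = 0}" "w - w' \<in> balance ?B (mult A) ?a2 UNIV UNIV"
    using flat_kernel[OF ff act2 act3 k2 k3 g_lin[OF clinear_ident] g_act w_bal] by blast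
  \<comment> \<open>Evaluation at 1, respecting the balancing relations. On \<open>w\<close> it
    gives the product of the two legs of \<open>T (unity H)\<close>, which is 1.\<close>
  define ev where "ev = tlift (\<lambda>a v. mult A a (ext v (unity H)))"
  have ev: "clinear ev" by (simp add: ev_def lin ext_lin)
  have ev_tensor: "ev (a \<otimes> v) = mult A a (ext v (unity H))" for a v
    by (simp add: ev_def tlift_tensor lin ext_lin)
  have "ev (w - w') \<in> {0}"
    using w'(2) unfolding balance_def
    by (rule clinear_image_span_subset[OF ev, rotated 2])
      (auto simp: cvec.subspace_single_0 clinear_diff[OF ev] ev_tensor ext_act amult_assoc)
  then have "ev w' = ev w" by (simp add: clinear_diff[OF ev])
  also have "ev w = unity A"
  proof -
    have "ev (tmap id (\<lambda>q. q \<otimes> e i) t) = xi i (unity H) *\<^sub>C tlift (mult A) t" if "i < n" for i t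
    proof -
      have "(\<lambda>t. ev (tmap id (\<lambda>q. q \<otimes> e i) t)) = (\<lambda>t. xi i (unity H) *\<^sub>C tlift (mult A) t)"
        using that by (intro tensor_ext)
          (simp_all add: lin clinear_compose[OF ev] amult_bilinear tmap_tensor ev_tensor tlift_tensor
            e_def ext_single clinear_scale[OF amult_lin(2)[OF clinear_ident]])
      then show ?thesis by (rule fun_cong)
    qed
    then have "ev w = (\<Sum>i<n. xi i (unity H) *\<^sub>C tlift (mult A) (T (z i)))"
      by (simp add: w_def clinear_sum[OF ev])
    also have "\<dots> = tlift (mult A) (T (unity H))"
      by (rule combine) (simp_all add: Z_def F'_def lin amult_bilinear)
    also have "\<dots> = unity A"
      using T_mult_sw[OF clinear_ident, of "unity H"] by (simp add: counit_unity scaleC_one)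
    finally show ?thesis .
  qed
  finally have ev_w': "ev w' = unity A" .
  \<comment> \<open>The values at 1 of the maps in the kernel of \<open>g\<close> form a left ideal
    of \<open>B\<close>, and \<open>w'\<close> writes 1 as an \<open>A\<close>-combination of
    them.\<close>
  define I where "I = (\<lambda>v. ext v (unity H)) ` {v. g v = 0}"
  have "unity A \<in> I"
  proof (rule faithful_ideal[OF ff comod_algebra])
    show "algebra_on ?B A"
      by (rule coinvariants_algebra)
    have "csubspace {v. g v = 0}"
      using g_lin[OF clinear_ident] by (auto simp: cvec.subspace_def clinear_iff clinear_0[OF g_lin[OF clinear_ident]])
    then show "csubspace I"
      unfolding I_def by (rule cpair.linear_subspace_image[OF ext_lin[OF clinear_ident]])
    show "I \<subseteq> ?B"
    proof
      fix x assume "x \<in> I"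
      then obtain v where v: "g v = 0" "x = ext v (unity H)" by (auto simp: I_def)
      then show "x \<in> ?B"
        using comp_zero[OF v(1), of "unity H"]
        by (simp add: F'_def dev_def coinvariants_def comul_unity tlift_tensor lin ext_lin2)
    qed
    show "mult A b x \<in> I" if b: "b \<in> ?B" and x: "x \<in> I" for b x
    proof -
      obtain v where v: "g v = 0" "x = ext v (unity H)" using x by (auto simp: I_def)
      have "g (?a2 b v) = 0" using g_act[OF b] v(1) clinear_0[of "?a3 b"] by (simp add: lin)
      then show ?thesis unfolding I_def v(2) ext_act[symmetric] by blast
    qed
    have "ev w' \<in> cspan {mult A a x | a x. x \<in> I}"
      using w'(1) unfolding tens_def
    proof (rule clinear_image_span_subset[OF ev cvec.subspace_span, rotated])
      fix y assume "y \<in> {x \<otimes> y |x y. x \<in> (UNIV :: 'a set) \<and> y \<in> {v. g v = 0}}"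
      then obtain a v where "y = a \<otimes> v" "g v = 0" by blast
      then show "ev y \<in> cspan {mult A a x | a x. x \<in> I}"
        by (intro cvec.span_base) (auto simp: ev_tensor I_def)
    qed
    then show "unity A \<in> cspan {mult A a x | a x. x \<in> I}" by (simp add: ev_w')
  qed
  then obtain v where v: "g v = 0" "ext v (unity H) = unity A" by (auto simp: I_def)
  have "colinear_at (ext v) h" if "h \<in> F" for h
    using comp_zero[OF v(1), of h] that by (simp add: F'_def dev_def colinear_at_def)
  then show ?thesis
    using v(2) ext_lin2[OF clinear_ident] by blast
qed

end

section \<open>Gradings\<close>

lemma clinear_if [lin]: "clinear f \<Longrightarrow> clinear g \<Longrightarrow> clinear (\<lambda>x. if P then f x else g x)"
  by (cases P) simp_all

lemma components_decomposition: "direct_sum G \<Longrightarrow> decomposition G x (components G x)"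
  unfolding components_def direct_sum_def by (rule theI') blast

lemma components_unique: "direct_sum G \<Longrightarrow> decomposition G x f \<Longrightarrow> components G x = f"
  using components_decomposition unfolding direct_sum_def by blast

lemma decomposition_superset:
  "finite K \<Longrightarrow> Poly_Mapping.keys f \<subseteq> K \<Longrightarrow> decomposition G x f \<longleftrightarrow>
    (\<forall>d. Poly_Mapping.lookup f d \<in> G d) \<and> x = (\<Sum>d\<in>K. Poly_Mapping.lookup f d)"
  unfolding decomposition_def
  by (subst sum.mono_neutral_left[of K "Poly_Mapping.keys f"]) (auto simp: in_keys_iff)

lemma components_linear:
  assumes G: "direct_sum G" shows "clinear (components G)"
proof -
  have sub: "csubspace (G d)" for d using G by (simp add: direct_sum_def)
  have "components G (x + y) = components G x + components G y" for x y
  proof (rule components_unique[OF G])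
    let ?f = "components G x" and ?g = "components G y"
    let ?K = "Poly_Mapping.keys ?f \<union> Poly_Mapping.keys ?g"
    have "decomposition G x ?f" "decomposition G y ?g"
      by (rule components_decomposition[OF G])+
    moreover have "finite ?K" "Poly_Mapping.keys ?f \<subseteq> ?K" "Poly_Mapping.keys ?g \<subseteq> ?K"
      "Poly_Mapping.keys (?f + ?g) \<subseteq> ?K"
      by (auto simp: Poly_Mapping.keys_add)
    ultimately show "decomposition G (x + y) (?f + ?g)"
      by (simp add: decomposition_superset[of ?K] lookup_add sum.distrib cvec.subspace_add[OF sub])
  qed
  moreover have "components G (c *\<^sub>C x) = c *\<^sub>C components G x" for c x
  proof (rule components_unique[OF G])
    let ?f = "components G x"
    have "decomposition G x ?f" by (rule components_decomposition[OF G])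
    moreover have "Poly_Mapping.keys (c *\<^sub>C ?f) \<subseteq> Poly_Mapping.keys ?f"
      by (auto simp: in_keys_iff scaleC_poly_mapping.rep_eq)
    ultimately show "decomposition G (c *\<^sub>C x) (c *\<^sub>C ?f)"
      by (simp add: decomposition_superset[of "Poly_Mapping.keys ?f"] scaleC_poly_mapping.rep_eq
        cvec.scale_sum_right[symmetric] cvec.subspace_scale[OF sub])
  qed
  ultimately show ?thesis by (simp add: clinear_iff)
qed

lemma components_homogeneous:
  assumes G: "direct_sum G" and x: "x \<in> G d"
  shows "components G x = Poly_Mapping.single d x"
proof (rule components_unique[OF G])
  have "0 \<in> G e" for e using G by (simp add: direct_sum_def cvec.subspace_0)
  then show "decomposition G x (Poly_Mapping.single d x)"
    using x by (auto simp: decomposition_def lookup_single when_def)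
qed

text \<open>The linear extension of a family of maps given degree by degree. Projections to degrees,
  deformed products and twists are instances.\<close>

definition gext :: "('d \<Rightarrow> 'v::complex_vector set) \<Rightarrow> ('d \<Rightarrow> 'v \<Rightarrow> 'w::complex_vector) \<Rightarrow> 'v \<Rightarrow> 'w" where
  "gext G F x = (\<Sum>d\<in>Poly_Mapping.keys (components G x). F d (Poly_Mapping.lookup (components G x) d))"

lemma gext_superset:
  assumes "\<And>d. clinear (F d)" "finite K" "Poly_Mapping.keys (components G x) \<subseteq> K"
  shows "gext G F x = (\<Sum>d\<in>K. F d (Poly_Mapping.lookup (components G x) d))"
  unfolding gext_def using assms
  by (intro sum.mono_neutral_left) (auto simp: in_keys_iff clinear_0)

lemma clinear_gext [lin]:
  assumes G: "direct_sum G" and F: "\<And>d. clinear (F d)" and f: "clinear f"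
  shows "clinear (\<lambda>x. gext G F (f x))"
proof -
  note cl = components_linear[OF G]
  have "gext G F (x + y) = gext G F x + gext G F y" for x y
  proof -
    let ?K = "Poly_Mapping.keys (components G x) \<union> Poly_Mapping.keys (components G y)"
    have "finite ?K" "Poly_Mapping.keys (components G (x + y)) \<subseteq> ?K"
      by (simp_all add: clinear_add[OF cl] Poly_Mapping.keys_add)
    then show ?thesis
      by (simp add: gext_superset[OF F, of ?K] clinear_add[OF cl] lookup_add clinear_add[OF F] sum.distrib)
  qed
  moreover have "gext G F (c *\<^sub>C x) = c *\<^sub>C gext G F x" for c x
  proof -
    have "Poly_Mapping.keys (components G (c *\<^sub>C x)) \<subseteq> Poly_Mapping.keys (components G x)"
      by (auto simp: clinear_scale[OF cl] in_keys_iff scaleC_poly_mapping.rep_eq)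
    then show ?thesis
      by (simp add: gext_superset[OF F, of "Poly_Mapping.keys (components G x)"] clinear_scale[OF cl]
        scaleC_poly_mapping.rep_eq clinear_scale[OF F] cvec.scale_sum_right)
  qed
  ultimately have "clinear (gext G F)" by (simp add: clinear_iff)
  then show ?thesis by (rule clinear_compose[OF _ f])
qed

lemma clinear_gext_param [lin]:
  "(\<And>d y. clinear (\<lambda>x. F x d y)) \<Longrightarrow> clinear (\<lambda>x. gext G (F x) y)"
  unfolding gext_def by (rule clinear_sum_map)

lemma gext_homogeneous:
  assumes "direct_sum G" "x \<in> G d" "clinear (F d)"
  shows "gext G F x = F d x"
  using components_homogeneous[OF assms(1,2)]
  by (cases "x = 0") (simp_all add: gext_def clinear_0[OF assms(3)])

lemma graded_in_subspace:
  assumes G: "direct_sum G" and f: "clinear f" and V: "csubspace V"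
    and hom: "\<And>d x. x \<in> G d \<Longrightarrow> f x \<in> V"
  shows "f x \<in> V"
proof -
  have "decomposition G x (components G x)" by (rule components_decomposition[OF G])
  then have d: "\<And>d. Poly_Mapping.lookup (components G x) d \<in> G d"
    and x: "x = (\<Sum>d\<in>Poly_Mapping.keys (components G x). Poly_Mapping.lookup (components G x) d)"
    by (auto simp: decomposition_def)
  have "f x = (\<Sum>d\<in>Poly_Mapping.keys (components G x). f (Poly_Mapping.lookup (components G x) d))"
    by (subst x) (rule clinear_sum[OF f])
  also have "\<dots> \<in> V"
    by (intro cvec.subspace_sum[OF V] hom[OF d])
  finally show ?thesis .
qed

lemma graded_ext:
  assumes G: "direct_sum G" and "clinear f" "clinear g" and hom: "\<And>d x. x \<in> G d \<Longrightarrow> f x = g x"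
  shows "f = g"
proof
  fix x
  have "f x - g x \<in> {0}"
    by (rule graded_in_subspace[OF G, of "\<lambda>x. f x - g x"])
      (simp_all add: assms clinear_minus cvec.subspace_single_0 hom)
  then show "f x = g x" by simp
qed

lemma tensor_graded_ext:
  assumes G: "direct_sum G" and G': "direct_sum G'" and f: "clinear f" and g: "clinear g"
    and hom: "\<And>d e x y. x \<in> G d \<Longrightarrow> y \<in> G' e \<Longrightarrow> f (x \<otimes> y) = g (x \<otimes> y)"
  shows "f = g"
proof (rule tensor_ext[OF f g])
  fix x y
  have *: "(\<lambda>y. f (x \<otimes> y)) = (\<lambda>y. g (x \<otimes> y))" if "x \<in> G d" for x d
    by (rule graded_ext[OF G']) (simp_all add: lin clinear_compose[OF f] clinear_compose[OF g] hom[OF that])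
  have "(\<lambda>x. f (x \<otimes> y)) = (\<lambda>x. g (x \<otimes> y))"
    by (rule graded_ext[OF G]) (simp_all add: lin clinear_compose[OF f] clinear_compose[OF g] *[THEN fun_cong])
  then show "f (x \<otimes> y) = g (x \<otimes> y)" by (rule fun_cong)
qed

definition twist :: "('d \<Rightarrow> 'v::complex_vector set) \<Rightarrow> ('e \<Rightarrow> 'w::complex_vector set) \<Rightarrow>
    ('d \<Rightarrow> 'e \<Rightarrow> complex) \<Rightarrow> 'v \<otimes> 'w \<Rightarrow> 'v \<otimes> 'w" where
  "twist G G' \<omega> = tlift (\<lambda>x y. gext G (\<lambda>d x'. gext G' (\<lambda>e y'. \<omega> d e *\<^sub>C (x' \<otimes> y')) y) x)"

lemma twist_lin [lin]: "direct_sum G \<Longrightarrow> direct_sum G' \<Longrightarrow> clinear f \<Longrightarrow> clinear (\<lambda>x. twist G G' \<omega> (f x))"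
  by (simp add: twist_def lin)

lemma twist_homogeneous:
  "direct_sum G \<Longrightarrow> direct_sum G' \<Longrightarrow> x \<in> G d \<Longrightarrow> y \<in> G' e \<Longrightarrow>
    twist G G' \<omega> (x \<otimes> y) = \<omega> d e *\<^sub>C (x \<otimes> y)"
  unfolding twist_def by (simp add: tlift_tensor lin gext_homogeneous)

lemma twist_twist:
  assumes G: "direct_sum G" and G': "direct_sum G'"
  shows "twist G G' \<omega> (twist G G' \<psi> u) = twist G G' (\<lambda>d e. \<omega> d e * \<psi> d e) u"
proof -
  have "(\<lambda>u. twist G G' \<omega> (twist G G' \<psi> u)) = twist G G' (\<lambda>d e. \<omega> d e * \<psi> d e)"
    by (rule tensor_graded_ext[OF G G'])
      (simp_all add: lin G G' twist_homogeneous[OF G G'] clinear_scale[OF twist_lin[OF G G' clinear_ident]]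
        mult.commute)
  then show ?thesis by (rule fun_cong)
qed

lemma twist_one:
  assumes G: "direct_sum G" and G': "direct_sum G'"
  shows "twist G G' (\<lambda>_ _. 1) u = u"
proof -
  have "twist G G' (\<lambda>_ _. 1) = (\<lambda>u. u)"
    by (rule tensor_graded_ext[OF G G']) (simp_all add: lin G G' twist_homogeneous[OF G G'] scaleC_one)
  then show ?thesis by (rule fun_cong)
qed

lemma twist_inverse:
  assumes "direct_sum G" "direct_sum G'" and "\<And>d e. \<omega> d e \<noteq> 0"
  shows "twist G G' (\<lambda>d e. inverse (\<omega> d e)) (twist G G' \<omega> u) = u"
    "twist G G' \<omega> (twist G G' (\<lambda>d e. inverse (\<omega> d e)) u) = u"
  using assms by (simp_all add: twist_twist twist_one)

section \<open>The phases\<close>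

lemma phase_nonzero [simp]: "phase \<theta> r l \<noteq> 0"
  by (simp add: phase_def)

lemma phase_add_left: "phase \<theta> (r + r') l = phase \<theta> r l * phase \<theta> r' l"
proof -
  have "(\<chi> i. real_of_int ((r + r') $ i)) = (\<chi> i. real_of_int (r $ i)) + (\<chi> i. real_of_int (r' $ i))"
    by (simp add: vec_eq_iff)
  then show ?thesis
    by (simp add: phase_def matrix_vector_right_distrib inner_add_left distrib_left exp_add)
qed

lemma phase_add_right: "phase \<theta> r (l + l') = phase \<theta> r l * phase \<theta> r l'"
proof -
  have "(\<chi> i. real_of_int ((l + l') $ i)) = (\<chi> i. real_of_int (l $ i)) + (\<chi> i. real_of_int (l' $ i))"
    by (simp add: vec_eq_iff)
  then show ?thesis
    by (simp add: phase_def inner_add_right distrib_left exp_add)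
qed

lemma phase_zero [simp]: "phase \<theta> 0 l = 1" "phase \<theta> r 0 = 1"
  using phase_add_left[of \<theta> 0 0 l] phase_add_right[of \<theta> r 0 0] by simp_all

lemma phase_neg_left: "phase \<theta> (- r) l = inverse (phase \<theta> r l)"
  using phase_add_left[of \<theta> "- r" r l] by (simp add: field_simps)

lemma phase_neg_right: "phase \<theta> r (- l) = inverse (phase \<theta> r l)"
  using phase_add_right[of \<theta> r "- l" l] by (simp add: field_simps)

lemma phase_minus: "phase (- \<theta>) r l = inverse (phase \<theta> r l)"
proof -
  have "(- \<theta>) *v x = - (\<theta> *v x)" for x
    by (simp add: matrix_vector_mult_def vec_eq_iff sum_negf)
  then show ?thesis
    by (simp add: phase_def exp_minus)
qed

lemma phase_swap:
  assumes "transpose \<theta> = - \<theta>"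
  shows "phase \<theta> l r = inverse (phase \<theta> r l)"
proof -
  have "(\<theta> *v x) \<bullet> y = - ((\<theta> *v y) \<bullet> x)" for x y
  proof -
    have "(\<theta> *v x) \<bullet> y = x \<bullet> (transpose \<theta> *v y)"
      by (metis dot_lmul_matrix inner_commute matrix_vector_mul_assoc transpose_matrix_vector transpose_transpose)
    also have "\<dots> = - ((\<theta> *v y) \<bullet> x)"
    proof -
      have "(- \<theta>) *v y = - (\<theta> *v y)"
        by (simp add: matrix_vector_mult_def vec_eq_iff sum_negf)
      then show ?thesis by (simp add: assms inner_commute)
    qed
    finally show ?thesis .
  qed
  then show ?thesis
    unfolding phase_def by (metis (no_types, lifting) exp_minus mult_minus_right of_real_minus)
qed

lemma phase_self:
  assumes "transpose \<theta> = - \<theta>"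
  shows "phase \<theta> r r = 1"
proof -
  have "(\<theta> *v x) \<bullet> x = 0" for x
  proof -
    have "(\<theta> *v x) \<bullet> x = x \<bullet> (transpose \<theta> *v x)"
      by (metis dot_lmul_matrix inner_commute matrix_vector_mul_assoc transpose_matrix_vector transpose_transpose)
    also have "(- \<theta>) *v x = - (\<theta> *v x)"
      by (simp add: matrix_vector_mult_def vec_eq_iff sum_negf)
    then have "x \<bullet> (transpose \<theta> *v x) = - ((\<theta> *v x) \<bullet> x)" by (simp add: assms inner_commute)
    finally show ?thesis by simp
  qed
  then show ?thesis by (simp add: phase_def)
qed

section \<open>The deformed algebras\<close>

lemma deformed_mult_gext: "deformed_mult \<theta> G m x y =
    gext G (\<lambda>d x'. gext G (\<lambda>e y'. (phase \<theta> (fst d) (fst e) * phase (- \<theta>) (snd d) (snd e)) *\<^sub>C m x' y') y) x"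
  by (simp add: deformed_mult_def gext_def split_def)

lemma deformed_mult_bilinear:
  assumes "direct_sum G" "cbilinear m" shows "cbilinear (deformed_mult \<theta> G m)"
proof -
  have "clinear (\<lambda>x. m x y)" "clinear (m x)" for x y
    using assms(2) by (auto simp: cbilinear_def)
  then show ?thesis
    unfolding deformed_mult_gext[abs_def] using assms(1) by (simp add: lin)
qed

lemma deformed_mult_homogeneous:
  assumes "direct_sum G" "cbilinear m" "x \<in> G (r, s)" "y \<in> G (p, q)"
  shows "deformed_mult \<theta> G m x y = (phase \<theta> r p * inverse (phase \<theta> s q)) *\<^sub>C m x y"
proof -
  have "clinear (\<lambda>x. m x y)" "clinear (m x)" for x y
    using assms(2) by (auto simp: cbilinear_def)
  then show ?thesis
    unfolding deformed_mult_gext using assms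
    by (simp add: gext_homogeneous lin phase_minus)
qed

lemma deform_simps [simp]:
  "mult (deform \<theta> G B) = deformed_mult \<theta> G (mult B)" "unity (deform \<theta> G B) = unity B"
  by (simp_all add: deform_def)

lemma deform_hopf_simps [simp]:
  "comul (deform \<theta> G H) = comul H" "counit (deform \<theta> G H) = counit H"
  "antipode (deform \<theta> G H) = antipode H"
  by (simp_all add: deform_def)

lemma deform_comod_simps [simp]: "coact (deform \<theta> G A) = coact A"
  by (simp add: deform_def)

text \<open>Comparing the parts of degree \<open>(p, q)\<close> in \<open>1 x = x\<close> shows that
  the degree-zero component of 1 is a left unit on homogeneous elements, hence everywhere;
  multiplied by 1 it is 1.\<close>

lemma unity_homogeneous:
  fixes G :: "'n::finite bideg \<Rightarrow> 'a::complex_vector set"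
  assumes G: "direct_sum G" and B: "algebra_on UNIV B"
    and gr: "\<And>x y r s p q. x \<in> G (r, s) \<Longrightarrow> y \<in> G (p, q) \<Longrightarrow> mult B x y \<in> G (r + p, s + q)"
  shows "unity B \<in> G (0, 0)"
proof -
  have bil: "clinear (\<lambda>x. mult B x y)" "clinear (mult B x)"
    and unit: "mult B (unity B) x = x" "mult B x (unity B) = x" for x y
    using B by (auto simp: algebra_on_def cbilinear_def)
  define pr where "pr d = gext G (\<lambda>e x. if e = d then x else 0)" for d
  have pr_lin: "clinear f \<Longrightarrow> clinear (\<lambda>x. pr d (f x))" for d and f :: "'c::complex_vector \<Rightarrow> 'a"
    unfolding pr_def by (rule clinear_gext[OF G]) (simp_all add: lin)
  have pr_hom: "pr d x = (if e = d then x else 0)" if "x \<in> G e" for d e x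
    unfolding pr_def using gext_homogeneous[OF G that, of "\<lambda>e x. if e = d then x else 0"] by (simp add: lin)
  let ?u = "pr (0, 0) (unity B)"
  have "mult B ?u x = x" if x: "x \<in> G (p, q)" for x p q
  proof -
    have "(\<lambda>y. pr (p, q) (mult B y x)) = (\<lambda>y. mult B (pr (0, 0) y) x)"
    proof (rule graded_ext[OF G])
      fix d y assume y: "y \<in> G d"
      obtain r s where d: "d = (r, s)" by (cases d)
      show "pr (p, q) (mult B y x) = mult B (pr (0, 0) y) x"
        using pr_hom[OF gr[OF y[unfolded d] x], of "(p, q)"] pr_hom[OF y, of "(0, 0)"]
        by (auto simp: d clinear_0[OF bil(1)])
    qed (simp_all add: pr_lin bil clinear_compose[OF bil(1)] lin)
    from fun_cong[OF this, of "unity B"] show ?thesis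
      using pr_hom[OF x, of "(p, q)"] by (simp add: unit)
  qed
  then have "mult B ?u = (\<lambda>x. x)"
    by (intro graded_ext[OF G]) (auto simp: bil lin)
  then have "?u = unity B" using unit(2)[of ?u] by metis
  moreover have "?u \<in> G (0, 0)"
  proof (rule graded_in_subspace[OF G, of "pr (0, 0)"])
    show "csubspace (G (0, 0))" using G by (simp add: direct_sum_def)
    then show "pr (0, 0) x \<in> G (0, 0)" if "x \<in> G d" for d x
      using pr_hom[OF that] that by (auto simp: cvec.subspace_0)
  qed (rule pr_lin[OF clinear_ident])
  ultimately show ?thesis by simp
qed

text \<open>The phase is a bicharacter, so both bracketings of three homogeneous elements acquire
  the product of the phases of the three pairs. The unit has degree zero and phase 1.\<close>

lemma deform_algebra:
  fixes G :: "'n::finite bideg \<Rightarrow> 'a::complex_vector set"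
  assumes G: "direct_sum G" and B: "algebra_on UNIV B"
    and gr: "\<And>x y r s p q. x \<in> G (r, s) \<Longrightarrow> y \<in> G (p, q) \<Longrightarrow> mult B x y \<in> G (r + p, s + q)"
  shows "algebra_on UNIV (deform \<theta> G B)"
proof -
  have bil: "cbilinear (mult B)" and unit: "mult B (unity B) x = x" "mult B x (unity B) = x"
    and assoc: "mult B (mult B x y) z = mult B x (mult B y z)" for x y z
    using B by (auto simp: algebra_on_def)
  let ?m = "deformed_mult \<theta> G (mult B)"
  have mb: "cbilinear ?m" by (rule deformed_mult_bilinear[OF G bil])
  have l1: "clinear f \<Longrightarrow> clinear (\<lambda>x. ?m (f x) y)" and l2: "clinear f \<Longrightarrow> clinear (\<lambda>x. ?m y (f x))"
    for f :: "'c::complex_vector \<Rightarrow> 'a" and y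
    using mb clinear_compose[of "\<lambda>x. ?m x y" f] clinear_compose[of "?m y" f] by (auto simp: cbilinear_def)
  note hom = deformed_mult_homogeneous[OF G bil]
  note sc = clinear_scale[OF l1[OF clinear_ident]] clinear_scale[OF l2[OF clinear_ident]]
  have a1: "?m (?m x y) z = ?m x (?m y z)" if x: "x \<in> G d" and y: "y \<in> G e" and z: "z \<in> G f" for x y z d e f
  proof -
    obtain r s p q k l where d: "d = (r, s)" "e = (p, q)" "f = (k, l)" by (cases d, cases e, cases f)
    note x = x[unfolded d] and y = y[unfolded d] and z = z[unfolded d]
    show ?thesis
      by (simp add: hom[OF x y] hom[OF y z] sc hom[OF gr[OF x y] z] hom[OF x gr[OF y z]]
        assoc phase_add_left phase_add_right scaleC_scaleC algebra_simps)
  qed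
  have a2: "?m (?m x y) z = ?m x (?m y z)" if x: "x \<in> G d" and y: "y \<in> G e" for x y z d e
    by (rule fun_cong[of _ _ z], rule graded_ext[OF G]) (simp_all add: l1 l2 lin a1[OF x y])
  have a3: "?m (?m x y) z = ?m x (?m y z)" if x: "x \<in> G d" for x y z d
    by (rule fun_cong[of _ _ y], rule graded_ext[OF G]) (simp_all add: l1 l2 lin a2[OF x])
  have a: "?m (?m x y) z = ?m x (?m y z)" for x y z
    by (rule fun_cong[of _ _ x], rule graded_ext[OF G]) (simp_all add: l1 l2 lin a3)
  note u = unity_homogeneous[OF G B gr]
  have "?m (unity B) = (\<lambda>x. x)" "(\<lambda>x. ?m x (unity B)) = (\<lambda>x. x)"
    by (rule graded_ext[OF G]; auto simp: l1 l2 lin hom[OF u] hom[OF _ u] unit scaleC_one)+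
  then have "?m (unity B) x = x" "?m x (unity B) = x" for x by metis+
  then show ?thesis by (simp add: algebra_on_def mb a cvec.subspace_UNIV)
qed

abbreviation graded_tens ::
    "('d \<times> 'd \<Rightarrow> 'v::complex_vector set) \<Rightarrow> ('d \<times> 'd \<Rightarrow> 'w::complex_vector set) \<Rightarrow> 'd \<Rightarrow> 'd \<Rightarrow> ('v \<otimes> 'w) set" where
  "graded_tens G G' r l \<equiv> cspan (\<Union>s. {y \<otimes> z | y z. y \<in> G (r, s) \<and> z \<in> G' (s, l)})"

lemma graded_tens_eq:
  assumes "clinear f" "clinear g" "u \<in> graded_tens G G' r l"
    and "\<And>s y z. y \<in> G (r, s) \<Longrightarrow> z \<in> G' (s, l) \<Longrightarrow> f (y \<otimes> z) = g (y \<otimes> z)"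
  shows "f u = g u"
  by (rule clinear_eq_on_span[OF assms(1,2,3)]) (use assms(4) in blast)

lemma graded_tens_eq2:
  assumes "cbilinear f" "cbilinear g" "u \<in> graded_tens G G' r l" "u' \<in> graded_tens K K' r' l'"
    and eq: "\<And>s y z s' y' z'. y \<in> G (r, s) \<Longrightarrow> z \<in> G' (s, l) \<Longrightarrow> y' \<in> K (r', s') \<Longrightarrow> z' \<in> K' (s', l') \<Longrightarrow>
      f (y \<otimes> z) (y' \<otimes> z') = g (y \<otimes> z) (y' \<otimes> z')"
  shows "f u u' = g u u'"
proof -
  have l: "clinear (f x)" "clinear (g x)" "clinear (\<lambda>x. f x y)" "clinear (\<lambda>x. g x y)" for x y
    using assms(1,2) by (auto simp: cbilinear_def)
  show ?thesis
    by (rule graded_tens_eq[OF l(3,4) assms(3)], rule graded_tens_eq[OF l(1,2) assms(4)], rule eq)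
qed

text \<open>For legs of degrees \<open>(r, t)\<close>, \<open>(t, s)\<close> and
  \<open>(p, t')\<close>, \<open>(t', q)\<close> the phase of \<open>t\<close> and \<open>t'\<close>
  occurs once inverted and once as it is, so only the phases of the outer degrees remain. A general
  \<open>D\<close> covers both the coproduct and the coaction.\<close>

lemma deformed_coaction_mult:
  fixes GA :: "'n::finite bideg \<Rightarrow> 'a::complex_vector set" and GH :: "'n bideg \<Rightarrow> 'h::complex_vector set"
  assumes GA: "direct_sum GA" and GH: "direct_sum GH" and m: "cbilinear m" and m': "cbilinear m'"
    and D: "clinear D" and D_mult: "\<And>x y. D (m x y) = tmult m m' (D x) (D y)"
    and gr: "\<And>x r l. x \<in> GA (r, l) \<Longrightarrow> D x \<in> graded_tens GA GH r l"
  shows "D (deformed_mult \<theta> GA m x y) = tmult (deformed_mult \<theta> GA m) (deformed_mult \<theta> GH m') (D x) (D y)"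
proof -
  note mb = deformed_mult_bilinear[OF GA m, of \<theta>] and mb' = deformed_mult_bilinear[OF GH m', of \<theta>]
  have tb: "cbilinear (tmult n n')" if "cbilinear n" "cbilinear n'"
    for n :: "'a \<Rightarrow> 'a \<Rightarrow> 'a" and n' :: "'h \<Rightarrow> 'h \<Rightarrow> 'h"
  proof -
    have "clinear (\<lambda>x. n x y)" "clinear (n x)" "clinear (\<lambda>x. n' x z)" "clinear (n' w)" for x y z w
      using that by (auto simp: cbilinear_def)
    then show ?thesis by (simp add: tmult_def tlift2_def lin)
  qed
  have l: "clinear (\<lambda>x. D (deformed_mult \<theta> GA m x y))" "clinear (\<lambda>y. D (deformed_mult \<theta> GA m x y))"
    "clinear (\<lambda>x. tmult (deformed_mult \<theta> GA m) (deformed_mult \<theta> GH m') (D x) v)"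
    "clinear (\<lambda>y. tmult (deformed_mult \<theta> GA m) (deformed_mult \<theta> GH m') w (D y))" for x y v w
    using mb tb[OF mb mb'] D by (auto simp: cbilinear_def clinear_compose[OF D] intro: clinear_compose[of _ D]
        clinear_compose[of "\<lambda>x. tmult (deformed_mult \<theta> GA m) (deformed_mult \<theta> GH m') x v" D])
  have hom: "D (deformed_mult \<theta> GA m x y) = tmult (deformed_mult \<theta> GA m) (deformed_mult \<theta> GH m') (D x) (D y)"
    if x: "x \<in> GA d" and y: "y \<in> GA e" for x y d e
  proof -
    obtain r s p q where d: "d = (r, s)" "e = (p, q)" by (cases d, cases e)
    note x = x[unfolded d] and y = y[unfolded d]
    let ?c = "phase \<theta> r p * inverse (phase \<theta> s q)"
    have "D (deformed_mult \<theta> GA m x y) = ?c *\<^sub>C tmult m m' (D x) (D y)"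
      by (simp add: deformed_mult_homogeneous[OF GA m x y] clinear_scale[OF D] D_mult)
    also have "\<dots> = tmult (deformed_mult \<theta> GA m) (deformed_mult \<theta> GH m') (D x) (D y)"
    proof (rule graded_tens_eq2[OF _ tb[OF mb mb'] gr[OF x] gr[OF y]])
      show "cbilinear (\<lambda>u v. ?c *\<^sub>C tmult m m' u v)"
        using tb[OF m m'] by (auto simp: cbilinear_def lin)
      fix t u v t' u' v' assume *: "u \<in> GA (r, t)" "v \<in> GH (t, s)" "u' \<in> GA (p, t')" "v' \<in> GH (t', q)"
      show "?c *\<^sub>C tmult m m' (u \<otimes> v) (u' \<otimes> v') =
          tmult (deformed_mult \<theta> GA m) (deformed_mult \<theta> GH m') (u \<otimes> v) (u' \<otimes> v')"
        by (simp add: tmult_tensor m m' mb mb' deformed_mult_homogeneous[OF GA m *(1,3)]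
          deformed_mult_homogeneous[OF GH m' *(2,4)] tensor_scale)
    qed
    finally show ?thesis .
  qed
  have hom2: "D (deformed_mult \<theta> GA m x y) = tmult (deformed_mult \<theta> GA m) (deformed_mult \<theta> GH m') (D x) (D y)"
    if x: "x \<in> GA d" for x y d
    by (rule fun_cong[of _ _ y], rule graded_ext[OF GA]) (simp_all add: l hom[OF x])
  show ?thesis
    by (rule fun_cong[of _ _ x], rule graded_ext[OF GA]) (simp_all add: l hom2)
qed

locale bigraded_extension = bigraded_hopf_algebra H GH + bigraded_comodule_algebra H A GH GA
  for H :: "('h::complex_vector) hopf" and A :: "('a::complex_vector, 'h) comod"
    and GH :: "'n::finite bideg \<Rightarrow> 'h set" and GA :: "'n bideg \<Rightarrow> 'a set" +
  fixes \<theta> :: "real ^ 'n ^ 'n"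
  assumes skew: "transpose \<theta> = - \<theta>"
begin

abbreviation "H' \<equiv> deform \<theta> GH H"
abbreviation "A' \<equiv> deform \<theta> GA A"
abbreviation mH (infixl \<open>\<star>\<^sub>H\<close> 70) where "mH \<equiv> deformed_mult \<theta> GH (mult H)"
abbreviation mA (infixl \<open>\<star>\<^sub>A\<close> 70) where "mA \<equiv> deformed_mult \<theta> GA (mult A)"

lemmas homH = deformed_mult_homogeneous[OF graded mult_bilinear, of _ _ _ _ _ _ \<theta>]
  and homA = deformed_mult_homogeneous[OF comod_graded amult_bilinear, of _ _ _ _ _ _ \<theta>]

lemma mH_bilinear: "cbilinear mH" and mA_bilinear: "cbilinear mA"
  by (rule deformed_mult_bilinear[OF graded mult_bilinear] deformed_mult_bilinear[OF comod_graded amult_bilinear])+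

lemma mH_lin [lin]:
  "clinear f \<Longrightarrow> clinear (\<lambda>x. mH (f x) y)" "clinear f \<Longrightarrow> clinear (\<lambda>x. mH y (f x))"
  using mH_bilinear clinear_compose[of "\<lambda>x. mH x y" f] clinear_compose[of "mH y" f]
  by (auto simp: cbilinear_def)

lemma mA_lin [lin]:
  "clinear f \<Longrightarrow> clinear (\<lambda>x. mA (f x) y)" "clinear f \<Longrightarrow> clinear (\<lambda>x. mA y (f x))"
  using mA_bilinear clinear_compose[of "\<lambda>x. mA x y" f] clinear_compose[of "mA y" f]
  by (auto simp: cbilinear_def)

text \<open>The factor \<open>c r l\<close> depends only on the outer degrees and can be pulled out
  of the Sweedler sum. For \<open>r \<noteq> l\<close> the counit, and with it both sides, vanishes;
  for \<open>r = l\<close> the factor is 1.\<close>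

lemma deformed_antipode:
  assumes \<beta>: "cbilinear \<beta>" and \<beta>': "cbilinear \<beta>'"
    and \<beta>_eq: "\<And>x. tlift \<beta> (comul H x) = counit H x *\<^sub>C unity H"
    and rel: "\<And>r s l y z. y \<in> GH (r, s) \<Longrightarrow> z \<in> GH (s, l) \<Longrightarrow> \<beta>' y z = c r l *\<^sub>C \<beta> y z"
    and c: "\<And>r. c r r = 1"
  shows "tlift \<beta>' (comul H x) = counit H x *\<^sub>C unity H"
proof -
  have "(\<lambda>x. tlift \<beta>' (comul H x)) = (\<lambda>x. counit H x *\<^sub>C unity H)"
  proof (rule graded_ext[OF graded])
    fix d x assume x: "x \<in> GH d"
    obtain r l where d: "d = (r, l)" by (cases d)
    have "tlift \<beta>' (comul H x) = c r l *\<^sub>C tlift \<beta> (comul H x)"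
      by (rule graded_tens_eq[OF _ _ graded_comul[OF x[unfolded d]]])
        (use rel in \<open>auto simp: lin \<beta> \<beta>' tlift_tensor\<close>)
    also have "\<dots> = counit H x *\<^sub>C unity H"
      using graded_counit[OF x[unfolded d]] by (cases "r = l") (simp_all add: \<beta>_eq c scaleC_one)
    finally show "tlift \<beta>' (comul H x) = counit H x *\<^sub>C unity H" .
  qed (simp_all add: lin \<beta>')
  then show ?thesis by (rule fun_cong)
qed

lemma phase_negs:
  "phase \<theta> (- s) s * inverse (phase \<theta> (- r) l) = phase \<theta> r l"
  "phase \<theta> r (- l) * inverse (phase \<theta> s (- s)) = inverse (phase \<theta> r l)"
  "phase \<theta> (- l) r * inverse (phase \<theta> (- s) s) = phase \<theta> r l"
  using phase_swap[OF skew, of l r]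
  by (simp_all add: phase_neg_left phase_neg_right phase_self[OF skew])

text \<open>The antipode exchanges and negates the degrees, so the inner degree \<open>s\<close>
  meets \<open>- s\<close> and contributes 1; a phase in \<open>r\<close> and \<open>l\<close> is
  left.\<close>

lemma antipode_mult_homogeneous:
  assumes y: "y \<in> GH (r, s)" and z: "z \<in> GH (s, l)"
  shows "mH (antipode H y) z = phase \<theta> r l *\<^sub>C mult H (antipode H y) z"
    "mH y (antipode H z) = inverse (phase \<theta> r l) *\<^sub>C mult H y (antipode H z)"
    "mH (antipode H z) y = phase \<theta> r l *\<^sub>C mult H (antipode H z) y"
  unfolding homH[OF graded_antipode[OF y] z] homH[OF y graded_antipode[OF z]]
    homH[OF graded_antipode[OF z] y] phase_negs by (rule refl)+

text \<open>The reversed antipode identity persists even where the deformed product is no longer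
  commutative.\<close>

lemma deformed_antipode_inv:
  assumes "\<And>h. tlift (\<lambda>x y. mult H (antipode H y) x) (comul H h) = counit H h *\<^sub>C unity H"
  shows "tlift (\<lambda>x y. mH (antipode H y) x) (comul H h) = counit H h *\<^sub>C unity H"
  by (rule deformed_antipode[OF _ _ assms, where c = "phase \<theta>"])
    (simp_all add: lin antipode_mult_homogeneous phase_self[OF skew])

lemma deformed_hopf_algebra: "hopf_algebra H'"
proof (rule hopf_algebra.intro)
  show "algebra_on UNIV H'"
    by (rule deform_algebra[OF graded algebra]) (rule graded_mult)
  show "comul H' (mult H' x y) = tmult (mult H') (mult H') (comul H' x) (comul H' y)" for x y
    unfolding deform_simps deform_hopf_simps
    by (rule deformed_coaction_mult[OF graded graded mult_bilinear mult_bilinear comul_linear comul_mult graded_comul])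
  show "counit H' (mult H' x y) = counit H' x * counit H' y" for x y
  proof -
    \<comment> \<open>The counit vanishes unless \<open>r = s\<close> and \<open>p = q\<close>, and
      then the two phases are inverse to each other.\<close>
    have hom: "counit H (mH x y) = counit H x * counit H y" if x: "x \<in> GH d" and y: "y \<in> GH e" for x y d e
    proof -
      obtain r s p q where d: "d = (r, s)" "e = (p, q)" by (cases d, cases e)
      note x = x[unfolded d] and y = y[unfolded d]
      have "counit H (mH x y) = phase \<theta> r p * inverse (phase \<theta> s q) * (counit H x * counit H y)"
        by (simp add: homH[OF x y] clinear_scale[OF counit_linear] scaleC_complex_def counit_mult)
      then show ?thesis
        using graded_counit[OF x] graded_counit[OF y] by (cases "r = s"; cases "p = q") simp_all
    qed
    have "(\<lambda>y. counit H (mH x y)) = (\<lambda>y. counit H x * counit H y)" if "x \<in> GH d" for x d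
      by (rule graded_ext[OF graded]) (simp_all add: lin hom[OF that])
    then have "(\<lambda>x. counit H (mH x y)) = (\<lambda>x. counit H x * counit H y)"
      by (intro graded_ext[OF graded]) (auto simp: lin fun_eq_iff)
    then show ?thesis by (simp add: fun_eq_iff)
  qed
  show "tlift (\<lambda>y z. mult H' (antipode H' y) z) (comul H' x) = counit H' x *\<^sub>C unity H'" for x
    unfolding deform_simps deform_hopf_simps
    by (rule deformed_antipode[OF _ _ antipode_left, where c = "phase \<theta>"])
      (simp_all add: lin antipode_mult_homogeneous phase_self[OF skew])
  show "tlift (\<lambda>y z. mult H' y (antipode H' z)) (comul H' x) = counit H' x *\<^sub>C unity H'" for x
    unfolding deform_simps deform_hopf_simps
    by (rule deformed_antipode[OF _ _ antipode_right, where c = "\<lambda>r l. inverse (phase \<theta> r l)"])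
      (simp_all add: lin antipode_mult_homogeneous phase_self[OF skew])
qed (simp_all add: comul_linear counit_linear antipode_linear coassoc counit_left counit_right
    comul_unity counit_unity)

lemma deformed_comodule_algebra: "comodule_algebra H' A'"
proof (rule comodule_algebra.intro[OF deformed_hopf_algebra], rule comodule_algebra_axioms.intro)
  show "algebra_on UNIV A'"
    by (rule deform_algebra[OF comod_graded comod_algebra]) (rule comod_graded_mult)
  show "coact A' (mult A' x y) = tmult (mult A') (mult H') (coact A' x) (coact A' y)" for x y
    unfolding deform_simps deform_comod_simps
    by (rule deformed_coaction_mult[OF comod_graded graded amult_bilinear mult_bilinear coact_linear coact_mult graded_coact])
qed (simp_all add: coact_linear coact_coassoc coact_counit coact_unity)

end

section \<open>The carrier of the deformed bialgebroid\<close>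

context bigraded_extension
begin

lemma unity_H_homogeneous: "unity H \<in> GH (0, 0)"
  by (rule unity_homogeneous[OF graded algebra]) (rule graded_mult)

definition proj0 :: "'h \<Rightarrow> 'h" where
  "proj0 = gext GH (\<lambda>d h. if snd d = 0 then h else 0)"

lemma proj0_lin [lin]: "clinear f \<Longrightarrow> clinear (\<lambda>x. proj0 (f x))"
  unfolding proj0_def by (rule clinear_gext[OF graded]) (simp_all add: lin)

lemma proj0_homogeneous: "h \<in> GH (r, l) \<Longrightarrow> proj0 h = (if l = 0 then h else 0)"
  unfolding proj0_def
  using gext_homogeneous[OF graded, of h "(r, l)" "\<lambda>d h. if snd d = 0 then h else 0"] by (simp add: lin)

lemma proj0_unity: "proj0 (unity H) = unity H"
  using proj0_homogeneous[OF unity_H_homogeneous] by simp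

abbreviation diag' where "diag' \<equiv> comodule_algebra.tens_coact H' A' (coact A)"

lemma diag'_def: "diag' = tlift (\<lambda>a v. tlift (\<lambda>x h. tlift (\<lambda>m k. (x \<otimes> m) \<otimes> mH h k) (coact A v)) (coact A a))"
  by (simp add: comodule_algebra.tens_coact_def[OF deformed_comodule_algebra])

lemma diag'_lin [lin]: "clinear f \<Longrightarrow> clinear (\<lambda>x. diag' (f x))"
  by (simp add: diag'_def lin)

lemma diag_lin [lin]: "clinear f \<Longrightarrow> clinear (\<lambda>x. diag (f x))"
  by (simp add: lin coact_linear)

abbreviation tw where "tw \<omega> \<equiv> twist GA GA \<omega>"

lemma tw_lin [lin]: "clinear f \<Longrightarrow> clinear (\<lambda>x. tw \<omega> (f x))"
  by (rule twist_lin[OF comod_graded comod_graded])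

lemmas tw_homogeneous = twist_homogeneous[OF comod_graded comod_graded]

lemma coact2_eq:
  assumes "x \<in> GA (r, l)" "y \<in> GA (p, q)"
    and "cbilinear f" "cbilinear g"
    and "\<And>s t a h b k. a \<in> GA (r, s) \<Longrightarrow> h \<in> GH (s, l) \<Longrightarrow> b \<in> GA (p, t) \<Longrightarrow> k \<in> GH (t, q) \<Longrightarrow>
      f (a \<otimes> h) (b \<otimes> k) = g (a \<otimes> h) (b \<otimes> k)"
  shows "f (coact A x) (coact A y) = g (coact A x) (coact A y)"
  by (rule graded_tens_eq2[OF assms(3,4) graded_coact[OF assms(1)] graded_coact[OF assms(2)]]) (rule assms(5))

text \<open>A coaction keeps the right degree: the part of \<open>w\<close> with right degrees
  \<open>l\<close> and \<open>q\<close> has its \<open>H\<close>-leg in right degree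
  \<open>l + q\<close>.\<close>

lemma diag_proj0:
  "diag (tw (\<lambda>d e. if snd d + snd e = 0 then 1 else 0) w) = tmap id proj0 (diag w)"
proof -
  have "(\<lambda>w. diag (tw (\<lambda>d e. if snd d + snd e = 0 then 1 else 0) w)) = (\<lambda>w. tmap id proj0 (diag w))"
  proof (rule tensor_graded_ext[OF comod_graded comod_graded])
    fix d e x y assume x: "x \<in> GA d" and y: "y \<in> GA e"
    obtain r l p q where d: "d = (r, l)" "e = (p, q)" by (cases d, cases e)
    note x = x[unfolded d] and y = y[unfolded d]
    let ?c = "if l + q = 0 then 1 else 0 :: complex"
    have "tmap id proj0 (diag (x \<otimes> y)) =
        tlift (\<lambda>a h. tlift (\<lambda>b k. (a \<otimes> b) \<otimes> proj0 (mult H h k)) (coact A y)) (coact A x)"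
      by (simp add: tens_coact_tensor coact_linear push lin tmap_tensor)
    also have "\<dots> = ?c *\<^sub>C diag (x \<otimes> y)"
      unfolding tens_coact_tensor[OF coact_linear]
    proof (rule coact2_eq[OF x y])
      fix s t a h b k assume *: "a \<in> GA (r, s)" "h \<in> GH (s, l)" "b \<in> GA (p, t)" "k \<in> GH (t, q)"
      show "tlift (\<lambda>a h. tlift (\<lambda>b k. (a \<otimes> b) \<otimes> proj0 (mult H h k)) (b \<otimes> k)) (a \<otimes> h) =
        ?c *\<^sub>C tlift (\<lambda>a h. tlift (\<lambda>b k. (a \<otimes> b) \<otimes> mult H h k) (b \<otimes> k)) (a \<otimes> h)"
        by (simp add: tlift_tensor lin proj0_homogeneous[OF graded_mult[OF *(2,4)]] scaleC_one
          tensor_zero)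
    qed (simp_all add: lin)
    also have "\<dots> = diag (tw (\<lambda>d e. if snd d + snd e = 0 then 1 else 0) (x \<otimes> y))"
      by (simp add: tw_homogeneous[OF x y] clinear_scale[OF diag_lin[OF clinear_ident]])
    finally show "diag (tw (\<lambda>d e. if snd d + snd e = 0 then 1 else 0) (x \<otimes> y)) = tmap id proj0 (diag (x \<otimes> y))"
      by (simp add: d)
  qed (simp_all add: lin)
  then show ?thesis by (rule fun_cong)
qed

text \<open>The \<open>H\<close>-leg of a coinvariant is 1, of right degree zero. Hence only
  components with opposite right degrees occur, as \<open>diag_proj0\<close> and the counit show,
  and there \<open>\<omega>\<close> is 1.\<close>

lemma tw_coinvariant:
  assumes w: "w \<in> ES2" and \<omega>: "\<And>d e. snd d + snd e = 0 \<Longrightarrow> \<omega> d e = 1"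
  shows "tw \<omega> w = w"
proof -
  let ?o = "\<lambda>d e. if snd d + snd e = 0 then 1 else 0"
  interpret AA: hopf_bimodule H A raA diag laA
    by (rule hopf_bimodule_AA)
  have "diag (tw ?o w) = w \<otimes> unity H"
    using w by (simp add: diag_proj0 coinv_def tmap_tensor lin proj0_unity)
  then have "tw ?o w = tlift (\<lambda>x h. counit H h *\<^sub>C x) (w \<otimes> unity H)"
    using AA.co_counit[of "tw ?o w"] by simp
  also have "\<dots> = w" by (simp add: tlift_tensor lin counit_unity scaleC_one)
  finally have eq: "tw ?o w = w" .
  have "(\<lambda>d e. \<omega> d e * ?o d e) = ?o" using \<omega> by (auto simp: fun_eq_iff)
  then have "tw \<omega> (tw ?o w) = tw ?o w"
    by (simp add: twist_twist[OF comod_graded comod_graded])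
  then show ?thesis by (simp add: eq)
qed

text \<open>\<open>tin\<close> conjugates the diagonal coaction into the deformed one; it is the identity on
  coinvariants, whose inner degrees cancel.\<close>

abbreviation "tin \<equiv> tw (\<lambda>d e. phase \<theta> (snd d) (snd e))"
abbreviation "tin' \<equiv> tw (\<lambda>d e. inverse (phase \<theta> (snd d) (snd e)))"

text \<open>With right degrees \<open>l\<close>, \<open>q\<close> and inner degrees
  \<open>s\<close>, \<open>t\<close>, the deformed product in \<open>H\<close> contributes
  \<open>phase \<theta> s t\<close> and the inverse of \<open>phase \<theta> l q\<close>. The latter
  cancels \<open>tin\<close> before the coaction; the former is \<open>tin\<close> after it.\<close>

lemma diag'_tin: "diag' (tin w) = tmap tin id (diag w)"
proof -
  have "(\<lambda>w. diag' (tin w)) = (\<lambda>w. tmap tin id (diag w))"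
  proof (rule tensor_graded_ext[OF comod_graded comod_graded])
    fix d e x y assume x: "x \<in> GA d" and y: "y \<in> GA e"
    obtain r l p q where d: "d = (r, l)" "e = (p, q)" by (cases d, cases e)
    note x = x[unfolded d] and y = y[unfolded d]
    have "tmap tin id (diag (x \<otimes> y)) =
        tlift (\<lambda>a h. tlift (\<lambda>b k. tin (a \<otimes> b) \<otimes> mult H h k) (coact A y)) (coact A x)"
      by (simp add: tens_coact_tensor coact_linear push lin tmap_tensor)
    also have "\<dots> = phase \<theta> l q *\<^sub>C tlift (\<lambda>a h. tlift (\<lambda>b k. (a \<otimes> b) \<otimes> mH h k) (coact A y)) (coact A x)"
    proof (rule coact2_eq[OF x y])
      fix s t a h b k assume *: "a \<in> GA (r, s)" "h \<in> GH (s, l)" "b \<in> GA (p, t)" "k \<in> GH (t, q)"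
      show "tlift (\<lambda>a h. tlift (\<lambda>b k. tin (a \<otimes> b) \<otimes> mult H h k) (b \<otimes> k)) (a \<otimes> h) =
        phase \<theta> l q *\<^sub>C tlift (\<lambda>a h. tlift (\<lambda>b k. (a \<otimes> b) \<otimes> mH h k) (b \<otimes> k)) (a \<otimes> h)"
        by (simp add: tlift_tensor lin homH[OF *(2,4)] tw_homogeneous[OF *(1,3)]
          tensor_scale)
    qed (simp_all add: lin)
    also have "\<dots> = diag' (tin (x \<otimes> y))"
      by (simp add: tw_homogeneous[OF x y] clinear_scale[OF diag'_lin[OF clinear_ident]])
        (simp add: diag'_def tlift_tensor lin)
    finally show "diag' (tin (x \<otimes> y)) = tmap tin id (diag (x \<otimes> y))" by simp
  qed (simp_all add: lin)
  then show ?thesis by (rule fun_cong)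
qed

lemma deformed_es_carrier: "es_carrier H' A' = es_carrier H A"
proof -
  have car: "es_carrier H' A' = {w. diag' w = w \<otimes> unity H}"
    using comodule_algebra.es_carrier_eq[OF deformed_comodule_algebra] by (simp add: coinv_def)
  have zero: "phase \<theta> (snd d) (snd e) = 1" if "snd d + snd e = 0" for d e :: "'n bideg"
  proof -
    have "snd e = - snd d" using that by (simp add: eq_neg_iff_add_eq_0 add.commute)
    then show ?thesis by (simp add: phase_neg_right phase_self[OF skew])
  qed
  have inv: "tin (tin' w) = w" for w
    by (rule twist_inverse[OF comod_graded comod_graded phase_nonzero])
  have inv': "tin' (tin w) = w" for w
    by (rule twist_inverse[OF comod_graded comod_graded phase_nonzero])
  have tl: "clinear tin" "clinear tin'" by (simp_all add: lin)
  show ?thesis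
    unfolding car es_carrier_eq
  proof (intro equalityI subsetI CollectI)
    fix w assume w: "w \<in> ES2"
    then have "tin w = w" by (rule tw_coinvariant) (rule zero)
    then have "diag' w = tmap tin id (w \<otimes> unity H)"
      using diag'_tin[of w] w by (simp add: coinv_def)
    then show "diag' w = w \<otimes> unity H"
      using \<open>tin w = w\<close> by (simp add: tmap_tensor lin)
  next
    fix w assume "w \<in> {w. diag' w = w \<otimes> unity H}"
    \<comment> \<open>Conversely, \<open>tin' w\<close> is coinvariant for the original coaction,
      hence fixed by \<open>tin\<close>, and therefore equal to \<open>w\<close>.\<close>
    then have "tmap tin id (diag (tin' w)) = w \<otimes> unity H"
      using diag'_tin[of "tin' w"] by (simp add: inv)
    then have "tmap tin' id (tmap tin id (diag (tin' w))) = tin' w \<otimes> unity H"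
      by (simp add: tmap_tensor lin)
    then have "diag (tin' w) = tin' w \<otimes> unity H"
      by (simp only: tmap_tmap[OF tl(2) clinear_id tl(1) clinear_id] inv' id_apply)
        (simp add: tmap_def)
    then have mem: "tin' w \<in> ES2" by (simp add: coinv_def)
    then have "tin (tin' w) = tin' w" by (rule tw_coinvariant) (rule zero)
    then show "w \<in> ES2" using mem by (simp add: inv)
  qed
qed

end

section \<open>The deformed extension is Hopf-Galois\<close>

context bigraded_extension
begin

lemma deformed_coinvariants: "coinvariants H' A' = coinvariants H A"
  by (simp add: coinvariants_def)

lemma coact1_eq:
  assumes "x \<in> GA (r, l)" "clinear f" "clinear g"
    and "\<And>s a h. a \<in> GA (r, s) \<Longrightarrow> h \<in> GH (s, l) \<Longrightarrow> f (a \<otimes> h) = g (a \<otimes> h)"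
  shows "f (coact A x) = g (coact A x)"
  by (rule graded_tens_eq[OF assms(2,3) graded_coact[OF assms(1)]]) (rule assms(4))

text \<open>A coinvariant need not be homogeneous; a phase that depends on the left degree of
  \<open>b\<close> is absorbed by passing to \<open>scale1 k b\<close>, which is again coinvariant
  because the coaction keeps the left degree.\<close>

definition scale1 :: "(int ^ 'n \<Rightarrow> complex) \<Rightarrow> 'a \<Rightarrow> 'a" where
  "scale1 k = gext GA (\<lambda>d a. k (fst d) *\<^sub>C a)"

definition projA0 :: "'a \<Rightarrow> 'a" where
  "projA0 = gext GA (\<lambda>d a. if snd d = 0 then a else 0)"

lemma scale1_lin [lin]: "clinear f \<Longrightarrow> clinear (\<lambda>x. scale1 k (f x))"
  unfolding scale1_def by (rule clinear_gext[OF comod_graded]) (simp_all add: lin)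

lemma projA0_lin [lin]: "clinear f \<Longrightarrow> clinear (\<lambda>x. projA0 (f x))"
  unfolding projA0_def by (rule clinear_gext[OF comod_graded]) (simp_all add: lin)

lemma scale1_homogeneous: "a \<in> GA (r, l) \<Longrightarrow> scale1 k a = k r *\<^sub>C a"
  unfolding scale1_def
  using gext_homogeneous[OF comod_graded, of a "(r, l)" "\<lambda>d a. k (fst d) *\<^sub>C a"] by (simp add: lin)

lemma projA0_homogeneous: "a \<in> GA (r, l) \<Longrightarrow> projA0 a = (if l = 0 then a else 0)"
  unfolding projA0_def
  using gext_homogeneous[OF comod_graded, of a "(r, l)" "\<lambda>d a. if snd d = 0 then a else 0"] by (simp add: lin)

lemma scale1_coinvariant:
  assumes "b \<in> coinvariants H A" shows "scale1 k b \<in> coinvariants H A"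
proof -
  have "(\<lambda>a. coact A (scale1 k a)) = (\<lambda>a. tmap (scale1 k) id (coact A a))"
  proof (rule graded_ext[OF comod_graded])
    fix d x assume x: "x \<in> GA d"
    obtain r l where d: "d = (r, l)" by (cases d)
    note x = x[unfolded d]
    have "tmap (scale1 k) id (coact A x) = k r *\<^sub>C coact A x"
      by (rule coact1_eq[OF x])
        (simp_all add: lin tmap_tensor scale1_homogeneous tensor_scale)
    then show "coact A (scale1 k x) = tmap (scale1 k) id (coact A x)"
      by (simp add: scale1_homogeneous[OF x] clinear_scale[OF coact_linear])
  qed (simp_all add: lin)
  then show ?thesis
    using assms by (simp add: coinvariants_def fun_eq_iff tmap_tensor lin)
qed

lemma projA0_coinvariant:
  assumes "b \<in> coinvariants H A" shows "projA0 b = b"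
proof -
  have "(\<lambda>a. coact A (projA0 a)) = (\<lambda>a. tmap id proj0 (coact A a))"
  proof (rule graded_ext[OF comod_graded])
    fix d x assume x: "x \<in> GA d"
    obtain r l where d: "d = (r, l)" by (cases d)
    note x = x[unfolded d]
    have "tmap id proj0 (coact A x) = (if l = 0 then 1 else 0) *\<^sub>C coact A x"
      by (rule coact1_eq[OF x])
        (simp_all add: lin tmap_tensor proj0_homogeneous scaleC_one
          tensor_zero)
    then show "coact A (projA0 x) = tmap id proj0 (coact A x)"
      by (simp add: projA0_homogeneous[OF x] scaleC_one clinear_0[OF coact_linear])
  qed (simp_all add: lin)
  then have "coact A (projA0 b) = b \<otimes> unity H"
    using assms by (simp add: coinvariants_def fun_eq_iff tmap_tensor lin proj0_unity)
  then have "projA0 b = tlift (\<lambda>x h. counit H h *\<^sub>C x) (b \<otimes> unity H)"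
    using coact_counit[of "projA0 b"] by simp
  also have "\<dots> = b" by (simp add: tlift_tensor lin counit_unity scaleC_one)
  finally show ?thesis .
qed

abbreviation "tout \<equiv> tw (\<lambda>d e. phase \<theta> (fst d) (fst e))"
abbreviation "tout' \<equiv> tw (\<lambda>d e. inverse (phase \<theta> (fst d) (fst e)))"
abbreviation "tmix \<equiv> twist GA GH (\<lambda>d e. inverse (phase \<theta> (snd d) (fst e)))"

lemma tmix_lin [lin]: "clinear f \<Longrightarrow> clinear (\<lambda>x. tmix (f x))"
  by (rule twist_lin[OF comod_graded graded])

lemma can_lift'_lin [lin]: "clinear f \<Longrightarrow> clinear (\<lambda>x. can_lift A' (f x))"
  by (rule comodule_algebra.can_lift_lin[OF deformed_comodule_algebra])

text \<open>For degrees \<open>(r, s)\<close>, \<open>(p, q)\<close> and inner degree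
  \<open>t\<close>, the deformed product carries \<open>phase \<theta> r p\<close>, supplied by
  \<open>tout\<close>, and the inverse of \<open>phase \<theta> s t\<close>. The latter is
  \<open>tmix\<close> at right degree \<open>s + t\<close> and left degree \<open>t\<close>, since
  \<open>phase \<theta> t t = 1\<close>.\<close>

lemma deformed_can_lift: "can_lift A' w = tmix (can_lift A (tout w))"
proof -
  have "can_lift A' = (\<lambda>w. tmix (can_lift A (tout w)))"
  proof (rule tensor_graded_ext[OF comod_graded comod_graded])
    fix d e x y assume x: "x \<in> GA d" and y: "y \<in> GA e"
    obtain r s p q where d: "d = (r, s)" "e = (p, q)" by (cases d, cases e)
    note x = x[unfolded d] and y = y[unfolded d]
    have "can_lift A' (x \<otimes> y) = tlift (\<lambda>a h. mA x a \<otimes> h) (coact A y)"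
      using comodule_algebra.can_lift_tensor[OF deformed_comodule_algebra, of x y] by simp
    also have "\<dots> = phase \<theta> r p *\<^sub>C tlift (\<lambda>a h. tmix (mult A x a \<otimes> h)) (coact A y)"
    proof (rule coact1_eq[OF y])
      fix t a h assume *: "a \<in> GA (p, t)" "h \<in> GH (t, q)"
      show "tlift (\<lambda>a h. mA x a \<otimes> h) (a \<otimes> h) = phase \<theta> r p *\<^sub>C tlift (\<lambda>a h. tmix (mult A x a \<otimes> h)) (a \<otimes> h)"
        by (simp add: tlift_tensor lin homA[OF x *(1)] tensor_scale
          twist_homogeneous[OF comod_graded graded comod_graded_mult[OF x *(1)] *(2)]
          phase_add_left phase_self[OF skew])
    qed (simp_all add: lin)
    also have "\<dots> = tmix (can_lift A (tout (x \<otimes> y)))"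
      using tlift_push[of tmix "\<lambda>a h. mult A x a \<otimes> h" "coact A y"]
      by (simp add: tw_homogeneous[OF x y] can_lift_tensor lin
        clinear_scale[OF can_lift_lin[OF clinear_ident]] clinear_scale[OF tmix_lin[OF clinear_ident]])
    finally show "can_lift A' (x \<otimes> y) = tmix (can_lift A (tout (x \<otimes> y)))" .
  qed (simp_all add: lin)
  then show ?thesis by (rule fun_cong)
qed

abbreviation bal' :: "('a \<otimes> 'a) set" where
  "bal' \<equiv> balance (coinvariants H A) mA mA UNIV UNIV"

text \<open>For fixed homogeneous \<open>x\<close> and \<open>y\<close>, the relation for
  \<open>b\<close> is sent to the deformed relation for a rescaled coinvariant. Coinvariants have
  right degree zero, so the right degrees of \<open>x\<close> and \<open>y\<close> contribute no
  phase.\<close>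

lemma tout'_bal: "u \<in> bal \<Longrightarrow> tout' u \<in> bal'"
proof -
  assume u: "u \<in> bal"
  have gen: "tout' (mult A x b \<otimes> y - x \<otimes> mult A b y) \<in> bal'" if b: "b \<in> coinvariants H A" for x b y
  proof -
    let ?f = "\<lambda>x y. tout' (mult A x b \<otimes> y - x \<otimes> mult A b y)"
    have hom: "?f x y \<in> bal'" if x: "x \<in> GA d" and y: "y \<in> GA e" for x y d e
    proof -
      obtain r s p q where d: "d = (r, s)" "e = (p, q)" by (cases d, cases e)
      note x = x[unfolded d] and y = y[unfolded d]
      \<comment> \<open>For \<open>b\<close> of left degree \<open>m\<close> both terms need the
        same correction: inverting the phase of \<open>r + m\<close> and \<open>p\<close> or that of
        \<open>r\<close> and \<open>m + p\<close>, and dividing by the phase of the deformed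
        product, leaves the inverse phases of all three pairs.\<close>
      define k where "k m = inverse (phase \<theta> r m * phase \<theta> m p * phase \<theta> r p)" for m
      have 1: "tout' (mult A x (projA0 c) \<otimes> y) = mA x (scale1 k (projA0 c)) \<otimes> y" for c
      proof -
        have "(\<lambda>c. tout' (mult A x (projA0 c) \<otimes> y)) = (\<lambda>c. mA x (scale1 k (projA0 c)) \<otimes> y)"
        proof (rule graded_ext[OF comod_graded])
          fix d c assume c: "c \<in> GA d"
          obtain m n where d: "d = (m, n)" by (cases d)
          note c = c[unfolded d]
          show "tout' (mult A x (projA0 c) \<otimes> y) = mA x (scale1 k (projA0 c)) \<otimes> y"
          proof (cases "n = 0")
            case True
            then show ?thesis
              using c by (simp add: projA0_homogeneous scale1_homogeneous[OF c] clinear_scale[OF mA_lin(2)[OF clinear_ident]]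
                homA[OF x c] tw_homogeneous[OF comod_graded_mult[OF x c] y] k_def phase_add_left
                tensor_scale mult.commute)
          next
            case False
            then show ?thesis
              using c by (simp add: projA0_homogeneous[OF c] clinear_0[OF amult_lin(2)[OF clinear_ident]]
                clinear_0[OF mA_lin(2)[OF clinear_ident]] clinear_0[OF scale1_lin[OF clinear_ident]]
                tensor_zero clinear_0[OF tw_lin[OF clinear_ident]])
          qed
        qed (simp_all add: lin)
        then show ?thesis by (rule fun_cong)
      qed
      have 2: "tout' (x \<otimes> mult A (projA0 c) y) = x \<otimes> mA (scale1 k (projA0 c)) y" for c
      proof -
        have "(\<lambda>c. tout' (x \<otimes> mult A (projA0 c) y)) = (\<lambda>c. x \<otimes> mA (scale1 k (projA0 c)) y)"
        proof (rule graded_ext[OF comod_graded])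
          fix d c assume c: "c \<in> GA d"
          obtain m n where d: "d = (m, n)" by (cases d)
          note c = c[unfolded d]
          show "tout' (x \<otimes> mult A (projA0 c) y) = x \<otimes> mA (scale1 k (projA0 c)) y"
          proof (cases "n = 0")
            case True
            then show ?thesis
              using c by (simp add: projA0_homogeneous scale1_homogeneous[OF c] clinear_scale[OF mA_lin(1)[OF clinear_ident]]
                homA[OF c y] tw_homogeneous[OF x comod_graded_mult[OF c y]] k_def phase_add_right
                tensor_scale mult.commute)
          next
            case False
            then show ?thesis
              using c by (simp add: projA0_homogeneous[OF c] clinear_0[OF amult_lin(1)[OF clinear_ident]]
                clinear_0[OF mA_lin(1)[OF clinear_ident]] clinear_0[OF scale1_lin[OF clinear_ident]]
                tensor_zero clinear_0[OF tw_lin[OF clinear_ident]])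
          qed
        qed (simp_all add: lin)
        then show ?thesis by (rule fun_cong)
      qed
      have "?f x y = mA x (scale1 k b) \<otimes> y - x \<otimes> mA (scale1 k b) y"
        using 1[of b] 2[of b] by (simp add: projA0_coinvariant[OF b] clinear_diff[OF tw_lin[OF clinear_ident]])
      then show ?thesis
        using scale1_coinvariant[OF b] by (simp add: balance_base)
    qed
    have "?f x y \<in> bal'" if x: "x \<in> GA d" for x y d
      by (rule graded_in_subspace[OF comod_graded, of "?f x"]) (simp_all add: lin balance_subspace hom[OF x])
    note hom' = this
    show ?thesis
      by (rule graded_in_subspace[OF comod_graded, of "\<lambda>x. ?f x y"]) (simp_all add: lin balance_subspace hom')
  qed
  show ?thesis
    using u unfolding balance_def[of _ "mult A"]
    by (rule clinear_image_span_subset[of tout', rotated 3])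
      (use gen in \<open>auto simp: lin balance_subspace\<close>)
qed

text \<open>\<open>can_lift A'\<close> is \<open>can_lift A\<close> between two invertible twists,
  so surjectivity carries over; the kernel condition follows with \<open>tout'_bal\<close>.\<close>

lemma deformed_hopf_galois:
  assumes "hopf_galois H A"
  shows "hopf_galois H' A'"
proof -
  have surj: "surj (can_lift A)" and ker: "\<And>w. can_lift A w = 0 \<Longrightarrow> w \<in> bal"
    using assms by (simp_all add: hopf_galois_iff)
  let ?tmix' = "twist GA GH (\<lambda>d e. phase \<theta> (snd d) (fst e))"
  have mix: "?tmix' (tmix u) = u" "tmix (?tmix' u) = u" for u
    using twist_inverse[OF comod_graded graded, of "\<lambda>d e. phase \<theta> (snd d) (fst e)"] by simp_all
  have out: "tout' (tout u) = u" "tout (tout' u) = u" for u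
    using twist_inverse[OF comod_graded comod_graded, of "\<lambda>d e. phase \<theta> (fst d) (fst e)"] by simp_all
  have "\<exists>w. v = can_lift A' w" for v
  proof -
    obtain u where "can_lift A u = ?tmix' v" using surj by (metis surjD)
    then have "can_lift A' (tout' u) = v" by (simp add: deformed_can_lift out mix)
    then show ?thesis by metis
  qed
  then have "surj (can_lift A')" by (simp add: surj_def)
  moreover have "w \<in> bal'" if "can_lift A' w = 0" for w
  proof -
    have "?tmix' (tmix (can_lift A (tout w))) = ?tmix' 0" using that by (simp add: deformed_can_lift)
    then have "can_lift A (tout w) = 0"
      by (simp add: mix clinear_0[OF twist_lin[OF comod_graded graded clinear_ident]])
    from tout'_bal[OF ker[OF this]] show ?thesis by (simp add: out)
  qed
  ultimately show ?thesis
    unfolding comodule_algebra.hopf_galois_iff[OF deformed_comodule_algebra]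
    by (simp add: deformed_coinvariants)
qed

end

theorem theorem5p2:
  fixes H :: "('h::complex_vector) hopf"
    and A :: "('a::complex_vector, 'h) comod"
    and GH :: "'n::finite bideg \<Rightarrow> 'h set"
    and GA :: "'n bideg \<Rightarrow> 'a set"
    and \<theta> :: "real ^ 'n ^ 'n"
  assumes "bigraded_hopf_algebra H GH"
    and "\<And>x y. mult H x y = mult H y x"
    and "bigraded_comodule_algebra H A GH GA"
    and "hopf_galois H A"
    and "faithfully_flat A (coinvariants H A)"
    and "transpose \<theta> = - \<theta>"
  shows "hopf_algebroid (ES H A) tflip \<and>
    hopf_galois (deform \<theta> GH H) (deform \<theta> GA A) \<and>
    es_carrier (deform \<theta> GH H) (deform \<theta> GA A) = es_carrier H A \<and>
    hopf_algebroid (ES (deform \<theta> GH H) (deform \<theta> GA A)) tflip"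
proof -
  interpret bigraded_extension H A GH GA \<theta>
    by (intro bigraded_extension.intro assms bigraded_extension_axioms.intro)
  have inv: "tlift (\<lambda>x y. mult H (antipode H y) x) (comul H h) = counit H h *\<^sub>C unity H" for h
    using antipode_right[of h] by (simp only: assms(2)[of "antipode H _"])
  have gal: "galois_extension H A"
    by (intro galois_extension.intro galois_extension_axioms.intro comodule_algebra_axioms assms(4))
  \<comment> \<open>Faithful flatness is used here, for the original extension; through
    \<open>col\<close> the same maps \<open>\<phi>\<close> serve the deformed one.\<close>
  have int: "\<exists>\<phi>. clinear \<phi> \<and> \<phi> (unity H) = unity A \<and> (\<forall>h\<in>F. colinear_at \<phi> h)" if "finite F" for F
    by (rule galois_extension.integral_exists[OF gal assms(5) that])
  have flip: "tflip w \<in> es_carrier H A" if w: "w \<in> es_carrier H A" for w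
  proof -
    have "(\<lambda>w. diag (tflip w)) = (\<lambda>w. tmap tflip id (diag w))"
    proof (rule tensor_ext)
      fix x y
      have "diag (tflip (x \<otimes> y)) =
          tlift (\<lambda>b k. tlift (\<lambda>a h. (b \<otimes> a) \<otimes> mult H h k) (coact A x)) (coact A y)"
        using assms(2) by (simp add: tens_coact_tensor coact_linear)
      also have "\<dots> = tlift (\<lambda>a h. tlift (\<lambda>b k. (b \<otimes> a) \<otimes> mult H h k) (coact A y)) (coact A x)"
        by (rule tlift_swap) (simp_all add: lin)
      also have "\<dots> = tmap tflip id (diag (x \<otimes> y))"
        by (simp add: tens_coact_tensor coact_linear push lin tmap_tensor)
      finally show "diag (tflip (x \<otimes> y)) = tmap tflip id (diag (x \<otimes> y))" .
    qed (simp_all add: lin)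
    then show ?thesis
      using w by (simp add: es_carrier_eq coinv_def fun_eq_iff tmap_tensor lin)
  qed
  have "ehresmann_schauenburg H A"
    by (intro ehresmann_schauenburg.intro integrable_extension.intro gal integrable_extension_axioms.intro
        ehresmann_schauenburg_axioms.intro inv int flip)
  then have 1: "hopf_algebroid (ES H A) tflip"
    by (rule ehresmann_schauenburg.hopf_algebroid_ES)
  have 2: "hopf_galois H' A'" by (rule deformed_hopf_galois[OF assms(4)])
  have gal': "galois_extension H' A'"
    by (intro galois_extension.intro galois_extension_axioms.intro deformed_comodule_algebra 2)
  have col: "comodule_algebra.colinear_at H' A' = colinear_at"
    by (simp add: fun_eq_iff colinear_at_def comodule_algebra.colinear_at_def[OF deformed_comodule_algebra])
  have "ehresmann_schauenburg H' A'"
    by (intro ehresmann_schauenburg.intro integrable_extension.intro gal' integrable_extension_axioms.intro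
        ehresmann_schauenburg_axioms.intro)
      (simp_all add: deformed_antipode_inv[OF inv] col int deformed_es_carrier flip)
  then have 4: "hopf_algebroid (ES H' A') tflip"
    by (rule ehresmann_schauenburg.hopf_algebroid_ES)
  show ?thesis using 1 2 deformed_es_carrier 4 by simp
qed

end
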